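(* Let $G$ be a compact Lie group, let $\rho\colon G\to O(2)$ be an orthogonal representation, and let $S(\rho)$ be the unit circle of the corresponding $G$-module. If $\rho(G)\subset SO(2)$, then every complex $G$-vector bundle over $S(\rho)$ is trivial.
   Context: A complex $G$-vector bundle over a $G$-space $X$ is trivial if it is isomorphic to a product bundle $X\times W$ with $W$ a (finite-dimensional complex) $G$-module as its fiber. *)

theory Defs
  imports "HOL-Analysis.Analysis" "HOL-Algebra.Algebraic_Closure_Type" "HOL-Algebra.Group_Action"
begin

section \<open>Smooth manifolds and Lie groups\<close>

text \<open>
  Manifolds are modelled on \<^const>\<open>Euclidean_space\<close> \<open>n\<close>, with \<open>n\<close> a natural number, so that
  dimension 0 (hence every finite group) is included.
\<close>

definition partial_deriv :: "nat \<Rightarrow> ((nat \<Rightarrow> real) \<Rightarrow> real) \<Rightarrow> (nat \<Rightarrow> real) \<Rightarrow> real"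
  where "partial_deriv i f x = deriv (\<lambda>t. f (x(i := t))) (x i)"

primrec Ck_on :: "nat \<Rightarrow> nat \<Rightarrow> (nat \<Rightarrow> real) set \<Rightarrow> ((nat \<Rightarrow> real) \<Rightarrow> real) \<Rightarrow> bool"
  where
    "Ck_on n 0 U f \<longleftrightarrow> continuous_map (subtopology (Euclidean_space n) U) euclidean f"
  | "Ck_on n (Suc k) U f \<longleftrightarrow>
       continuous_map (subtopology (Euclidean_space n) U) euclidean f \<and>
       (\<forall>i<n. (\<forall>x\<in>U. (\<lambda>t. f (x(i := t))) differentiable (at (x i))) \<and>
              Ck_on n k U (partial_deriv i f))"

text \<open>Only meaningful for \<open>U\<close> open in \<^const>\<open>Euclidean_space\<close> \<open>n\<close>.\<close>

definition smooth_on :: "nat \<Rightarrow> nat \<Rightarrow> (nat \<Rightarrow> real) set \<Rightarrow> ((nat \<Rightarrow> real) \<Rightarrow> nat \<Rightarrow> real) \<Rightarrow> bool"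
  where "smooth_on n m U F \<longleftrightarrow> (\<forall>j<m. \<forall>k. Ck_on n k U (\<lambda>x. F x j))"

type_synonym 'a chart = "'a set \<times> ('a \<Rightarrow> nat \<Rightarrow> real)"

definition smooth_atlas :: "'a topology \<Rightarrow> nat \<Rightarrow> 'a chart set \<Rightarrow> bool"
  where "smooth_atlas T n A \<longleftrightarrow>
    (\<forall>(U, \<phi>)\<in>A. openin T U \<and> openin (Euclidean_space n) (\<phi> ` U) \<and>
       homeomorphic_map (subtopology T U) (subtopology (Euclidean_space n) (\<phi> ` U)) \<phi>) \<and>
    \<Union> (fst ` A) = topspace T \<and>
    (\<forall>(U, \<phi>)\<in>A. \<forall>(V, \<psi>)\<in>A. smooth_on n n (\<phi> ` (U \<inter> V)) (\<psi> \<circ> inv_into U \<phi>))"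

definition smooth_manifold :: "'a topology \<Rightarrow> nat \<Rightarrow> 'a chart set \<Rightarrow> bool"
  where "smooth_manifold T n A \<longleftrightarrow>
    Hausdorff_space T \<and> second_countable T \<and> smooth_atlas T n A"

definition smooth_map ::
  "'a topology \<Rightarrow> nat \<Rightarrow> 'a chart set \<Rightarrow> 'b topology \<Rightarrow> nat \<Rightarrow> 'b chart set \<Rightarrow> ('a \<Rightarrow> 'b) \<Rightarrow> bool"
  where "smooth_map S n A T m B f \<longleftrightarrow>
    continuous_map S T f \<and>
    (\<forall>(U, \<phi>)\<in>A. \<forall>(V, \<psi>)\<in>B. smooth_on n m (\<phi> ` (U \<inter> f -` V)) (\<psi> \<circ> f \<circ> inv_into U \<phi>))"

definition append_coords :: "nat \<Rightarrow> (nat \<Rightarrow> real) \<Rightarrow> (nat \<Rightarrow> real) \<Rightarrow> nat \<Rightarrow> real"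
  where "append_coords n u v = (\<lambda>i. if i < n then u i else v (i - n))"

definition prod_atlas :: "nat \<Rightarrow> 'a chart set \<Rightarrow> 'b chart set \<Rightarrow> ('a \<times> 'b) chart set"
  where "prod_atlas n A B =
    {(U \<times> V, \<lambda>(x, y). append_coords n (\<phi> x) (\<psi> y)) | U \<phi> V \<psi>. (U, \<phi>) \<in> A \<and> (V, \<psi>) \<in> B}"

locale lie_group = group G for G (structure) +
  fixes T :: "'a topology" and n :: nat and A :: "'a chart set"
  assumes topspace_eq: "topspace T = carrier G"
    and smooth_manifold: "smooth_manifold T n A"
    and smooth_mult:
      "smooth_map (prod_topology T T) (n + n) (prod_atlas n A A) T n A (\<lambda>(x, y). x \<otimes> y)"
    and smooth_inv: "smooth_map T n A T n A (\<lambda>x. inv x)"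

locale compact_lie_group = lie_group +
  assumes compact: "compact_space T"


section \<open>\<open>G\<close>-spaces, representations and \<open>G\<close>-modules\<close>

text \<open>The restriction is needed because \<^const>\<open>BijGroup\<close> consists of extensional functions.\<close>

definition G_space ::
  "('g, 'm) monoid_scheme \<Rightarrow> 'g topology \<Rightarrow> 'x topology \<Rightarrow> ('g \<Rightarrow> 'x \<Rightarrow> 'x) \<Rightarrow> bool"
  where "G_space G T Y a \<longleftrightarrow>
    group_action G (topspace Y) (\<lambda>g. restrict (a g) (topspace Y)) \<and>
    continuous_map (prod_topology T Y) Y (\<lambda>(g, x). a g x)"

definition orthogonal_group :: "(real^'n^'n) monoid"
  where "orthogonal_group =
    \<lparr>carrier = {M. orthogonal_matrix M}, mult = (**), one = mat 1\<rparr>"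

definition orthogonal_representation ::
  "('g, 'm) monoid_scheme \<Rightarrow> 'g topology \<Rightarrow> ('g \<Rightarrow> real^'n^'n) \<Rightarrow> bool"
  where "orthogonal_representation G T \<rho> \<longleftrightarrow>
    \<rho> \<in> hom G orthogonal_group \<and> continuous_map T euclidean \<rho>"

definition complex_field :: "complex ring"
  where "complex_field = ring_of_type_algebra"

text \<open>The ring multiplication and unit of a \<^typ>\<open>('a, 'b) module\<close> record carry no meaning.\<close>

definition linear_on ::
  "(complex, 'v) module \<Rightarrow> (complex, 'w) module \<Rightarrow> ('v \<Rightarrow> 'w) \<Rightarrow> bool"
  where "linear_on V W f \<longleftrightarrow>
    f \<in> carrier V \<rightarrow> carrier W \<and>
    (\<forall>u\<in>carrier V. \<forall>v\<in>carrier V. f (u \<oplus>\<^bsub>V\<^esub> v) = f u \<oplus>\<^bsub>W\<^esub> f v) \<and>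
    (\<forall>c. \<forall>v\<in>carrier V. f (c \<odot>\<^bsub>V\<^esub> v) = c \<odot>\<^bsub>W\<^esub> f v)"

text \<open>Complex \<open>n\<close>-space, encoded in the same way as \<^const>\<open>Euclidean_space\<close>.\<close>

definition Complex_space :: "nat \<Rightarrow> (nat \<Rightarrow> complex) topology"
  where "Complex_space n =
    subtopology (product_topology (\<lambda>i. euclidean) UNIV) {x. \<forall>i\<ge>n. x i = 0}"

definition complex_vectors :: "nat \<Rightarrow> (complex, nat \<Rightarrow> complex) module"
  where "complex_vectors n =
    \<lparr>carrier = topspace (Complex_space n), mult = undefined, one = undefined,
     zero = (\<lambda>i. 0), add = (\<lambda>u v i. u i + v i), smult = (\<lambda>c v i. c * v i)\<rparr>"

text \<open>A finite-dimensional complex \<open>G\<close>-module with underlying vector space complex \<open>n\<close>-space.\<close>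

definition complex_G_module ::
  "('g, 'm) monoid_scheme \<Rightarrow> 'g topology \<Rightarrow> nat \<Rightarrow> ('g \<Rightarrow> (nat \<Rightarrow> complex) \<Rightarrow> nat \<Rightarrow> complex) \<Rightarrow> bool"
  where "complex_G_module G T n \<sigma> \<longleftrightarrow>
    G_space G T (Complex_space n) \<sigma> \<and>
    (\<forall>g\<in>carrier G. linear_on (complex_vectors n) (complex_vectors n) (\<sigma> g))"


section \<open>Complex \<open>G\<close>-vector bundles\<close>

record ('x, 'e) vbundle =
  base_space :: "'x topology"
  total_space :: "'e topology"
  proj :: "'e \<Rightarrow> 'x"
  fibre :: "'x \<Rightarrow> (complex, 'e) module"

definition restrict_bundle :: "('x, 'e) vbundle \<Rightarrow> 'x set \<Rightarrow> ('x, 'e) vbundle"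
  where "restrict_bundle E U =
    \<lparr>base_space = subtopology (base_space E) U,
     total_space = subtopology (total_space E) {e \<in> topspace (total_space E). proj E e \<in> U},
     proj = proj E, fibre = fibre E\<rparr>"

definition product_bundle :: "'x topology \<Rightarrow> nat \<Rightarrow> ('x, 'x \<times> (nat \<Rightarrow> complex)) vbundle"
  where "product_bundle Y n =
    \<lparr>base_space = Y,
     total_space = prod_topology Y (Complex_space n),
     proj = fst,
     fibre = (\<lambda>x.
       \<lparr>carrier = {x} \<times> carrier (complex_vectors n), mult = undefined, one = undefined,
        zero = (x, \<zero>\<^bsub>complex_vectors n\<^esub>),
        add = (\<lambda>(_, u) (_, v). (x, u \<oplus>\<^bsub>complex_vectors n\<^esub> v)),
        smult = (\<lambda>c (_, v). (x, c \<odot>\<^bsub>complex_vectors n\<^esub> v))\<rparr>)\<rparr>"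

definition bundle_iso :: "('x, 'e) vbundle \<Rightarrow> ('x, 'f) vbundle \<Rightarrow> ('e \<Rightarrow> 'f) \<Rightarrow> bool"
  where "bundle_iso E F f \<longleftrightarrow>
    base_space E = base_space F \<and>
    homeomorphic_map (total_space E) (total_space F) f \<and>
    (\<forall>e\<in>topspace (total_space E). proj F (f e) = proj E e) \<and>
    (\<forall>x\<in>topspace (base_space E). linear_on (fibre E x) (fibre F x) f)"

definition complex_vector_bundle :: "('x, 'e) vbundle \<Rightarrow> bool"
  where "complex_vector_bundle E \<longleftrightarrow>
    continuous_map (total_space E) (base_space E) (proj E) \<and>
    (\<forall>x\<in>topspace (base_space E).
       module complex_field (fibre E x) \<and>
       carrier (fibre E x) = {e \<in> topspace (total_space E). proj E e = x}) \<and>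
    (\<forall>x\<in>topspace (base_space E). \<exists>U n h.
       openin (base_space E) U \<and> x \<in> U \<and>
       bundle_iso (restrict_bundle E U) (product_bundle (subtopology (base_space E) U) n) h)"

text \<open>\<open>a\<close> is the action on the base and \<open>b\<close> the action on the total space.\<close>

definition complex_G_vector_bundle ::
  "('g, 'm) monoid_scheme \<Rightarrow> 'g topology \<Rightarrow> ('x, 'e) vbundle \<Rightarrow>
   ('g \<Rightarrow> 'x \<Rightarrow> 'x) \<Rightarrow> ('g \<Rightarrow> 'e \<Rightarrow> 'e) \<Rightarrow> bool"
  where "complex_G_vector_bundle G T E a b \<longleftrightarrow>
    complex_vector_bundle E \<and>
    G_space G T (base_space E) a \<and>
    G_space G T (total_space E) b \<and>
    (\<forall>g\<in>carrier G. \<forall>e\<in>topspace (total_space E). proj E (b g e) = a g (proj E e)) \<and>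
    (\<forall>g\<in>carrier G. \<forall>x\<in>topspace (base_space E). linear_on (fibre E x) (fibre E (a g x)) (b g))"

definition G_bundle_iso ::
  "('g, 'm) monoid_scheme \<Rightarrow> ('x, 'e) vbundle \<Rightarrow> ('g \<Rightarrow> 'e \<Rightarrow> 'e) \<Rightarrow>
   ('x, 'f) vbundle \<Rightarrow> ('g \<Rightarrow> 'f \<Rightarrow> 'f) \<Rightarrow> ('e \<Rightarrow> 'f) \<Rightarrow> bool"
  where "G_bundle_iso G E b F c f \<longleftrightarrow>
    bundle_iso E F f \<and>
    (\<forall>g\<in>carrier G. \<forall>e\<in>topspace (total_space E). f (b g e) = c g (f e))"

definition trivial_G_vector_bundle ::
  "('g, 'm) monoid_scheme \<Rightarrow> 'g topology \<Rightarrow> ('x, 'e) vbundle \<Rightarrow>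
   ('g \<Rightarrow> 'x \<Rightarrow> 'x) \<Rightarrow> ('g \<Rightarrow> 'e \<Rightarrow> 'e) \<Rightarrow> bool"
  where "trivial_G_vector_bundle G T E a b \<longleftrightarrow>
    (\<exists>n \<sigma> f. complex_G_module G T n \<sigma> \<and>
       G_bundle_iso G E b (product_bundle (base_space E) n) (\<lambda>g (x, w). (a g x, \<sigma> g w)) f)"

end

theory Submission
  imports Defs "HOL-Computational_Algebra.Fundamental_Theorem_Algebra"
begin

text \<open>
  After the choice of a finite frame, a \<open>G\<close>-vector bundle over the circle on which \<open>G\<close> acts by rotations
  becomes a matrix cocycle over the circle. Averaging over \<open>G\<close> the projections to the fibres gives, for small
  \<open>t\<close>, equivariant isomorphisms \<open>h t\<close> covering the rotation by \<open>cis t\<close>. The point is to extend them to an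
  equivariant flow of period \<open>2 * pi\<close>; it suffices to do so for irreducible cocycles, whose endomorphisms are
  scalar by Schur's lemma. If the image of \<open>G\<close> in the circle has order \<open>m\<close>, the
  isomorphisms over an arc whose length divides \<open>2 * pi / m\<close> are continued to all \<open>t\<close> by composition, and
  \<open>h (s + t)\<close> composed with the inverse of \<open>h t\<close>, both at \<open>1\<close>, gives the flow at \<open>cis t\<close>. If the image is the
  whole circle, \<open>h s\<close> composed with \<open>h t\<close> is a scalar multiple of \<open>h (s + t)\<close>, and this scalar 2-cocycle is
  a coboundary. In both cases \<open>h (2 * pi)\<close> is a scalar, which rescaling turns into \<open>1\<close>.
  A periodic equivariant flow identifies every fibre with the fibre over \<open>1\<close>, and under this identification the
  action of \<open>G\<close> does not depend on the base point.
\<close>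

section \<open>Finitely supported complex matrices\<close>

text \<open>Rotations commute with each other, so the rotation by \<open>cis t\<close> is a
  \<open>G\<close>-map of the circle and equivariant lifts of it make sense. Lifts chosen
  independently for different \<open>t\<close> need not compose, and after a full turn they need not
  return to the identity of the fibre. These defects are automorphisms over the identity of the
  circle; once they are numbers they have logarithms and can be averaged or rescaled away, which is
  why the bundle is split first. The splitting uses no invariant inner product: an endomorphism
  minus one of its eigenvalues has an equivariant generalised inverse, and the product of the two is
  an equivariant idempotent. Making the generalised inverse continuous requires the endomorphisms of
  different fibres to be conjugate with uniform bounds; these conjugations come from a flow or from
  a transitive group. Integration over \<open>G\<close> is von Neumann's mean, built from averages
  of finitely many translates. Fibres are ranges of idempotents in one ambient space C^N, so all
  inverses are relative to a source and a target idempotent.\<close>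

typedef fmat = "{f :: nat \<Rightarrow> nat \<Rightarrow> complex. \<exists>n. \<forall>i j. f i j \<noteq> 0 \<longrightarrow> i < n \<and> j < n}"
  morphisms entry Abs_fmat
  by (rule exI[of _ "\<lambda>i j. 0"]) auto

text \<open>All sizes share one type, so a single ring and a single norm serve every block. The ring
  has no unit; idempotents such as \<open>unit_fmat n\<close>, or later the projections
  \<open>p z\<close> to the fibres, take its part.\<close>

definition fmats :: "nat \<Rightarrow> fmat set"
  where "fmats n = {a. \<forall>i j. entry a i j \<noteq> 0 \<longrightarrow> i < n \<and> j < n}"

definition fmat_of :: "nat \<Rightarrow> (nat \<Rightarrow> nat \<Rightarrow> complex) \<Rightarrow> fmat"
  where "fmat_of n f = Abs_fmat (\<lambda>i j. if i < n \<and> j < n then f i j else 0)"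

lemma entry_Abs_fmat:
  assumes "\<And>i j. f i j \<noteq> 0 \<Longrightarrow> i < n \<and> j < n"
  shows "entry (Abs_fmat f) = f"
  using assms by (intro Abs_fmat_inverse) blast

lemma fmat_eqI: "(\<And>i j. entry a i j = entry b i j) \<Longrightarrow> a = b"
  using entry_inject[of a b] by blast

lemma fmats_exist: obtains n where "a \<in> fmats n"
  using entry[of a] by (auto simp: fmats_def)

lemma fmats_mono: "a \<in> fmats m \<Longrightarrow> m \<le> n \<Longrightarrow> a \<in> fmats n"
  by (force simp: fmats_def)

lemma fmats_entry_0: "a \<in> fmats n \<Longrightarrow> \<not> (i < n \<and> j < n) \<Longrightarrow> entry a i j = 0"
  by (auto simp: fmats_def)

lemma fmats_common2:
  obtains n where "a \<in> fmats n" "b \<in> fmats n"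
proof -
  obtain m k where "a \<in> fmats m" "b \<in> fmats k"
    using fmats_exist by metis
  then show ?thesis
    using that[of "max m k"] fmats_mono by (meson max.cobounded1 max.cobounded2)
qed

lemma fmats_common3:
  obtains n where "a \<in> fmats n" "b \<in> fmats n" "c \<in> fmats n"
proof -
  obtain m k where "a \<in> fmats m" "b \<in> fmats m" "c \<in> fmats k"
    using fmats_exist fmats_common2 by metis
  then show ?thesis
    using that[of "max m k"] fmats_mono by (meson max.cobounded1 max.cobounded2)
qed

lemma entry_fmat_of: "entry (fmat_of n f) i j = (if i < n \<and> j < n then f i j else 0)"
  unfolding fmat_of_def by (subst entry_Abs_fmat[of _ n]) (auto split: if_splits)

lemma fmat_of_in [simp]: "fmat_of n f \<in> fmats n"
  by (auto simp: fmats_def entry_fmat_of)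

instantiation fmat :: ab_group_add
begin

definition zero_fmat where "0 = Abs_fmat (\<lambda>i j. 0)"
definition plus_fmat where "a + b = Abs_fmat (\<lambda>i j. entry a i j + entry b i j)"
definition uminus_fmat where "- a = Abs_fmat (\<lambda>i j. - entry a i j)"
definition minus_fmat where "a - b = Abs_fmat (\<lambda>i j. entry a i j - entry b i j)"

lemma entry_0 [simp]: "entry 0 i j = 0"
  unfolding zero_fmat_def by (subst entry_Abs_fmat[of _ 0]) auto

lemma entry_plus [simp]: "entry (a + b) i j = entry a i j + entry b i j"
proof -
  obtain n where "a \<in> fmats n" "b \<in> fmats n"
    by (rule fmats_common2)
  then show ?thesis
    unfolding plus_fmat_def fmats_def
    by (subst entry_Abs_fmat[of _ n]) (auto, (metis add_0)+)
qed

lemma entry_minus [simp]: "entry (a - b) i j = entry a i j - entry b i j"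
proof -
  obtain n where "a \<in> fmats n" "b \<in> fmats n"
    by (rule fmats_common2)
  then show ?thesis
    unfolding minus_fmat_def fmats_def
    by (subst entry_Abs_fmat[of _ n]) (auto, metis+)
qed

lemma entry_uminus [simp]: "entry (- a) i j = - entry a i j"
proof -
  obtain n where "a \<in> fmats n"
    by (rule fmats_exist)
  then show ?thesis
    unfolding uminus_fmat_def fmats_def by (subst entry_Abs_fmat[of _ n]) auto
qed

instance
  by standard (auto intro!: fmat_eqI)

end

definition cscale :: "complex \<Rightarrow> fmat \<Rightarrow> fmat" (infixr "*\<^sub>c" 75)
  where "z *\<^sub>c a = Abs_fmat (\<lambda>i j. z * entry a i j)"

definition star :: "fmat \<Rightarrow> fmat"
  where "star a = Abs_fmat (\<lambda>i j. cnj (entry a j i))"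

lemma entry_cscale [simp]: "entry (z *\<^sub>c a) i j = z * entry a i j"
proof -
  obtain n where "a \<in> fmats n"
    by (rule fmats_exist)
  then show ?thesis
    unfolding cscale_def fmats_def by (subst entry_Abs_fmat[of _ n]) auto
qed

lemma entry_star [simp]: "entry (star a) i j = cnj (entry a j i)"
proof -
  obtain n where "a \<in> fmats n"
    by (rule fmats_exist)
  then show ?thesis
    unfolding star_def fmats_def by (subst entry_Abs_fmat[of _ n]) auto
qed

instantiation fmat :: ring
begin

text \<open>A factor has no distinguished size, so the sum runs over the finite support of a row of
  \<open>a\<close>; \<open>entry_times\<close> replaces it by a sum up to any bound for
  \<open>a\<close>.\<close>

definition times_fmat
  where "a * b = Abs_fmat (\<lambda>i j. \<Sum>k | entry a i k \<noteq> 0. entry a i k * entry b k j)"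

lemma entry_times_aux:
  assumes "a \<in> fmats n"
  shows "(\<Sum>k | entry a i k \<noteq> 0. entry a i k * entry b k j) = (\<Sum>k<n. entry a i k * entry b k j)"
  using assms by (intro sum.mono_neutral_left) (auto simp: fmats_def)

lemma entry_times:
  assumes "a \<in> fmats n"
  shows "entry (a * b) i j = (\<Sum>k<n. entry a i k * entry b k j)"
proof -
  obtain m where m: "a \<in> fmats m" "b \<in> fmats m"
    by (rule fmats_common2)
  have "entry (a * b) i j = (\<Sum>k | entry a i k \<noteq> 0. entry a i k * entry b k j)"
    unfolding times_fmat_def
  proof (subst entry_Abs_fmat[of _ m])
    fix i j
    assume "(\<Sum>k | entry a i k \<noteq> 0. entry a i k * entry b k j) \<noteq> 0"
    then obtain k where "entry a i k * entry b k j \<noteq> 0"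
      by (rule sum.not_neutral_contains_not_neutral)
    then show "i < m \<and> j < m"
      using m by (auto simp: fmats_def)
  qed auto
  then show ?thesis
    using entry_times_aux[OF assms] by simp
qed

instance
proof
  fix a b c :: fmat
  obtain n where n: "a \<in> fmats n" "b \<in> fmats n" "c \<in> fmats n"
    by (rule fmats_common3)
  show "a * b * c = a * (b * c)"
  proof (rule fmat_eqI)
    fix i j
    have "a * b \<in> fmats n"
      unfolding fmats_def
    proof (clarify)
      fix i j assume "entry (a * b) i j \<noteq> 0"
      then obtain k where "entry a i k * entry b k j \<noteq> 0"
        unfolding entry_times[OF n(1)] by (rule sum.not_neutral_contains_not_neutral)
      then show "i < n \<and> j < n"
        using n by (auto simp: fmats_def)
    qed
    then show "entry (a * b * c) i j = entry (a * (b * c)) i j"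
      using n by (simp add: entry_times[of _ n] sum_distrib_left sum_distrib_right mult.assoc) (rule sum.swap)
  qed
  show "(a + b) * c = a * c + b * c"
  proof (rule fmat_eqI)
    fix i j
    have "a + b \<in> fmats n"
      using n by (auto simp: fmats_def) (metis add_0)+
    then show "entry ((a + b) * c) i j = entry (a * c + b * c) i j"
      using n by (simp add: entry_times[of _ n] distrib_right sum.distrib)
  qed
  show "a * (b + c) = a * b + a * c"
    using n by (auto intro!: fmat_eqI simp: entry_times[of _ n] distrib_left sum.distrib)
qed

end

instantiation fmat :: real_vector
begin

definition scaleR_fmat where "r *\<^sub>R a = complex_of_real r *\<^sub>c a"

instance
  by standard (auto intro!: fmat_eqI simp: scaleR_fmat_def algebra_simps)

end

lemma entry_scaleR [simp]: "entry (r *\<^sub>R a) i j = complex_of_real r * entry a i j"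
  by (simp add: scaleR_fmat_def)

lemma fmats_0 [simp]: "0 \<in> fmats n"
  by (simp add: fmats_def)

lemma fmats_add [simp]: "a \<in> fmats n \<Longrightarrow> b \<in> fmats n \<Longrightarrow> a + b \<in> fmats n"
  by (auto simp: fmats_def) (metis add_0)+

lemma fmats_diff [simp]: "a \<in> fmats n \<Longrightarrow> b \<in> fmats n \<Longrightarrow> a - b \<in> fmats n"
  by (auto simp: fmats_def) metis+

lemma fmats_uminus [simp]: "a \<in> fmats n \<Longrightarrow> - a \<in> fmats n"
  by (auto simp: fmats_def)

lemma fmats_cscale [simp]: "a \<in> fmats n \<Longrightarrow> z *\<^sub>c a \<in> fmats n"
  by (auto simp: fmats_def)

lemma fmats_scaleR [simp]: "a \<in> fmats n \<Longrightarrow> r *\<^sub>R a \<in> fmats n"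
  by (auto simp: fmats_def)

lemma fmats_star [simp]: "a \<in> fmats n \<Longrightarrow> star a \<in> fmats n"
  by (auto simp: fmats_def)

lemma fmats_mult [simp]: 
  assumes "a \<in> fmats n" "b \<in> fmats n"
  shows "a * b \<in> fmats n"
  unfolding fmats_def
proof (clarify)
  fix i j assume "entry (a * b) i j \<noteq> 0"
  then obtain k where "entry a i k * entry b k j \<noteq> 0"
    unfolding entry_times[OF assms(1)] by (rule sum.not_neutral_contains_not_neutral)
  then show "i < n \<and> j < n"
    using assms by (auto simp: fmats_def)
qed

lemma fmats_sum [simp]: "(\<And>i. i \<in> I \<Longrightarrow> f i \<in> fmats n) \<Longrightarrow> sum f I \<in> fmats n"
  by (induction I rule: infinite_finite_induct) auto

lemma entry_sum: "entry (sum f I) i j = (\<Sum>k\<in>I. entry (f k) i j)"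
  by (induction I rule: infinite_finite_induct) auto

lemma cscale_mult_left [simp]: "(z *\<^sub>c a) * b = z *\<^sub>c (a * b)"
proof -
  obtain n where "a \<in> fmats n" by (rule fmats_exist)
  then show ?thesis
    by (auto intro!: fmat_eqI simp: entry_times[of _ n] sum_distrib_left mult.assoc)
qed

lemma cscale_mult_right [simp]: "a * (z *\<^sub>c b) = z *\<^sub>c (a * b)"
proof -
  obtain n where "a \<in> fmats n" by (rule fmats_exist)
  then show ?thesis
    by (auto intro!: fmat_eqI simp: entry_times[of _ n] sum_distrib_left mult_ac)
qed

lemma cscale_simps [simp]:
  "z *\<^sub>c w *\<^sub>c a = (z * w) *\<^sub>c a" "1 *\<^sub>c a = a" "0 *\<^sub>c a = 0" "z *\<^sub>c (0::fmat) = 0"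
  by (auto intro!: fmat_eqI)

lemma cscale_distribs:
  "z *\<^sub>c (a + b) = z *\<^sub>c a + z *\<^sub>c b" "z *\<^sub>c (a - b) = z *\<^sub>c a - z *\<^sub>c b"
  "(z + w) *\<^sub>c a = z *\<^sub>c a + w *\<^sub>c a" "(z - w) *\<^sub>c a = z *\<^sub>c a - w *\<^sub>c a"
  by (auto intro!: fmat_eqI simp: algebra_simps)

lemma cscale_minus [simp]: "z *\<^sub>c (- a) = - (z *\<^sub>c a)"
  by (auto intro!: fmat_eqI)

lemma cscale_cancel: "z *\<^sub>c a = w *\<^sub>c a \<Longrightarrow> a \<noteq> 0 \<Longrightarrow> z = w"
  by (metis entry_cscale entry_0 fmat_eqI mult_cancel_right)

lemma star_star [simp]: "star (star a) = a"
  by (auto intro!: fmat_eqI)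

lemma star_add [simp]: "star (a + b) = star a + star b"
  and star_diff [simp]: "star (a - b) = star a - star b"
  and star_0 [simp]: "star 0 = 0"
  and star_scaleR [simp]: "star (r *\<^sub>R a) = r *\<^sub>R star a"
  by (auto intro!: fmat_eqI)

lemma star_sum: "star (sum f I) = (\<Sum>i\<in>I. star (f i))"
  by (induction I rule: infinite_finite_induct) auto

lemma star_mult [simp]: "star (a * b) = star b * star a"
proof -
  obtain n where "a \<in> fmats n" "b \<in> fmats n" by (rule fmats_common2)
  then show ?thesis
    by (auto intro!: fmat_eqI simp: entry_times[of _ n] mult.commute)
qed

text \<open>Each diagonal entry of \<open>star a * a\<close> is the squared length of a column of
  \<open>a\<close>.\<close>

lemma star_mult_eq_0:
  assumes "star a * a = 0"
  shows "a = 0"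
proof (rule fmat_eqI)
  fix i j
  obtain n where n: "a \<in> fmats n" by (rule fmats_exist)
  have "(\<Sum>k<n. (cmod (entry a k j))\<^sup>2) = Re (entry (star a * a) j j)"
    using n by (simp add: entry_times[of _ n] mult.commute[of "cnj _"] complex_mult_cnj cmod_power2)
  also have "\<dots> = 0"
    using assms by simp
  finally have "\<forall>k<n. entry a k j = 0"
    by (subst (asm) sum_nonneg_eq_0_iff) auto
  then show "entry a i j = entry 0 i j"
    by (metis n entry_0 fmats_entry_0)
qed

instantiation fmat :: real_normed_algebra
begin

text \<open>The entrywise l1 norm: submultiplicative, invariant under \<open>star\<close>, and the
  same in every block that contains \<open>a\<close>.\<close>

definition norm_fmat where "norm a = (\<Sum>x | entry a (fst x) (snd x) \<noteq> 0. cmod (entry a (fst x) (snd x)))"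
definition dist_fmat :: "fmat \<Rightarrow> fmat \<Rightarrow> real" where "dist_fmat a b = norm (a - b)"
definition sgn_fmat :: "fmat \<Rightarrow> fmat" where "sgn_fmat a = a /\<^sub>R norm a"
definition uniformity_fmat :: "(fmat \<times> fmat) filter"
  where "uniformity_fmat = (INF e\<in>{0<..}. principal {(x, y). dist x y < e})"
definition open_fmat :: "fmat set \<Rightarrow> bool"
  where "open_fmat U = (\<forall>x\<in>U. eventually (\<lambda>(x', y). x' = x \<longrightarrow> y \<in> U) uniformity)"

lemma norm_fmat:
  assumes "a \<in> fmats n"
  shows "norm a = (\<Sum>i<n. \<Sum>j<n. cmod (entry a i j))"
proof -
  have "norm a = (\<Sum>x\<in>{..<n} \<times> {..<n}. cmod (entry a (fst x) (snd x)))"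
    unfolding norm_fmat_def using assms by (intro sum.mono_neutral_left) (auto simp: fmats_def)
  then show ?thesis
    by (simp add: sum.cartesian_product case_prod_beta)
qed

instance
proof
  fix a b :: fmat and r :: real
  obtain n where n: "a \<in> fmats n" "b \<in> fmats n"
    by (rule fmats_common2)
  have nn: "a + b \<in> fmats n" "r *\<^sub>R a \<in> fmats n" "a * b \<in> fmats n"
    using n by auto
  show "dist a b = norm (a - b)" by (rule dist_fmat_def)
  show "sgn a = a /\<^sub>R norm a" by (rule sgn_fmat_def)
  show "(uniformity :: (fmat \<times> fmat) filter) = (INF e\<in>{0<..}. principal {(x, y). dist x y < e})"
    by (rule uniformity_fmat_def)
  show "open U = (\<forall>x\<in>U. eventually (\<lambda>(x', y). x' = x \<longrightarrow> y \<in> U) uniformity)" for U :: "fmat set"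
    by (rule open_fmat_def)
  show "(norm a = 0) = (a = 0)"
  proof
    assume "norm a = 0"
    then have "\<forall>i<n. (\<Sum>j<n. cmod (entry a i j)) = 0"
      unfolding norm_fmat[OF n(1)] by (subst (asm) sum_nonneg_eq_0_iff) (auto intro!: sum_nonneg)
    then have "\<forall>i<n. \<forall>j<n. entry a i j = 0"
      by (simp add: sum_nonneg_eq_0_iff)
    then show "a = 0"
      by (intro fmat_eqI) (metis n(1) entry_0 fmats_entry_0)
  qed (simp add: norm_fmat_def)
  show "norm (a + b) \<le> norm a + norm b"
    unfolding norm_fmat[OF n(1)] norm_fmat[OF n(2)] norm_fmat[OF nn(1)] sum.distrib[symmetric]
    by (intro sum_mono) (auto intro: norm_triangle_ineq)
  show "norm (r *\<^sub>R a) = \<bar>r\<bar> * norm a"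
    unfolding norm_fmat[OF n(1)] norm_fmat[OF nn(2)] by (simp add: norm_mult sum_distrib_left)
  show "norm (a * b) \<le> norm a * norm b"
  proof -
    have "norm (a * b) \<le> (\<Sum>i<n. \<Sum>j<n. \<Sum>k<n. cmod (entry a i k) * cmod (entry b k j))"
      unfolding norm_fmat[OF nn(3)] entry_times[OF n(1)]
      by (intro sum_mono order.trans[OF norm_sum]) (simp add: norm_mult)
    also have "\<dots> = (\<Sum>i<n. \<Sum>k<n. cmod (entry a i k) * (\<Sum>j<n. cmod (entry b k j)))"
      by (subst sum.swap) (simp add: sum_distrib_left)
    also have "\<dots> \<le> (\<Sum>i<n. \<Sum>k<n. cmod (entry a i k) * norm b)"
    proof (intro sum_mono mult_left_mono)
      fix k assume "k \<in> {..<n}"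
      then show "(\<Sum>j<n. cmod (entry b k j)) \<le> norm b"
        unfolding norm_fmat[OF n(2)] by (intro member_le_sum) (auto intro: sum_nonneg)
    qed auto
    also have "\<dots> = norm a * norm b"
      unfolding norm_fmat[OF n(1)] by (simp add: sum_distrib_right)
    finally show ?thesis .
  qed
  show "r *\<^sub>R a * b = r *\<^sub>R (a * b)" "a * r *\<^sub>R b = r *\<^sub>R (a * b)"
    by (simp_all add: scaleR_fmat_def)
qed

end

lemma norm_cscale [simp]: "norm (z *\<^sub>c a) = cmod z * norm a"
proof -
  obtain n where n: "a \<in> fmats n" by (rule fmats_exist)
  then have "z *\<^sub>c a \<in> fmats n" by simp
  then show ?thesis
    using n by (simp add: norm_fmat[of _ n] norm_mult sum_distrib_left)
qed

lemma norm_star [simp]: "norm (star a) = norm a"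
proof -
  obtain n where n: "a \<in> fmats n" by (rule fmats_exist)
  then have "star a \<in> fmats n" by simp
  then show ?thesis
    using n by (simp add: norm_fmat[of _ n]) (rule sum.swap)
qed

lemma norm_entry_le: "cmod (entry a i j) \<le> norm a"
proof -
  obtain n where n: "a \<in> fmats n" by (rule fmats_exist)
  show ?thesis
  proof (cases "i < n \<and> j < n")
    case True
    then have "cmod (entry a i j) \<le> (\<Sum>j<n. cmod (entry a i j))"
      by (intro member_le_sum) auto
    also have "\<dots> \<le> norm a"
      unfolding norm_fmat[OF n] using True by (intro member_le_sum) (auto intro: sum_nonneg)
    finally show ?thesis .
  qed (simp add: fmats_entry_0[OF n])
qed

lemma bounded_bilinear_cscale: "bounded_bilinear (*\<^sub>c)"
proof
  show "(r *\<^sub>R z) *\<^sub>c a = r *\<^sub>R (z *\<^sub>c a)" "z *\<^sub>c (r *\<^sub>R a) = r *\<^sub>R (z *\<^sub>c a)" for r z a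
    by (auto intro!: fmat_eqI simp: scaleR_conv_of_real)
  show "\<exists>K. \<forall>z b. norm (z *\<^sub>c b) \<le> norm z * norm b * K"
    by (rule exI[of _ 1]) simp
qed (auto simp: cscale_distribs)

lemma bounded_linear_entry: "bounded_linear (\<lambda>a. entry a i j)"
  by (rule bounded_linear_intro[of _ 1]) (auto simp: norm_entry_le scaleR_conv_of_real)

lemmas continuous_on_cscale [continuous_intros] =
  bounded_bilinear.continuous_on[OF bounded_bilinear_cscale]
lemmas continuous_on_entry [continuous_intros] =
  bounded_linear.continuous_on[OF bounded_linear_entry]

definition unit_fmat :: "nat \<Rightarrow> fmat"
  where "unit_fmat n = fmat_of n (\<lambda>i j. if i = j then 1 else 0)"

lemma unit_fmat_in [simp]: "unit_fmat n \<in> fmats n"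
  by (simp add: unit_fmat_def)

lemma unit_fmat_mult [simp]: 
  assumes "a \<in> fmats n"
  shows "unit_fmat n * a = a" "a * unit_fmat n = a"
proof -
  have "entry (unit_fmat n * a) i j = entry a i j" for i j
  proof -
    have "entry (unit_fmat n * a) i j = (\<Sum>k<n. if k = i then entry a i j else 0)"
      unfolding entry_times[OF unit_fmat_in]
      by (intro sum.cong) (auto simp: unit_fmat_def entry_fmat_of)
    then show ?thesis
      using fmats_entry_0[OF assms, of i j] by auto
  qed
  moreover have "entry (a * unit_fmat n) i j = entry a i j" for i j
  proof -
    have "entry (a * unit_fmat n) i j = (\<Sum>k<n. if k = j then entry a i j else 0)"
      unfolding entry_times[OF assms]
      by (intro sum.cong) (auto simp: unit_fmat_def entry_fmat_of)
    then show ?thesis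
      using fmats_entry_0[OF assms, of i j] by auto
  qed
  ultimately show "unit_fmat n * a = a" "a * unit_fmat n = a"
    by (auto intro: fmat_eqI)
qed

lemma star_unit_fmat [simp]: "star (unit_fmat n) = unit_fmat n"
  by (auto intro!: fmat_eqI simp: unit_fmat_def entry_fmat_of)

definition elem_fmat :: "nat \<Rightarrow> nat \<Rightarrow> fmat"
  where "elem_fmat i j = fmat_of (Suc (max i j)) (\<lambda>k l. if k = i \<and> l = j then 1 else 0)"

lemma entry_elem_fmat: "entry (elem_fmat i j) k l = (if k = i \<and> l = j then 1 else 0)"
  by (auto simp: elem_fmat_def entry_fmat_of)

lemma fmat_expand:
  assumes "a \<in> fmats n"
  shows "a = (\<Sum>i<n. \<Sum>j<n. entry a i j *\<^sub>c elem_fmat i j)"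
proof (rule fmat_eqI)
  fix k l
  have "entry (\<Sum>i<n. \<Sum>j<n. entry a i j *\<^sub>c elem_fmat i j) k l =
      (\<Sum>i<n. \<Sum>j<n. if l = j then (if k = i then entry a i j else 0) else 0)"
    by (simp add: entry_sum entry_elem_fmat if_distrib cong: if_cong) (intro sum.cong refl, auto)
  also have "\<dots> = (if l < n then (if k < n then entry a k l else 0) else 0)"
    by simp
  finally show "entry a k l = entry (\<Sum>i<n. \<Sum>j<n. entry a i j *\<^sub>c elem_fmat i j) k l"
    using fmats_entry_0[OF assms, of k l] by auto
qed

section \<open>Eigenvalues and generalised inverses\<close>

lemma star_minus [simp]: "star (- a) = - star a"
  by (auto intro!: fmat_eqI)

text \<open>The span is real, so every matrix unit is taken together with its multiple by the
  imaginary unit.\<close>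

lemma fmats_finite_span:
  obtains B where "finite B" "fmats n \<subseteq> span B"
proof
  define B where "B = (\<lambda>(i, j). elem_fmat i j) ` ({..<n} \<times> {..<n}) \<union>
    (\<lambda>(i, j). \<i> *\<^sub>c elem_fmat i j) ` ({..<n} \<times> {..<n})"
  show "finite B"
    by (simp add: B_def)
  show "fmats n \<subseteq> span B"
  proof
    fix a assume "a \<in> fmats n"
    then have "a = (\<Sum>i<n. \<Sum>j<n. entry a i j *\<^sub>c elem_fmat i j)"
      by (rule fmat_expand)
    moreover have "entry a i j *\<^sub>c elem_fmat i j \<in> span B" if "i < n" "j < n" for i j
    proof -
      have "entry a i j *\<^sub>c elem_fmat i j =
          Re (entry a i j) *\<^sub>R elem_fmat i j + Im (entry a i j) *\<^sub>R (\<i> *\<^sub>c elem_fmat i j)"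
        by (rule fmat_eqI) (simp add: entry_elem_fmat complex_eq_iff)
      moreover have "elem_fmat i j \<in> B" "\<i> *\<^sub>c elem_fmat i j \<in> B"
        using that by (auto simp: B_def)
      ultimately show ?thesis
        by (metis span_add span_scale span_base)
    qed
    ultimately show "a \<in> span B"
      by (metis (no_types, lifting) lessThan_iff span_sum)
  qed
qed

text \<open>Finite dimension in the form used below: applied to the powers of one matrix, it
  produces an annihilating polynomial.\<close>

lemma fmats_linear_dependence:
  fixes f :: "nat \<Rightarrow> fmat"
  assumes f: "\<And>i. f i \<in> fmats n"
  obtains K r where "\<exists>i\<le>K. r i \<noteq> 0" "(\<Sum>i\<le>K. r i *\<^sub>R f i) = 0"
proof -
  obtain B where B: "finite B" "fmats n \<subseteq> span B"
    by (rule fmats_finite_span)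
  define K where "K = card B"
  show ?thesis
  proof (cases "inj_on f {..K}")
    case True
    have "dependent (f ` {..K})"
    proof (rule ccontr)
      assume "independent (f ` {..K})"
      moreover have "f ` {..K} \<subseteq> span B"
        using f B by auto
      ultimately have "card (f ` {..K}) \<le> K"
        using independent_span_bound[OF B(1)] unfolding K_def by blast
      then show False
        using True by (simp add: card_image)
    qed
    then obtain u v where "v \<in> f ` {..K}" "u v \<noteq> 0" "(\<Sum>v\<in>f ` {..K}. u v *\<^sub>R v) = 0"
      by (subst (asm) real_vector.dependent_finite) auto
    then show ?thesis
      using True by (intro that[of K "u \<circ> f"]) (auto simp: sum.reindex)
  next
    \<comment> \<open>Dependence of the set of values says nothing about a repeated value; there the
      relation is \<open>f i - f j = 0\<close>.\<close>
    case False
    then obtain i j where ij: "i \<le> K" "j \<le> K" "i \<noteq> j" "f i = f j"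
      by (auto simp: inj_on_def)
    define r :: "nat \<Rightarrow> real" where "r = (\<lambda>k. (if k = i then 1 else 0) - (if k = j then 1 else 0))"
    have "(\<Sum>k\<le>K. r k *\<^sub>R f k) =
        (\<Sum>k\<le>K. if k = i then f k else 0) - (\<Sum>k\<le>K. if k = j then f k else 0)"
      unfolding sum_subtractf[symmetric] by (intro sum.cong) (auto simp: r_def)
    also have "\<dots> = 0"
      using ij by simp
    finally show ?thesis
      using ij by (intro that[of K r]) (auto simp: r_def)
  qed
qed

section \<open>Polynomials in one matrix and their roots\<close>

primrec pow_fmat :: "fmat \<Rightarrow> fmat \<Rightarrow> nat \<Rightarrow> fmat"
  where
    "pow_fmat p a 0 = p"
  | "pow_fmat p a (Suc k) = a * pow_fmat p a k"

lemma pow_fmat_in: "p \<in> fmats n \<Longrightarrow> a \<in> fmats n \<Longrightarrow> pow_fmat p a k \<in> fmats n"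
  by (induction k) auto

text \<open>Horner evaluation of \<open>f\<close> at \<open>a\<close>, with the idempotent
  \<open>p\<close> as the zeroth power of \<open>a\<close>.\<close>

definition poly_fmat :: "fmat \<Rightarrow> fmat \<Rightarrow> complex poly \<Rightarrow> fmat"
  where "poly_fmat p a f = fold_coeffs (\<lambda>c r. c *\<^sub>c p + a * r) f 0"

lemma poly_fmat_0 [simp]: "poly_fmat p a 0 = 0"
  by (simp add: poly_fmat_def)

lemma poly_fmat_pCons [simp]: "poly_fmat p a (pCons c f) = c *\<^sub>c p + a * poly_fmat p a f"
  by (cases "c = 0"; cases "f = 0")
    (simp_all add: poly_fmat_def fold_coeffs_pCons_coeff_not_0_eq fold_coeffs_pCons_not_0_0_eq)

lemma poly_fmat_add: "poly_fmat p a (f + g) = poly_fmat p a f + poly_fmat p a g"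
  by (induction f g rule: poly_induct2) (auto simp: cscale_distribs distrib_left)

lemma poly_fmat_diff: "poly_fmat p a (f - g) = poly_fmat p a f - poly_fmat p a g"
  using poly_fmat_add[of p a "f - g" g] by simp

lemma poly_fmat_smult: "poly_fmat p a (Polynomial.smult c f) = c *\<^sub>c poly_fmat p a f"
  by (induction f) (auto simp: cscale_distribs)

lemma poly_fmat_sum: "poly_fmat p a (sum f I) = (\<Sum>i\<in>I. poly_fmat p a (f i))"
  by (induction I rule: infinite_finite_induct) (auto simp: poly_fmat_add)

lemma poly_fmat_monom: "poly_fmat p a (Polynomial.monom c k) = c *\<^sub>c pow_fmat p a k"
  by (induction k) (auto simp: monom_0 monom_Suc)

text \<open>Some nonzero polynomial annihilates \<open>a\<close>. Split off a linear factor with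
  root \<open>c\<close>: if \<open>a - c *\<^sub>c p\<close> has a left inverse, the cofactor
  annihilates \<open>a\<close> as well and has smaller degree. The descent cannot reach a nonzero
  constant, since \<open>p\<close> is not 0, so at some root the left inverse fails to
  exist.\<close>

lemma eigenvalue_exists:
  assumes "p \<in> fmats n" "a \<in> fmats n" "p * p = p" "p * a = a" "p \<noteq> 0"
  obtains c where "\<nexists>y. y * (a - c *\<^sub>c p) = p"
proof -
  have absorb: "p * poly_fmat p a f = poly_fmat p a f" for f
  proof (cases f)
    case (pCons c g)
    have "p * (a * poly_fmat p a g) = a * poly_fmat p a g"
      using assms by (metis mult.assoc)
    then show ?thesis
      using assms pCons by (simp add: distrib_left)
  qed
  have "\<exists>c. \<nexists>y. y * (a - c *\<^sub>c p) = p" if "poly_fmat p a f = 0" "f \<noteq> 0" for f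
    using that
  proof (induction "Polynomial.degree f" arbitrary: f rule: less_induct)
    case less
    show ?case
    proof (cases "Polynomial.degree f = 0")
      case True
      then obtain c where c: "f = [:c:]"
        by (meson degree_eq_zeroE)
      then have "c *\<^sub>c p = 0"
        using less.prems by simp
      then have "inverse c *\<^sub>c c *\<^sub>c p = 0"
        by simp
      then show ?thesis
        using less.prems c assms by simp
    next
      case False
      then obtain c where "poly f c = 0"
        using fundamental_theorem_of_algebra constant_degree by metis
      then obtain g where g: "f = [:- c, 1:] * g"
        by (auto simp: poly_eq_0_iff_dvd)
      then have gz: "g \<noteq> 0"
        using less.prems by auto
      have ev: "(a - c *\<^sub>c p) * poly_fmat p a g = 0"
      proof -
        have "poly_fmat p a f = a * poly_fmat p a g - c *\<^sub>c poly_fmat p a g"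
          unfolding g by (simp add: poly_fmat_diff poly_fmat_smult)
        also have "\<dots> = (a - c *\<^sub>c p) * poly_fmat p a g"
          using absorb[of g] by (simp add: left_diff_distrib)
        finally have "poly_fmat p a f = (a - c *\<^sub>c p) * poly_fmat p a g" .
        then show ?thesis
          using less.prems by simp
      qed
      show ?thesis
      proof (cases "\<exists>y. y * (a - c *\<^sub>c p) = p")
        case True
        then obtain y where y: "y * (a - c *\<^sub>c p) = p"
          by blast
        have "poly_fmat p a g = y * (a - c *\<^sub>c p) * poly_fmat p a g"
          unfolding y by (rule absorb[symmetric])
        also have "\<dots> = 0"
          using ev by (simp add: mult.assoc)
        finally have "poly_fmat p a g = 0" .
        moreover have "Polynomial.degree g < Polynomial.degree f"
          using gz unfolding g by (subst degree_mult_eq) auto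
        ultimately show ?thesis
          using less.hyps gz by blast
      qed blast
    qed
  qed
  moreover obtain K r where r: "\<exists>i\<le>K. r i \<noteq> (0::real)" "(\<Sum>i\<le>K. r i *\<^sub>R pow_fmat p a i) = 0"
    by (rule fmats_linear_dependence[OF pow_fmat_in[OF assms(1,2)]])
  define f where "f = (\<Sum>i\<le>K. Polynomial.monom (complex_of_real (r i)) i)"
  have "poly_fmat p a f = 0"
    using r(2) unfolding f_def by (simp add: poly_fmat_sum poly_fmat_monom scaleR_fmat_def)
  moreover have "f \<noteq> 0"
  proof
    assume "f = 0"
    moreover obtain i where "i \<le> K" "r i \<noteq> 0"
      using r(1) by blast
    moreover have "Polynomial.coeff f i = r i" if "i \<le> K" for i
      using that unfolding f_def by (simp add: coeff_sum coeff_monom)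
    ultimately show False
      by (metis coeff_0 of_real_eq_0_iff)
  qed
  ultimately show ?thesis
    using that by blast
qed

text \<open>In a linear relation among the positive powers of \<open>s\<close>, let \<open>l\<close>
  be the lowest index with nonzero coefficient. Dividing by the power of \<open>s\<close> in front
  gives \<open>s * e = 0\<close> with \<open>e = r l *\<^sub>R unit_fmat n + s * t\<close>, that is,
  \<open>s * s * t\<close> is \<open>- r l\<close> times \<open>s\<close>. The inverse is thus a
  real polynomial in \<open>s\<close>, hence selfadjoint and commuting with
  \<open>s\<close>.\<close>

lemma selfadjoint_generalised_inverse:
  assumes "s \<in> fmats n" "star s = s"
  obtains k where "k \<in> fmats n" "s * k * s = s" "star k = k" "k * s = s * k"
proof -
  let ?P = "\<lambda>i. pow_fmat (unit_fmat n) s i"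
  have P_in: "?P i \<in> fmats n" for i
    by (rule pow_fmat_in[OF unit_fmat_in assms(1)])
  have P_comm: "?P i * s = s * ?P i" for i
    using assms(1) by (induction i) (auto simp: mult.assoc)
  have P_star: "star (?P i) = ?P i" for i
    using P_comm assms(2) by (induction i) auto
  have P_add: "?P i * ?P j = ?P (i + j)" for i j
    using P_in by (induction i) (auto simp: mult.assoc)
  obtain K r where r: "\<exists>i\<le>K. r i \<noteq> (0::real)" "(\<Sum>i\<le>K. r i *\<^sub>R ?P (Suc i)) = 0"
    by (rule fmats_linear_dependence[of "\<lambda>i. ?P (Suc i)", OF P_in])
  define l where "l = (LEAST i. r i \<noteq> 0)"
  have l: "r l \<noteq> 0" "l \<le> K" and l_min: "\<And>i. i < l \<Longrightarrow> r i = 0"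
    using r(1) not_less_Least unfolding l_def
    by (metis (mono_tags, lifting) LeastI, meson Least_le order_trans, blast)
  define e where "e = (\<Sum>i\<in>{l..K}. r i *\<^sub>R ?P (i - l))"
  have e_in: "e \<in> fmats n"
    using P_in by (auto simp: e_def)
  have 0: "?P (Suc l) * e = 0"
  proof -
    have "?P (Suc l) * e = (\<Sum>i\<in>{l..K}. r i *\<^sub>R ?P (Suc i))"
      unfolding e_def sum_distrib_left
      by (intro sum.cong refl) (simp only: mult_scaleR_right P_add, simp)
    also have "\<dots> = (\<Sum>i\<le>K. r i *\<^sub>R ?P (Suc i))"
      using l_min by (intro sum.mono_neutral_left) auto
    finally show ?thesis
      using r(2) by simp
  qed
  \<comment> \<open>A selfadjoint matrix has no nilpotent part: if \<open>s\<close> kills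
    \<open>x\<close>, a positive power of \<open>s\<close> applied to \<open>e\<close>, then
    \<open>star x * x\<close> contains the factor \<open>s * x\<close>, so \<open>x = 0\<close> and
    the power can be lowered.\<close>
  have "?P (Suc j) * e = 0 \<Longrightarrow> s * e = 0" for j
  proof (induction j)
    case 0
    then show ?case
      using assms(1) by simp
  next
    case (Suc j)
    define x where "x = ?P (Suc j) * e"
    have "s * x = 0"
      using Suc.prems by (simp add: x_def mult.assoc)
    moreover have "star x = star e * ?P (Suc j)"
      using P_star[of "Suc j"] by (simp only: x_def star_mult)
    moreover have "?P (Suc j) * x = ?P j * (s * x)"
      using P_comm by (simp add: mult.assoc[symmetric])
    ultimately have "star x * x = 0"
      by (simp add: mult.assoc)
    then show ?case
      using Suc.IH star_mult_eq_0 x_def by blast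
  qed
  then have se: "s * e = 0"
    using 0 by blast
  define t where "t = (\<Sum>i\<in>{Suc l..K}. r i *\<^sub>R ?P (i - Suc l))"
  have t_in: "t \<in> fmats n"
    using P_in by (auto simp: t_def)
  have t_comm: "t * s = s * t"
    using P_comm by (simp add: t_def sum_distrib_left sum_distrib_right)
  have t_star: "star t = t"
    using P_star by (simp add: t_def star_sum)
  have "e = r l *\<^sub>R unit_fmat n + s * t"
  proof -
    have "e = r l *\<^sub>R ?P 0 + (\<Sum>i\<in>{Suc l..K}. r i *\<^sub>R ?P (i - l))"
      unfolding e_def using l(2) by (simp add: sum.atLeast_Suc_atMost)
    also have "(\<Sum>i\<in>{Suc l..K}. r i *\<^sub>R ?P (i - l)) = s * t"
      unfolding t_def sum_distrib_left
    proof (intro sum.cong refl)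
      fix i assume "i \<in> {Suc l..K}"
      then have "i - l = Suc (i - Suc l)"
        by auto
      then show "r i *\<^sub>R ?P (i - l) = s * r i *\<^sub>R ?P (i - Suc l)"
        by simp
    qed
    finally show ?thesis by simp
  qed
  then have "r l *\<^sub>R s + s * (s * t) = 0"
    using se assms(1) by (simp add: distrib_left)
  then have *: "s * t * s = - (r l *\<^sub>R s)"
    using t_comm by (metis mult.assoc minus_unique)
  show ?thesis
  proof (rule that[of "- (1 / r l) *\<^sub>R t"])
    show "s * - (1 / r l) *\<^sub>R t * s = s"
      using * l(1) by simp
  qed (use t_in t_comm t_star in auto)
qed

text \<open>The four Penrose equations. They determine \<open>y\<close> from \<open>a\<close>, which
  an arbitrary generalised inverse does not, so that a choice made pointwise can be
  continuous.\<close>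

definition moore_penrose :: "fmat \<Rightarrow> fmat \<Rightarrow> bool"
  where "moore_penrose a y \<longleftrightarrow>
    a * y * a = a \<and> y * a * y = y \<and> star (a * y) = a * y \<and> star (y * a) = y * a"

text \<open>Reduction to the selfadjoint \<open>s = star a * a\<close>, which kills the same vectors
  as \<open>a\<close>, so that \<open>a * (k * s) = a\<close>. The factor \<open>k * s * k\<close>
  in place of \<open>k\<close> secures \<open>y * a * y = y\<close>.\<close>

lemma moore_penrose_exists:
  assumes "a \<in> fmats n"
  obtains y where "y \<in> fmats n" "moore_penrose a y"
proof -
  define s where "s = star a * a"
  have "s \<in> fmats n" "star s = s"
    using assms by (auto simp: s_def)
  then obtain k where k: "k \<in> fmats n" "s * k * s = s" "star k = k" "k * s = s * k"
    by (rule selfadjoint_generalised_inverse)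
  define x where "x = a - a * (k * s)"
  have "s * (k * s) = s"
    using k(2) by (simp add: mult.assoc)
  then have "star a * x = 0"
    unfolding x_def right_diff_distrib by (simp add: s_def mult.assoc)
  moreover have "star x = star a - s * k * star a"
    using k(3) \<open>star s = s\<close> by (simp add: x_def)
  ultimately have "star x * x = 0"
    by (simp add: left_diff_distrib mult.assoc)
  then have "x = 0"
    by (rule star_mult_eq_0)
  then have aks: "a * (k * s) = a"
    by (simp add: x_def)
  define y where "y = k * s * k * star a"
  have ya: "y * a = k * s"
    unfolding y_def using k(2) by (simp add: s_def mult.assoc)
  have "moore_penrose a y"
    unfolding moore_penrose_def
  proof (intro conjI)
    show "a * y * a = a"
      using aks ya by (simp add: mult.assoc)
    have "k * s * (k * s * k) = k * s * k"
      using k(2) by (metis mult.assoc)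
    then show "y * a * y = y"
      by (simp only: ya) (simp add: y_def mult.assoc[symmetric])
    show "star (y * a) = y * a"
      unfolding ya using k \<open>star s = s\<close> by simp
    show "star (a * y) = a * y"
      using k(3) \<open>star s = s\<close> by (simp add: y_def mult.assoc)
  qed
  moreover have "y \<in> fmats n"
    using assms k \<open>s \<in> fmats n\<close> by (simp add: y_def)
  ultimately show ?thesis
    using that by blast
qed

text \<open>The diagonal entry \<open>e j j\<close> is the sum of the squared moduli in column
  \<open>j\<close>, hence at least its own square and at most 1. So all entries have modulus at most
  1, and there are n^2 of them.\<close>

lemma norm_projection_le:
  assumes "e \<in> fmats n" "e * e = e" "star e = e"
  shows "norm e \<le> (real n)\<^sup>2"
proof -
  have sq: "(cmod (entry e i j))\<^sup>2 \<le> Re (entry e j j)" if "i < n" for i j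
  proof -
    have "Re (entry e j j) = Re (entry (star e * e) j j)"
      using assms by simp
    also have "\<dots> = (\<Sum>k<n. (cmod (entry e k j))\<^sup>2)"
      unfolding entry_times[OF fmats_star[OF assms(1)]]
      by (simp add: mult.commute[of "cnj _"] complex_mult_cnj cmod_power2)
    finally show ?thesis
      using member_le_sum[of i "{..<n}" "\<lambda>k. (cmod (entry e k j))\<^sup>2"] that by simp
  qed
  have le1: "cmod (entry e i j) \<le> 1" if "i < n" "j < n" for i j
  proof -
    have "(Re (entry e j j))\<^sup>2 \<le> (cmod (entry e j j))\<^sup>2"
      by (simp add: cmod_power2)
    then have "(Re (entry e j j))\<^sup>2 \<le> Re (entry e j j)"
      using sq[of j j] that by linarith
    then have "Re (entry e j j) \<le> 1"
      using mult_strict_right_mono[of 1 "Re (entry e j j)" "Re (entry e j j)"]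
      unfolding power2_eq_square by linarith
    then have "(cmod (entry e i j))\<^sup>2 \<le> 1"
      using sq[of i j] that by linarith
    then show ?thesis
      by (simp add: abs_square_le_1)
  qed
  have "norm e \<le> (\<Sum>i<n. \<Sum>j<n. 1)"
    unfolding norm_fmat[OF assms(1)] by (intro sum_mono) (auto intro: le1)
  then show ?thesis
    by (simp add: power2_eq_square)
qed

lemma moore_penrose_projections:
  assumes "a \<in> fmats n" "y \<in> fmats n" "moore_penrose a y"
  shows "norm (a * y) \<le> (real n)\<^sup>2" "norm (y * a) \<le> (real n)\<^sup>2"
  using assms by (auto intro!: norm_projection_le simp: moore_penrose_def mult.assoc)

text \<open>\<open>y = (y * a) * x * (a * y)\<close>, and the outer factors are orthogonal
  projections. Any bounded family of generalised inverses therefore bounds the Moore-Penrose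
  inverses.\<close>

lemma moore_penrose_norm_le:
  assumes "a \<in> fmats n" "y \<in> fmats n" "moore_penrose a y" "a * x * a = a"
  shows "norm y \<le> (real n)\<^sup>2 * norm x * (real n)\<^sup>2"
proof -
  have "y = (y * a) * x * (a * y)"
    using assms(3,4) unfolding moore_penrose_def by (metis mult.assoc)
  then have "norm y \<le> norm (y * a) * norm x * norm (a * y)"
    by (metis mult_right_mono norm_ge_zero norm_mult_ineq order_trans)
  also have "\<dots> \<le> (real n)\<^sup>2 * norm x * (real n)\<^sup>2"
    using moore_penrose_projections[OF assms(1-3)] by (intro mult_mono) auto
  finally show ?thesis .
qed

text \<open>Wedin's identity.\<close>

lemma moore_penrose_diff:
  assumes "moore_penrose a x" "moore_penrose b y"
  shows "y - x = - (y * (b - a) * x)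
    + (y * star y * star (b - a) - y * star y * star (b - a) * (a * x))
    + (star (b - a) * star x * x - y * b * (star (b - a) * star x * x))"
proof -
  have 1: "y * star y * star b = y" "star a * star x * x = x"
    using assms unfolding moore_penrose_def by (metis star_mult mult.assoc)+
  have 2: "star a * (a * x) = star a" "y * b * star b = star b"
    using assms unfolding moore_penrose_def by (metis star_mult star_star mult.assoc)+
  have "y * star y * star (b - a) - y * star y * star (b - a) * (a * x) = y - y * a * x"
    using 1 2 by (simp add: right_diff_distrib left_diff_distrib mult.assoc)
  moreover have "star (b - a) * star x * x - y * b * (star (b - a) * star x * x) = y * b * x - x"
    using 1 2 by (simp add: right_diff_distrib left_diff_distrib mult.assoc[symmetric])
  ultimately show ?thesis
    by (simp add: right_diff_distrib left_diff_distrib)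
qed

text \<open>Of the five terms of the identity above, three are at most K^2 times the distance of
  \<open>a\<close> and \<open>b\<close>; the other two carry in addition a projection, bounded by
  n^2.\<close>

lemma moore_penrose_lipschitz:
  assumes "a \<in> fmats n" "x \<in> fmats n" "moore_penrose a x" "norm x \<le> K"
    and "b \<in> fmats n" "y \<in> fmats n" "moore_penrose b y" "norm y \<le> K"
  shows "norm (y - x) \<le> (K * K * (3 + 2 * (real n)\<^sup>2)) * norm (b - a)"
proof -
  have K: "0 \<le> K"
    using assms(4) norm_ge_zero order_trans by blast
  have m2: "norm (u * v) \<le> r * s" if "norm u \<le> r" "norm v \<le> s" for u v :: fmat and r s
    using that by (meson mult_mono norm_ge_zero norm_mult_ineq order_trans)
  let ?d = "norm (b - a)"
  have 1: "norm (y * (b - a) * x) \<le> K * ?d * K"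
    using assms by (intro m2) auto
  have 2: "norm (y * star y * star (b - a)) \<le> K * K * ?d"
    unfolding mult.assoc using assms by (intro m2) (auto simp del: star_diff)
  then have 3: "norm (y * star y * star (b - a) * (a * x)) \<le> K * K * ?d * (real n)\<^sup>2"
    by (rule m2) (rule moore_penrose_projections[OF assms(1-3)])
  have 4: "norm (star (b - a) * star x * x) \<le> ?d * K * K"
    using assms by (intro m2) (auto simp del: star_diff)
  have 5: "norm (y * b * (star (b - a) * star x * x)) \<le> (real n)\<^sup>2 * (?d * K * K)"
    by (rule m2[OF moore_penrose_projections(2)[OF assms(5-7)] 4])
  have "norm (y - x) \<le> norm (y * (b - a) * x) + (norm (y * star y * star (b - a)) +
      norm (y * star y * star (b - a) * (a * x))) +
      (norm (star (b - a) * star x * x) + norm (y * b * (star (b - a) * star x * x)))"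
    unfolding moore_penrose_diff[OF assms(3,7)]
    by (intro order.trans[OF norm_triangle_ineq] add_mono norm_triangle_ineq4)
      (simp_all del: star_diff)
  also have "\<dots> \<le> K * ?d * K + (K * K * ?d + K * K * ?d * (real n)\<^sup>2) + (?d * K * K + (real n)\<^sup>2 * (?d * K * K))"
    using 1 2 3 4 5 by linarith
  also have "\<dots> = (K * K * (3 + 2 * (real n)\<^sup>2)) * ?d"
    by (simp add: algebra_simps)
  finally show ?thesis .
qed

text \<open>The Moore-Penrose inverse jumps only where the rank does, and there it is unbounded; the
  uniform bound \<open>K\<close> rules this out.\<close>

lemma continuous_generalised_inverse:
  fixes a :: "'a::metric_space \<Rightarrow> fmat"
  assumes "continuous_on S a" "\<And>z. z \<in> S \<Longrightarrow> a z \<in> fmats n"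
    and "\<And>z. z \<in> S \<Longrightarrow> \<exists>x. a z * x * a z = a z \<and> norm x \<le> K"
  obtains y where "continuous_on S y" "\<And>z. z \<in> S \<Longrightarrow> y z \<in> fmats n \<and> a z * y z * a z = a z"
proof -
  have "\<exists>y. \<forall>z\<in>S. y z \<in> fmats n \<and> moore_penrose (a z) (y z)"
    by (intro bchoice ballI) (meson moore_penrose_exists assms(2))
  then obtain y where y: "\<And>z. z \<in> S \<Longrightarrow> y z \<in> fmats n \<and> moore_penrose (a z) (y z)"
    by blast
  define L where "L = (real n)\<^sup>2 * K * (real n)\<^sup>2"
  have yL: "norm (y z) \<le> L" if z: "z \<in> S" for z
  proof -
    obtain x where x: "a z * x * a z = a z" "norm x \<le> K"
      using assms(3)[OF z] by blast
    have "norm (y z) \<le> (real n)\<^sup>2 * norm x * (real n)\<^sup>2"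
      using moore_penrose_norm_le y x z assms(2) by blast
    also have "\<dots> \<le> L"
      unfolding L_def using x(2) by (simp add: mult_left_mono mult_right_mono)
    finally show ?thesis .
  qed
  define C where "C = L * L * (3 + 2 * (real n)\<^sup>2)"
  have C: "0 \<le> C"
    by (auto simp: C_def)
  have lip: "norm (y w - y z) \<le> C * norm (a w - a z)" if "z \<in> S" "w \<in> S" for z w
    unfolding C_def using that y yL assms(2) by (intro moore_penrose_lipschitz) auto
  have "continuous_on S y"
    unfolding continuous_on_def
  proof
    fix z assume z: "z \<in> S"
    have "((\<lambda>w. a w - a z) \<longlongrightarrow> a z - a z) (at z within S)"
      using assms(1) z by (intro tendsto_intros) (auto simp: continuous_on_def)
    then have "((\<lambda>w. C * norm (a w - a z)) \<longlongrightarrow> C * 0) (at z within S)"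
      by (intro tendsto_intros tendsto_norm_zero) simp
    then have "((\<lambda>w. C * norm (a w - a z)) \<longlongrightarrow> 0) (at z within S)"
      by simp
    then have "((\<lambda>w. y w - y z) \<longlongrightarrow> 0) (at z within S)"
      by (rule Lim_null_comparison[rotated]) (auto simp: eventually_at_filter lip z intro!: always_eventually)
    then show "(y \<longlongrightarrow> y z) (at z within S)"
      by (simp add: LIM_zero_cancel)
  qed
  moreover have "y z \<in> fmats n \<and> a z * y z * a z = a z" if "z \<in> S" for z
    using y that by (simp add: moore_penrose_def)
  ultimately show ?thesis
    using that by blast
qed

text \<open>The measure for the induction on summands. The matrix \<open>p\<close> lies in its own
  set but not in that of \<open>q\<close>, because \<open>q * p = q\<close> differs from
  \<open>p\<close>.\<close>

lemma dim_range_less: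
  assumes "p \<in> fmats n" "q \<in> fmats n" "p * p = p" "p * q = q" "q * p = q" "q \<noteq> p"
  shows "dim {a \<in> fmats n. q * a = a} < dim {a \<in> fmats n. p * a = a}"
proof -
  let ?S = "\<lambda>p. {a \<in> fmats n. p * a = a}"
  obtain B where B: "finite B" "fmats n \<subseteq> span B"
    by (rule fmats_finite_span)
  have fin: "finite C" if "independent C" "C \<subseteq> ?S r" for C r
    using independent_span_bound[OF B(1), of C] B(2) that by auto
  obtain C where C: "C \<subseteq> ?S q" "independent C" "?S q \<subseteq> span C" "card C = dim (?S q)"
    using basis_exists by blast
  obtain D where D: "D \<subseteq> ?S p" "independent D" "?S p \<subseteq> span D" "card D = dim (?S p)"
    using basis_exists by blast
  have "subspace (?S q)"
    by (auto simp: subspace_def distrib_left)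
  then have "span C \<subseteq> ?S q"
    using C(1) by (simp add: span_minimal)
  then have p: "p \<notin> span C"
    using assms by auto
  then have "independent (insert p C)"
    using C(2) by (simp add: independent_insertI)
  moreover have "insert p C \<subseteq> span D"
  proof -
    have "?S q \<subseteq> ?S p"
      using assms(4) by auto (metis mult.assoc)
    then show ?thesis
      using C(1) D(3) assms by auto
  qed
  ultimately have "card (insert p C) \<le> card D"
    using independent_span_bound[OF fin[OF D(2,1)]] by blast
  moreover have "p \<notin> C"
    using p span_base by blast
  ultimately show ?thesis
    using C(4) D(4) fin[OF C(2,1)] by simp
qed

section \<open>Averaging over a compact group\<close>

locale compact_group = group G for G (structure) +
  fixes T :: "'a topology"
  assumes topspace_T: "topspace T = carrier G"
    and compact_T: "compact_space T"
    and continuous_mult: "continuous_map (prod_topology T T) T (\<lambda>(x, y). x \<otimes> y)"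
    and continuous_inv: "continuous_map T T (\<lambda>x. inv x)"

text \<open>Tube lemma for the open set where \<open>F\<close> is \<open>e\<close>-close to its
  values on the slice over \<open>x0\<close>.\<close>

lemma uniformly_near_in_compact:
  fixes F :: "'x \<Rightarrow> 'y \<Rightarrow> 'b::real_normed_vector"
  assumes "compact_space Y" "continuous_map (prod_topology Z Y) euclidean (\<lambda>(x, y). F x y)"
    and "x0 \<in> topspace Z" "0 < e"
  obtains U where "openin Z U" "x0 \<in> U" "\<And>x y. x \<in> U \<Longrightarrow> y \<in> topspace Y \<Longrightarrow> norm (F x y - F x0 y) < e"
proof -
  let ?P = "prod_topology Z Y"
  have c: "continuous_map ?P euclidean (\<lambda>z. F (fst z) (snd z) - F x0 (snd z))"
  proof (intro continuous_map_diff)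
    show "continuous_map ?P euclidean (\<lambda>z. F (fst z) (snd z))"
      using assms(2) by (simp add: case_prod_unfold)
    have "continuous_map ?P ?P (\<lambda>z. (x0, snd z))"
      using assms(3) by (intro continuous_intros) (auto simp: continuous_map_snd)
    then have "continuous_map ?P euclidean ((\<lambda>(x, y). F x y) \<circ> (\<lambda>z. (x0, snd z)))"
      using assms(2) continuous_map_compose by blast
    then show "continuous_map ?P euclidean (\<lambda>z. F x0 (snd z))"
      by (simp add: o_def)
  qed
  define W where "W = {z \<in> topspace ?P. F (fst z) (snd z) - F x0 (snd z) \<in> ball 0 e}"
  have "openin ?P W"
    unfolding W_def using c by (rule openin_continuous_map_preimage) simp
  moreover have "{x0} \<times> topspace Y \<subseteq> W"
    using assms(3,4) by (auto simp: W_def)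
  ultimately obtain U V where UV: "openin Z U" "openin Y V" "x0 \<in> U" "topspace Y \<subseteq> V" "U \<times> V \<subseteq> W"
    using tube_lemma_right[of Z Y W "topspace Y" x0] assms(1,3) unfolding compact_space_def by blast
  show ?thesis
  proof (rule that[OF UV(1,3)])
    fix x y assume "x \<in> U" "y \<in> topspace Y"
    then have "(x, y) \<in> W"
      using UV by blast
    then show "norm (F x y - F x0 y) < e"
      by (simp add: W_def)
  qed
qed

lemma sum_list_scaleR: "(\<Sum>a\<leftarrow>l. c *\<^sub>R f a) = c *\<^sub>R (\<Sum>a\<leftarrow>l. f a)"
  for f :: "'c \<Rightarrow> 'b::real_vector"
  by (induction l) (auto simp: scaleR_add_right)

section \<open>Averages over finitely many translates\<close>

context compact_group
begin

definition avg :: "'a list \<Rightarrow> ('a \<Rightarrow> 'v::real_normed_vector) \<Rightarrow> 'a \<Rightarrow> 'v"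
  where "avg l f x = (1 / real (length l)) *\<^sub>R (\<Sum>a\<leftarrow>l. f (a \<otimes> x))"

definition ravg :: "'a list \<Rightarrow> ('a \<Rightarrow> 'v::real_normed_vector) \<Rightarrow> 'a \<Rightarrow> 'v"
  where "ravg l f x = (1 / real (length l)) *\<^sub>R (\<Sum>a\<leftarrow>l. f (x \<otimes> a))"

text \<open>Von Neumann's description of the invariant mean: the constant that averages of left
  translates approximate uniformly on the group.\<close>

definition is_mean :: "('a \<Rightarrow> 'v::real_normed_vector) \<Rightarrow> 'v \<Rightarrow> bool"
  where "is_mean f c \<longleftrightarrow> (\<forall>e>0. \<exists>l. l \<noteq> [] \<and> set l \<subseteq> carrier G \<and>
    (\<forall>x\<in>carrier G. norm (avg l f x - c) \<le> e))"

definition is_rmean :: "('a \<Rightarrow> 'v::real_normed_vector) \<Rightarrow> 'v \<Rightarrow> bool"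
  where "is_rmean f c \<longleftrightarrow> (\<forall>e>0. \<exists>l. l \<noteq> [] \<and> set l \<subseteq> carrier G \<and>
    (\<forall>x\<in>carrier G. norm (ravg l f x - c) \<le> e))"

lemma norm_list_avg_le:
  fixes f :: "'c \<Rightarrow> 'v::real_normed_vector"
  assumes "l \<noteq> []" "\<And>a. a \<in> set l \<Longrightarrow> norm (f a - c) \<le> e"
  shows "norm ((1 / real (length l)) *\<^sub>R (\<Sum>a\<leftarrow>l. f a) - c) \<le> e"
proof -
  have "norm ((\<Sum>a\<leftarrow>l. f a) - real (length l) *\<^sub>R c) \<le> real (length l) * e"
    using assms(2)
  proof (induction l)
    case (Cons a l)
    have "(\<Sum>a\<leftarrow>a # l. f a) - real (length (a # l)) *\<^sub>R c =
        (f a - c) + ((\<Sum>a\<leftarrow>l. f a) - real (length l) *\<^sub>R c)"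
      by (simp add: algebra_simps)
    also have "norm \<dots> \<le> e + real (length l) * e"
      using Cons by (intro norm_triangle_le add_mono) auto
    finally show ?case
      by (simp add: algebra_simps)
  qed auto
  then have "norm ((1 / real (length l)) *\<^sub>R ((\<Sum>a\<leftarrow>l. f a) - real (length l) *\<^sub>R c)) \<le> e"
    using assms(1) by (simp add: divide_le_eq mult.commute)
  moreover have "(1 / real (length l)) *\<^sub>R ((\<Sum>a\<leftarrow>l. f a) - real (length l) *\<^sub>R c) =
      (1 / real (length l)) *\<^sub>R (\<Sum>a\<leftarrow>l. f a) - c"
    using assms(1) unfolding scaleR_diff_right by simp
  ultimately show ?thesis
    by simp
qed

lemma avg_near:
  assumes "l \<noteq> []" "set l \<subseteq> carrier G" "x \<in> carrier G" "\<And>y. y \<in> carrier G \<Longrightarrow> norm (f y - c) \<le> e"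
  shows "norm (avg l f x - c) \<le> e"
  unfolding avg_def using assms by (intro norm_list_avg_le) auto

lemma ravg_near:
  assumes "l \<noteq> []" "set l \<subseteq> carrier G" "x \<in> carrier G" "\<And>y. y \<in> carrier G \<Longrightarrow> norm (f y - c) \<le> e"
  shows "norm (ravg l f x - c) \<le> e"
  unfolding ravg_def using assms by (intro norm_list_avg_le) auto

text \<open>Averaging on the left commutes with averaging on the right. This lets left and right
  means be compared, and uniqueness and existence of the mean both rest on it.\<close>

lemma ravg_avg_commute:
  assumes "set l \<subseteq> carrier G" "set k \<subseteq> carrier G" "x \<in> carrier G"
  shows "ravg k (avg l f) x = avg l (ravg k f) x"
proof -
  have "(\<Sum>b\<leftarrow>k. \<Sum>a\<leftarrow>l. f (a \<otimes> (x \<otimes> b))) = (\<Sum>a\<leftarrow>l. \<Sum>b\<leftarrow>k. f (a \<otimes> x \<otimes> b))"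
    using assms
  proof (induction k)
    case (Cons b k)
    have "(\<Sum>a\<leftarrow>l. f (a \<otimes> (x \<otimes> b))) = (\<Sum>a\<leftarrow>l. f (a \<otimes> x \<otimes> b))"
      using Cons.prems by (intro arg_cong[of _ _ sum_list] map_cong) (auto simp: m_assoc)
    then show ?case
      using Cons by (simp add: sum_list_addf)
  qed simp
  then show ?thesis
    unfolding avg_def ravg_def sum_list_scaleR by (simp add: mult.commute)
qed


lemma avg_avg:
  assumes "set l \<subseteq> carrier G" "set k \<subseteq> carrier G" "x \<in> carrier G"
  shows "avg k (avg l f) x = avg (concat (map (\<lambda>b. map (\<lambda>a. a \<otimes> b) l) k)) f x"
proof -
  have len: "length (concat (map (\<lambda>b. map (\<lambda>a. a \<otimes> b) l) k)) = length k * length l"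
    by (induction k) auto
  have "(\<Sum>b\<leftarrow>k. \<Sum>a\<leftarrow>l. f (a \<otimes> (b \<otimes> x))) =
      (\<Sum>a\<leftarrow>concat (map (\<lambda>b. map (\<lambda>a. a \<otimes> b) l) k). f (a \<otimes> x))"
    using assms
  proof (induction k)
    case (Cons b k)
    have "(\<Sum>a\<leftarrow>l. f (a \<otimes> (b \<otimes> x))) = (\<Sum>a\<leftarrow>map (\<lambda>a. a \<otimes> b) l. f (a \<otimes> x))"
      using Cons.prems unfolding map_map by (intro arg_cong[of _ _ sum_list] map_cong) (auto simp: m_assoc)
    then show ?case
      using Cons by simp
  qed simp
  then show ?thesis
    unfolding avg_def sum_list_scaleR len by (simp add: mult.commute)
qed

lemma concat_products_closed:
  assumes "set l \<subseteq> carrier G" "set k \<subseteq> carrier G" "l \<noteq> []" "k \<noteq> []"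
  shows "set (concat (map (\<lambda>b. map (\<lambda>a. a \<otimes> b) l) k)) \<subseteq> carrier G"
    "concat (map (\<lambda>b. map (\<lambda>a. a \<otimes> b) l) k) \<noteq> []"
proof -
  show "set (concat (map (\<lambda>b. map (\<lambda>a. a \<otimes> b) l) k)) \<subseteq> carrier G"
    using assms by auto
  show "concat (map (\<lambda>b. map (\<lambda>a. a \<otimes> b) l) k) \<noteq> []"
    using assms by (cases k) auto
qed

lemma continuous_translates:
  assumes "continuous_map T euclidean f"
  shows "continuous_map (prod_topology T (prod_topology T T)) euclidean
    (\<lambda>(z, (g, h)). f (g \<otimes> z \<otimes> h))"
proof -
  let ?P = "prod_topology T (prod_topology T T)"
  have m: "continuous_map ?P T (\<lambda>w. u w \<otimes> v w)" if "continuous_map ?P T u" "continuous_map ?P T v" for u v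
  proof -
    have "continuous_map ?P (prod_topology T T) (\<lambda>w. (u w, v w))"
      using that by (simp add: continuous_map_pairedI)
    then show ?thesis
      using continuous_map_compose[OF _ continuous_mult] by (force simp: o_def)
  qed
  have "continuous_map ?P T (fst \<circ> snd)" "continuous_map ?P T (snd \<circ> snd)"
    by (rule continuous_map_compose continuous_map_fst continuous_map_snd)+
  then have "continuous_map ?P T (\<lambda>w. fst (snd w) \<otimes> fst w \<otimes> snd (snd w))"
    by (intro m continuous_map_fst) (simp_all add: o_def)
  then have "continuous_map ?P euclidean (f \<circ> (\<lambda>w. fst (snd w) \<otimes> fst w \<otimes> snd (snd w)))"
    using assms by (rule continuous_map_compose)
  then show ?thesis
    by (simp add: o_def case_prod_unfold)
qed

text \<open>The function sending \<open>z\<close> to all two-sided translates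
  \<open>f (g \<otimes> z \<otimes> h)\<close> is continuous for the uniform distance, because
  \<open>(g, h)\<close> ranges over a compact space; a finite subcover by neighbourhoods of uniform
  closeness is the net.\<close>

lemma finite_net:
  fixes f :: "'a \<Rightarrow> 'v::real_normed_vector"
  assumes "continuous_map T euclidean f" "0 < e"
  obtains l where "l \<noteq> []" "set l \<subseteq> carrier G"
    "\<And>z. z \<in> carrier G \<Longrightarrow>
      \<exists>b\<in>set l. \<forall>g\<in>carrier G. \<forall>h\<in>carrier G. norm (f (g \<otimes> b \<otimes> h) - f (g \<otimes> z \<otimes> h)) \<le> e"
proof -
  let ?near = "\<lambda>b z. \<forall>g\<in>carrier G. \<forall>h\<in>carrier G. norm (f (g \<otimes> b \<otimes> h) - f (g \<otimes> z \<otimes> h)) \<le> e"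
  have "\<exists>U. openin T U \<and> z \<in> U \<and> (\<forall>x\<in>U. ?near z x)" if z: "z \<in> carrier G" for z
  proof -
    have c: "compact_space (prod_topology T T)"
      using compact_T by (simp add: compact_space_prod_topology)
    obtain U where U: "openin T U" "z \<in> U"
      "\<And>x y. x \<in> U \<Longrightarrow> y \<in> topspace (prod_topology T T) \<Longrightarrow>
        norm ((\<lambda>(g, h). f (g \<otimes> x \<otimes> h)) y - (\<lambda>(g, h). f (g \<otimes> z \<otimes> h)) y) < e"
      using uniformly_near_in_compact[OF c continuous_translates[OF assms(1)] _ assms(2)] z topspace_T
      by metis
    have "?near z x" if x: "x \<in> U" for x
    proof (intro ballI)
      fix g h assume "g \<in> carrier G" "h \<in> carrier G"
      then have "norm (f (g \<otimes> x \<otimes> h) - f (g \<otimes> z \<otimes> h)) < e"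
        using U(3)[OF x, of "(g, h)"] topspace_T by simp
      then show "norm (f (g \<otimes> z \<otimes> h) - f (g \<otimes> x \<otimes> h)) \<le> e"
        by (simp add: norm_minus_commute)
    qed
    then show ?thesis
      using U(1,2) by blast
  qed
  then obtain U where U: "\<And>z. z \<in> carrier G \<Longrightarrow> openin T (U z) \<and> z \<in> U z \<and> (\<forall>x\<in>U z. ?near z x)"
    by metis
  have "compactin T (carrier G)"
    using compact_T topspace_T unfolding compact_space_def by simp
  moreover have "\<And>V. V \<in> U ` carrier G \<Longrightarrow> openin T V" "carrier G \<subseteq> \<Union> (U ` carrier G)"
    using U by auto
  ultimately obtain F where F: "finite F" "F \<subseteq> U ` carrier G" "carrier G \<subseteq> \<Union> F"
    unfolding compactin_def by blast
  then obtain B where B: "finite B" "B \<subseteq> carrier G" "F = U ` B"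
    by (meson finite_subset_image)
  obtain l where l: "set l = B"
    using finite_list B(1) by blast
  have net: "\<exists>b\<in>set l. ?near b z" if z: "z \<in> carrier G" for z
  proof -
    obtain b where b: "b \<in> B" "z \<in> U b"
      using z F(3) B(3) by auto
    then have "?near b z"
      using U[of b] B(2) by auto
    then show ?thesis
      using b(1) l by blast
  qed
  then have "l \<noteq> []"
    by force
  then show ?thesis
    using that net l B(2) by blast
qed

text \<open>Suppose an average of \<open>f\<close> varies by at most \<open>D\<close>. If some value
  lies in the lower half of the range, averaging once more over the net places a value near it among
  the summands at every point, which lowers the maximum by about \<open>D / (2 * n)\<close>.
  Otherwise the average already stays in the upper half. Either way the width contracts by a fixed
  rate, up to an error from the net.\<close>

lemma avg_iterate_narrow:
  fixes f :: "'a \<Rightarrow> real"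
  assumes "continuous_map T euclidean f" "0 < e"
  obtains l m where "l \<noteq> []" "set l \<subseteq> carrier G"
    "\<And>x. x \<in> carrier G \<Longrightarrow> m \<le> avg l f x \<and> avg l f x \<le> m + e"
proof -
  \<comment> \<open>The widths obtained below tend to \<open>4 * \<epsilon>\<close>, hence fall
    below \<open>e\<close>.\<close>
  define \<epsilon> where "\<epsilon> = e / 8"
  have \<epsilon>: "0 < \<epsilon>"
    using assms(2) by (simp add: \<epsilon>_def)
  \<comment> \<open>One net for \<open>f\<close> serves all averages of \<open>f\<close>, since it
    controls \<open>f (a \<otimes> b \<otimes> x)\<close> for every left factor \<open>a\<close>.
    Its size \<open>n\<close>, and with it the rate of contraction, stays fixed during the
    iteration.\<close>
  obtain B where B: "B \<noteq> []" "set B \<subseteq> carrier G" "\<And>z. z \<in> carrier G \<Longrightarrow>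
      \<exists>b\<in>set B. \<forall>g\<in>carrier G. \<forall>h\<in>carrier G. norm (f (g \<otimes> b \<otimes> h) - f (g \<otimes> z \<otimes> h)) \<le> \<epsilon>"
    using finite_net[OF assms(1) \<epsilon>] by blast
  define n where "n = real (length B)"
  have n: "1 \<le> n"
    using B(1) by (cases B) (auto simp: n_def)
  have step: "\<exists>l' m'. l' \<noteq> [] \<and> set l' \<subseteq> carrier G \<and>
      (\<forall>x\<in>carrier G. m' \<le> avg l' f x \<and> avg l' f x \<le> m' + (D - (D / 2 - 2 * \<epsilon>) / n))"
    if l: "l \<noteq> []" "set l \<subseteq> carrier G" "\<forall>x\<in>carrier G. m \<le> avg l f x \<and> avg l f x \<le> m + D"
    for l m D
  proof (cases "\<exists>y\<in>carrier G. avg l f y \<le> m + D / 2")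
    case True
    then obtain y where y: "y \<in> carrier G" "avg l f y \<le> m + D / 2"
      by blast
    let ?k = "concat (map (\<lambda>b. map (\<lambda>a. a \<otimes> b) l) B)"
    have "m \<le> avg ?k f x \<and> avg ?k f x \<le> m + (D - (D / 2 - 2 * \<epsilon>) / n)" if x: "x \<in> carrier G" for x
    proof -
      have k: "avg ?k f x = avg B (avg l f) x"
        using avg_avg[of l B x f] l B x by simp
      \<comment> \<open>With \<open>b\<close> near \<open>y \<otimes> inv x\<close>, the point
        \<open>b \<otimes> x\<close> behaves like \<open>y\<close>, where the average is
        small.\<close>
      obtain b where b: "b \<in> set B" "\<And>g h. g \<in> carrier G \<Longrightarrow> h \<in> carrier G \<Longrightarrow>
          norm (f (g \<otimes> b \<otimes> h) - f (g \<otimes> (y \<otimes> inv x) \<otimes> h)) \<le> \<epsilon>"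
        using B(3)[of "y \<otimes> inv x"] x y by auto
      have "b \<in> carrier G"
        using b B by auto
      have "norm (avg l f (b \<otimes> x) - avg l f y) \<le> \<epsilon>"
      proof -
        have "norm ((1 / real (length l)) *\<^sub>R (\<Sum>a\<leftarrow>l. f (a \<otimes> (b \<otimes> x)) - f (a \<otimes> y)) - 0) \<le> \<epsilon>"
        proof (intro norm_list_avg_le l(1))
          fix a assume "a \<in> set l"
          then have a: "a \<in> carrier G"
            using l by auto
          have "a \<otimes> (y \<otimes> inv x) \<otimes> x = a \<otimes> y"
            using a x y by (simp add: m_assoc)
          then show "norm (f (a \<otimes> (b \<otimes> x)) - f (a \<otimes> y) - 0) \<le> \<epsilon>"
            using b(2)[OF a x] a x \<open>b \<in> carrier G\<close> by (simp add: m_assoc)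
        qed
        then show ?thesis
          by (simp add: avg_def sum_list_subtractf right_diff_distrib diff_divide_distrib)
      qed
      then have b_le: "avg l f (b \<otimes> x) \<le> m + D / 2 + \<epsilon>"
        using y by auto
      have bnd: "m \<le> avg l f (a \<otimes> x)" "avg l f (a \<otimes> x) \<le> m + D" if "a \<in> set B" for a
        using that l(3) B x by auto
      have "(\<Sum>a\<leftarrow>B. avg l f (a \<otimes> x)) \<le> n * (m + D) - (D / 2 - \<epsilon>)"
      proof -
        obtain B1 B2 where B12: "B = B1 @ b # B2"
          using b(1) split_list by metis
        have "(\<Sum>a\<leftarrow>C. avg l f (a \<otimes> x)) \<le> real (length C) * (m + D)" if "set C \<subseteq> set B" for C
          using that
        proof (induction C)
          case (Cons a C)
          then have "avg l f (a \<otimes> x) \<le> m + D" "(\<Sum>a\<leftarrow>C. avg l f (a \<otimes> x)) \<le> real (length C) * (m + D)"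
            using bnd(2) by auto
          then show ?case
            by (simp add: algebra_simps)
        qed simp
        moreover have "set B1 \<subseteq> set B" "set B2 \<subseteq> set B"
          unfolding B12 by auto
        ultimately have "(\<Sum>a\<leftarrow>B1. avg l f (a \<otimes> x)) \<le> real (length B1) * (m + D)"
            "(\<Sum>a\<leftarrow>B2. avg l f (a \<otimes> x)) \<le> real (length B2) * (m + D)"
          by blast+
        then show ?thesis
          using b_le unfolding n_def B12 by (simp add: algebra_simps)
      qed
      then have "avg B (avg l f) x \<le> (n * (m + D) - (D / 2 - \<epsilon>)) / n"
        unfolding avg_def[of B] n_def[symmetric] using n by (simp add: divide_right_mono)
      also have "\<dots> = m + D - (D / 2 - \<epsilon>) / n"
        using n by (simp add: field_simps)
      also have "\<dots> \<le> m + (D - (D / 2 - 2 * \<epsilon>) / n)"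
        using n \<epsilon> by (simp add: divide_right_mono)
      finally have up: "avg B (avg l f) x \<le> m + (D - (D / 2 - 2 * \<epsilon>) / n)" .
      have "real (length C) * m \<le> (\<Sum>a\<leftarrow>C. avg l f (a \<otimes> x))" if "set C \<subseteq> set B" for C
        using that
      proof (induction C)
        case (Cons a C)
        then have "m \<le> avg l f (a \<otimes> x)" "real (length C) * m \<le> (\<Sum>a\<leftarrow>C. avg l f (a \<otimes> x))"
          using bnd(1) by auto
        then show ?case
          by (simp add: algebra_simps)
      qed simp
      from this[of B] have "m \<le> avg B (avg l f) x"
        unfolding avg_def[of B] n_def[symmetric] using n by (simp add: field_simps)
      then show ?thesis
        using up k by simp
    qed
    then show ?thesis
      using concat_products_closed[OF l(2) B(2) l(1) B(1)] by blast
  next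
    \<comment> \<open>Here nothing is averaged: raising the lower bound to the midpoint halves the
      width.\<close>
    case False
    have "m + D / 2 \<le> avg l f x \<and> avg l f x \<le> m + D / 2 + (D - (D / 2 - 2 * \<epsilon>) / n)" if x: "x \<in> carrier G" for x
    proof -
      have lo: "m + D / 2 < avg l f x" and hi: "avg l f x \<le> m + D"
        using False l(3) x by (auto simp: not_le)
      have "D / 2 - (D / 2 - 2 * \<epsilon>) / n \<ge> 0"
      proof -
        have "0 \<le> D"
          using lo hi by linarith
        then have "D / 2 * 1 \<le> D / 2 * n"
          using n by (intro mult_left_mono) auto
        then show ?thesis
          using n \<epsilon> by (simp add: field_simps)
      qed
      then show ?thesis
        using lo hi by linarith
    qed
    then show ?thesis
      using l by blast
  qed
  have "bounded (f ` carrier G)"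
  proof -
    have "compactin euclidean (f ` topspace T)"
      using image_compactin compact_T assms(1) unfolding compact_space_def by blast
    then show ?thesis
      using topspace_T by (simp add: compact_imp_bounded)
  qed
  then obtain K where K: "\<And>x. x \<in> carrier G \<Longrightarrow> \<bar>f x\<bar> \<le> K"
    by (auto simp: bounded_iff)
  \<comment> \<open>Solution of the recursion in \<open>step\<close>: the fixed point is
    \<open>4 * \<epsilon>\<close>, and the deviation from it shrinks by
    \<open>1 - 1 / (2 * n)\<close> each time. The initial deviation \<open>2 * K\<close> covers the
    range of \<open>f\<close>.\<close>
  define D where "D = (\<lambda>k. 4 * \<epsilon> + (1 - 1 / (2 * n)) ^ k * (2 * K))"
  have D_step: "D k - (D k / 2 - 2 * \<epsilon>) / n = D (Suc k)" for k
    using n by (simp add: D_def field_simps)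
  have "\<exists>l m. l \<noteq> [] \<and> set l \<subseteq> carrier G \<and> (\<forall>x\<in>carrier G. m \<le> avg l f x \<and> avg l f x \<le> m + D k)" for k
  proof (induction k)
    case 0
    have "- K \<le> avg [\<one>] f x \<and> avg [\<one>] f x \<le> - K + D 0" if "x \<in> carrier G" for x
      using K[OF that] that \<epsilon> by (auto simp: avg_def D_def)
    then show ?case
      by (intro exI[of _ "[\<one>]"] exI[of _ "- K"]) auto
  next
    case (Suc k)
    then show ?case
      using step[of _ _ "D k"] unfolding D_step by blast
  qed
  moreover have "\<exists>k. D k \<le> e"
  proof -
    have "(\<lambda>k. (1 - 1 / (2 * n)) ^ k * (2 * K)) \<longlonglongrightarrow> 0 * (2 * K)"
      using n by (intro tendsto_intros LIMSEQ_power_zero) (simp add: field_simps)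
    then have "\<forall>\<^sub>F k in sequentially. (1 - 1 / (2 * n)) ^ k * (2 * K) < \<epsilon>"
      using \<epsilon> by (simp add: order_tendstoD)
    then obtain k where "(1 - 1 / (2 * n)) ^ k * (2 * K) < \<epsilon>"
      by (meson eventually_sequentially order_refl)
    then have "D k \<le> e"
      using \<epsilon> by (simp add: D_def \<epsilon>_def)
    then show ?thesis ..
  qed
  ultimately obtain k l m where "D k \<le> e" "l \<noteq> []" "set l \<subseteq> carrier G"
      "\<forall>x\<in>carrier G. m \<le> avg l f x \<and> avg l f x \<le> m + D k"
    by blast
  then show ?thesis
    by (intro that[of l m]) force+
qed

end

section \<open>Existence, linearity and continuity of the mean\<close>

context compact_group
begin

lemma is_meanE:
  assumes "is_mean f c" "0 < e"
  obtains l where "l \<noteq> []" "set l \<subseteq> carrier G" "\<And>x. x \<in> carrier G \<Longrightarrow> norm (avg l f x - c) \<le> e"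
  using assms unfolding is_mean_def by meson

lemma is_rmeanE:
  assumes "is_rmean f c" "0 < e"
  obtains l where "l \<noteq> []" "set l \<subseteq> carrier G" "\<And>x. x \<in> carrier G \<Longrightarrow> norm (ravg l f x - c) \<le> e"
  using assms unfolding is_rmean_def by meson

lemma continuous_translate_left: 
  assumes "a \<in> carrier G"
  shows "continuous_map T T (\<lambda>x. a \<otimes> x)"
proof -
  have "continuous_map T (prod_topology T T) (\<lambda>x. (a, x))"
    using assms topspace_T by (simp add: continuous_map_pairedI)
  from continuous_map_compose[OF this continuous_mult] show ?thesis
    by (simp add: o_def)
qed

lemma continuous_translate_right: 
  assumes "a \<in> carrier G"
  shows "continuous_map T T (\<lambda>x. x \<otimes> a)"
proof -
  have "continuous_map T (prod_topology T T) (\<lambda>x. (x, a))"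
    using assms topspace_T by (simp add: continuous_map_pairedI)
  from continuous_map_compose[OF this continuous_mult] show ?thesis
    by (simp add: o_def)
qed

lemma continuous_avg:
  fixes f :: "'a \<Rightarrow> real"
  assumes "continuous_map T euclidean f" "set l \<subseteq> carrier G"
  shows "continuous_map T euclidean (avg l f)"
proof -
  have "continuous_map T euclidean (\<lambda>x. \<Sum>a\<leftarrow>l. f (a \<otimes> x))"
    using assms(2)
  proof (induction l)
    case (Cons a l)
    have "continuous_map T euclidean (f \<circ> (\<lambda>x. a \<otimes> x))"
      using Cons.prems by (intro continuous_map_compose[OF continuous_translate_left assms(1)]) auto
    then show ?case
      using Cons by (simp add: o_def continuous_map_add)
  qed simp
  then have "continuous_map T euclidean (\<lambda>x. (1 / real (length l)) * (\<Sum>a\<leftarrow>l. f (a \<otimes> x)))"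
    by (intro continuous_map_real_mult) auto
  then show ?thesis
    unfolding avg_def[abs_def] by simp
qed

lemma avg_inv:
  assumes "set l \<subseteq> carrier G" "x \<in> carrier G"
  shows "avg l (\<lambda>y. f (inv y)) (inv x) = ravg (map (\<lambda>a. inv a) l) f x"
    and "ravg l f x = avg (map (\<lambda>a. inv a) l) (\<lambda>y. f (inv y)) (inv x)"
proof -
  have "(\<Sum>a\<leftarrow>l. f (inv (a \<otimes> inv x))) = (\<Sum>a\<leftarrow>l. f (x \<otimes> inv a))"
    using assms by (intro arg_cong[of _ _ sum_list] map_cong) (auto simp: inv_mult_group)
  then show "avg l (\<lambda>y. f (inv y)) (inv x) = ravg (map (\<lambda>a. inv a) l) f x"
    by (simp add: avg_def ravg_def o_def)
  have "(\<Sum>a\<leftarrow>l. f (x \<otimes> a)) = (\<Sum>a\<leftarrow>l. f (inv (inv a \<otimes> inv x)))"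
    using assms by (intro arg_cong[of _ _ sum_list] map_cong) (auto simp: inv_mult_group)
  then show "ravg l f x = avg (map (\<lambda>a. inv a) l) (\<lambda>y. f (inv y)) (inv x)"
    by (simp add: avg_def ravg_def o_def)
qed

lemma is_rmean_iff: "is_rmean f c \<longleftrightarrow> is_mean (\<lambda>y. f (inv y)) c"
proof
  assume r: "is_rmean f c"
  show "is_mean (\<lambda>y. f (inv y)) c"
    unfolding is_mean_def
  proof (intro allI impI)
    fix e :: real assume "0 < e"
    then obtain l where l: "l \<noteq> []" "set l \<subseteq> carrier G" "\<And>x. x \<in> carrier G \<Longrightarrow> norm (ravg l f x - c) \<le> e"
      using is_rmeanE[OF r] by metis
    have "norm (avg (map (\<lambda>a. inv a) l) (\<lambda>y. f (inv y)) x - c) \<le> e" if "x \<in> carrier G" for x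
      using l(3)[of "inv x"] avg_inv(2)[OF l(2), of "inv x" f] that by simp
    then show "\<exists>l. l \<noteq> [] \<and> set l \<subseteq> carrier G \<and>
        (\<forall>x\<in>carrier G. norm (avg l (\<lambda>y. f (inv y)) x - c) \<le> e)"
      using l(1,2) by (intro exI[of _ "map (\<lambda>a. inv a) l"]) auto
  qed
next
  assume r: "is_mean (\<lambda>y. f (inv y)) c"
  show "is_rmean f c"
    unfolding is_rmean_def
  proof (intro allI impI)
    fix e :: real assume "0 < e"
    then obtain l where l: "l \<noteq> []" "set l \<subseteq> carrier G"
      "\<And>x. x \<in> carrier G \<Longrightarrow> norm (avg l (\<lambda>y. f (inv y)) x - c) \<le> e"
      using is_meanE[OF r] by metis
    have "norm (ravg (map (\<lambda>a. inv a) l) f x - c) \<le> e" if "x \<in> carrier G" for x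
      using l(3)[of "inv x"] avg_inv(1)[OF l(2) that, of f] that by simp
    then show "\<exists>l. l \<noteq> [] \<and> set l \<subseteq> carrier G \<and> (\<forall>x\<in>carrier G. norm (ravg l f x - c) \<le> e)"
      using l(1,2) by (intro exI[of _ "map (\<lambda>a. inv a) l"]) auto
  qed
qed

text \<open>Apply a good left average and a good right average together: the result is near
  \<open>c\<close> and near \<open>d\<close>.\<close>

lemma is_mean_unique:
  assumes "is_mean f c" "is_rmean f d"
  shows "c = d"
proof (rule ccontr)
  assume "c \<noteq> d"
  define e where "e = norm (c - d) / 3"
  have e: "0 < e"
    using \<open>c \<noteq> d\<close> by (simp add: e_def)
  obtain l where l: "l \<noteq> []" "set l \<subseteq> carrier G" "\<And>x. x \<in> carrier G \<Longrightarrow> norm (avg l f x - c) \<le> e"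
    using is_meanE[OF assms(1) e] by metis
  obtain k where k: "k \<noteq> []" "set k \<subseteq> carrier G" "\<And>x. x \<in> carrier G \<Longrightarrow> norm (ravg k f x - d) \<le> e"
    using is_rmeanE[OF assms(2) e] by metis
  have "norm (ravg k (avg l f) \<one> - c) \<le> e"
    by (rule ravg_near[OF k(1,2) one_closed l(3)])
  moreover have "norm (avg l (ravg k f) \<one> - d) \<le> e"
    by (rule avg_near[OF l(1,2) one_closed k(3)])
  ultimately have "norm (c - d) \<le> e + e"
    unfolding ravg_avg_commute[OF l(2) k(2) one_closed]
    by (smt (verit) norm_triangle_ineq4 diff_diff_eq2 diff_add_cancel norm_minus_commute)
  then show False
    using e by (simp add: e_def)
qed

text \<open>A lower bound of a left average is at most an upper bound of a right average, and
  conversely, because both bound the same double average at \<open>\<one>\<close>. As averages of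
  arbitrarily small width exist on both sides, all these intervals close in on one number.\<close>

lemma real_mean_exists:
  fixes f :: "'a \<Rightarrow> real"
  assumes f: "continuous_map T euclidean f"
  obtains c where "is_mean f c" "is_rmean f c"
proof -
  have left: "\<exists>l m. l \<noteq> [] \<and> set l \<subseteq> carrier G \<and> (\<forall>x\<in>carrier G. m \<le> avg l f x \<and> avg l f x \<le> m + e)"
    if e: "0 < e" for e
    using avg_iterate_narrow[OF f e] by metis
  have right: "\<exists>l m. l \<noteq> [] \<and> set l \<subseteq> carrier G \<and> (\<forall>x\<in>carrier G. m \<le> ravg l f x \<and> ravg l f x \<le> m + e)"
    if e: "0 < e" for e
  proof -
    have "continuous_map T euclidean (f \<circ> (\<lambda>x. inv x))"
      using continuous_inv f by (rule continuous_map_compose)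
    then obtain l m where l: "l \<noteq> []" "set l \<subseteq> carrier G"
      "\<And>x. x \<in> carrier G \<Longrightarrow> m \<le> avg l (\<lambda>y. f (inv y)) x \<and> avg l (\<lambda>y. f (inv y)) x \<le> m + e"
      using avg_iterate_narrow[OF _ e] unfolding o_def by metis
    have "m \<le> ravg (map (\<lambda>a. inv a) l) f x \<and> ravg (map (\<lambda>a. inv a) l) f x \<le> m + e"
      if "x \<in> carrier G" for x
      using l(3)[of "inv x"] avg_inv(1)[OF l(2) that, of f] that by simp
    then show ?thesis
      using l(1,2) by (intro exI[of _ "map (\<lambda>a. inv a) l"] exI[of _ m]) auto
  qed
  have lower: "m \<le> m' + d" if "l \<noteq> []" "set l \<subseteq> carrier G" "k \<noteq> []" "set k \<subseteq> carrier G"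
    "\<And>x. x \<in> carrier G \<Longrightarrow> m \<le> avg l f x" "\<And>x. x \<in> carrier G \<Longrightarrow> ravg k f x \<le> m' + d" for l k m m' d
  proof -
    have 1: "m \<le> ravg k (avg l f) \<one>"
    proof -
      have "real (length k) * m \<le> (\<Sum>a\<leftarrow>k. avg l f (\<one> \<otimes> a))"
        using \<open>set k \<subseteq> carrier G\<close>
      proof (induction k)
        case (Cons a k)
        then have "m \<le> avg l f (\<one> \<otimes> a)"
          using that(5) by auto
        then show ?case
          using Cons by (simp add: algebra_simps)
      qed simp
      then show ?thesis
        using \<open>k \<noteq> []\<close> by (simp add: ravg_def field_simps)
    qed
    have 2: "avg l (ravg k f) \<one> \<le> m' + d"
    proof -
      have "(\<Sum>a\<leftarrow>l. ravg k f (a \<otimes> \<one>)) \<le> real (length l) * (m' + d)"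
        using \<open>set l \<subseteq> carrier G\<close>
      proof (induction l)
        case (Cons a l)
        then have "ravg k f (a \<otimes> \<one>) \<le> m' + d"
          using that(6) by auto
        then show ?case
          using Cons by (simp add: algebra_simps)
      qed simp
      then show ?thesis
        using \<open>l \<noteq> []\<close> by (simp add: avg_def field_simps)
    qed
    show ?thesis
      using 1 2 ravg_avg_commute[OF that(2,4) one_closed, of f] by simp
  qed
  have upper: "m' \<le> m + d" if "l \<noteq> []" "set l \<subseteq> carrier G" "k \<noteq> []" "set k \<subseteq> carrier G"
    "\<And>x. x \<in> carrier G \<Longrightarrow> m' \<le> ravg k f x" "\<And>x. x \<in> carrier G \<Longrightarrow> avg l f x \<le> m + d" for l k m m' d
  proof -
    have 1: "m' \<le> avg l (ravg k f) \<one>"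
    proof -
      have "real (length l) * m' \<le> (\<Sum>a\<leftarrow>l. ravg k f (a \<otimes> \<one>))"
        using \<open>set l \<subseteq> carrier G\<close>
      proof (induction l)
        case (Cons a l)
        then have "m' \<le> ravg k f (a \<otimes> \<one>)"
          using that(5) by auto
        then show ?case
          using Cons by (simp add: algebra_simps)
      qed simp
      then show ?thesis
        using \<open>l \<noteq> []\<close> by (simp add: avg_def field_simps)
    qed
    have 2: "ravg k (avg l f) \<one> \<le> m + d"
    proof -
      have "(\<Sum>a\<leftarrow>k. avg l f (\<one> \<otimes> a)) \<le> real (length k) * (m + d)"
        using \<open>set k \<subseteq> carrier G\<close>
      proof (induction k)
        case (Cons a k)
        then have "avg l f (\<one> \<otimes> a) \<le> m + d"
          using that(6) by auto
        then show ?case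
          using Cons by (simp add: algebra_simps)
      qed simp
      then show ?thesis
        using \<open>k \<noteq> []\<close> by (simp add: ravg_def field_simps)
    qed
    show ?thesis
      using 1 2 ravg_avg_commute[OF that(2,4) one_closed, of f] by simp
  qed
  \<comment> \<open>Lower bounds of left averages; every upper bound of a right average bounds this
    set, and its supremum is the mean.\<close>
  define S where "S = {m. \<exists>l. l \<noteq> [] \<and> set l \<subseteq> carrier G \<and> (\<forall>x\<in>carrier G. m \<le> avg l f x)}"
  have S_le: "m \<le> m' + d" if "m \<in> S" "k \<noteq> []" "set k \<subseteq> carrier G" "\<And>x. x \<in> carrier G \<Longrightarrow> ravg k f x \<le> m' + d"
    for m m' d k
    using that lower unfolding S_def by blast
  have S_ne: "S \<noteq> {}"
    using left[of 1] unfolding S_def by auto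
  have S_bdd: "bdd_above S"
    using right[of 1] S_le unfolding bdd_above_def by (metis zero_less_one)
  define c where "c = Sup S"
  have mean_left: "m \<le> c \<and> c \<le> m + e" if l: "l \<noteq> []" "set l \<subseteq> carrier G"
    "\<forall>x\<in>carrier G. m \<le> avg l f x \<and> avg l f x \<le> m + e" for l m e
  proof
    show "m \<le> c"
      unfolding c_def using l S_bdd by (intro cSup_upper) (auto simp: S_def)
    show "c \<le> m + e"
    proof (rule field_le_epsilon)
      fix d :: real assume "0 < d"
      then obtain k m' where k: "k \<noteq> []" "set k \<subseteq> carrier G"
        "\<forall>x\<in>carrier G. m' \<le> ravg k f x \<and> ravg k f x \<le> m' + d"
        using right by blast
      have "m' \<le> m + e"
        using upper[OF l(1,2) k(1,2)] k(3) l(3) by blast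
      moreover have "c \<le> m' + d"
        unfolding c_def using S_ne S_le k by (intro cSup_least) auto
      ultimately show "c \<le> m + e + d"
        by linarith
    qed
  qed
  have mean_right: "m' - d \<le> c \<and> c \<le> m' + d" if k: "k \<noteq> []" "set k \<subseteq> carrier G"
    "\<forall>x\<in>carrier G. m' \<le> ravg k f x \<and> ravg k f x \<le> m' + d" "0 < d" for k m' d
  proof
    show "c \<le> m' + d"
      unfolding c_def using S_ne S_le k by (intro cSup_least) auto
    obtain l m where l: "l \<noteq> []" "set l \<subseteq> carrier G"
      "\<forall>x\<in>carrier G. m \<le> avg l f x \<and> avg l f x \<le> m + d"
      using left[OF \<open>0 < d\<close>] by blast
    have "m' \<le> m + d"
      using upper[OF l(1,2) k(1,2)] k(3) l(3) by blast
    then show "m' - d \<le> c"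
      using mean_left[OF l] by linarith
  qed
  show ?thesis
  proof (rule that[of c])
    show "is_mean f c"
      unfolding is_mean_def
    proof (intro allI impI)
      fix e :: real assume "0 < e"
      then obtain l m where l: "l \<noteq> []" "set l \<subseteq> carrier G"
        "\<forall>x\<in>carrier G. m \<le> avg l f x \<and> avg l f x \<le> m + e"
        using left by blast
      have "\<forall>x\<in>carrier G. norm (avg l f x - c) \<le> e"
        using l(3) mean_left[OF l] by (force simp: abs_le_iff)
      then show "\<exists>l. l \<noteq> [] \<and> set l \<subseteq> carrier G \<and> (\<forall>x\<in>carrier G. norm (avg l f x - c) \<le> e)"
        using l by blast
    qed
    show "is_rmean f c"
      unfolding is_rmean_def
    proof (intro allI impI)
      fix e :: real assume "0 < e"
      then obtain k m where k: "k \<noteq> []" "set k \<subseteq> carrier G"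
        "\<forall>x\<in>carrier G. m \<le> ravg k f x \<and> ravg k f x \<le> m + e / 2"
        using right[of "e / 2"] by auto
      have "\<forall>x\<in>carrier G. norm (ravg k f x - c) \<le> e"
        using k(3) mean_right[OF k] \<open>0 < e\<close> by (force simp: abs_le_iff)
      then show "\<exists>l. l \<noteq> [] \<and> set l \<subseteq> carrier G \<and> (\<forall>x\<in>carrier G. norm (ravg l f x - c) \<le> e)"
        using k by blast
    qed
  qed
qed

text \<open>Average first by a list that is good for \<open>f\<close>, then by one that is good for
  the averaged \<open>h\<close>. The second averaging does not spoil the first, and by uniqueness
  the averaged \<open>h\<close> still has mean \<open>d\<close>, which fixes the limit of the
  sum.\<close>

lemma is_mean_add_scaleR:
  fixes f :: "'a \<Rightarrow> 'v::real_normed_vector" and h :: "'a \<Rightarrow> real"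
  assumes "is_mean f c" "continuous_map T euclidean h" "is_rmean h d"
  shows "is_mean (\<lambda>x. f x + h x *\<^sub>R v) (c + d *\<^sub>R v)"
  unfolding is_mean_def
proof (intro allI impI)
  fix e :: real assume e: "0 < e"
  define \<epsilon> where "\<epsilon> = e / (2 * (1 + norm v))"
  have \<epsilon>: "0 < \<epsilon>" "\<epsilon> * norm v \<le> e / 2"
    using e by (auto simp: \<epsilon>_def field_simps add_pos_nonneg)
  obtain l where l: "l \<noteq> []" "set l \<subseteq> carrier G" "\<And>x. x \<in> carrier G \<Longrightarrow> norm (avg l f x - c) \<le> e / 2"
    using is_meanE[OF assms(1) half_gt_zero[OF e]] by metis
  obtain d' where d': "is_mean (avg l h) d'"
    using real_mean_exists[OF continuous_avg[OF assms(2) l(2)]] by blast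
  have "is_mean h d'"
    unfolding is_mean_def
  proof (intro allI impI)
    fix e :: real assume "0 < e"
    then obtain k where k: "k \<noteq> []" "set k \<subseteq> carrier G" "\<And>x. x \<in> carrier G \<Longrightarrow> norm (avg k (avg l h) x - d') \<le> e"
      using is_meanE[OF d'] by metis
    then show "\<exists>l. l \<noteq> [] \<and> set l \<subseteq> carrier G \<and> (\<forall>x\<in>carrier G. norm (avg l h x - d') \<le> e)"
      using concat_products_closed[OF l(2) k(2) l(1) k(1)] avg_avg[OF l(2) k(2), of _ h]
      by (intro exI[of _ "concat (map (\<lambda>b. map (\<lambda>a. a \<otimes> b) l) k)"]) simp
  qed
  then have "d' = d"
    using assms(3) by (rule is_mean_unique)
  then have "is_mean (avg l h) d"
    using d' by simp
  then obtain k where k: "k \<noteq> []" "set k \<subseteq> carrier G"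
    "\<And>x. x \<in> carrier G \<Longrightarrow> norm (avg k (avg l h) x - d) \<le> \<epsilon>"
    using is_meanE[OF _ \<epsilon>(1)] by metis
  let ?k = "concat (map (\<lambda>b. map (\<lambda>a. a \<otimes> b) l) k)"
  have "norm (avg ?k (\<lambda>x. f x + h x *\<^sub>R v) x - (c + d *\<^sub>R v)) \<le> e" if x: "x \<in> carrier G" for x
  proof -
    have "avg ?k (\<lambda>x. f x + h x *\<^sub>R v) x = avg ?k f x + avg ?k h x *\<^sub>R v"
    proof -
      have "(\<Sum>a\<leftarrow>l. h (a \<otimes> x) *\<^sub>R v) = (\<Sum>a\<leftarrow>l. h (a \<otimes> x)) *\<^sub>R v" for l
        by (induction l) (auto simp: scaleR_add_left)
      then show ?thesis
        unfolding avg_def by (simp only: sum_list_addf scaleR_add_right) simp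
    qed
    also have "\<dots> = avg k (avg l f) x + avg k (avg l h) x *\<^sub>R v"
      using avg_avg[OF l(2) k(2) x, of f] avg_avg[OF l(2) k(2) x, of h] by simp
    finally have "avg ?k (\<lambda>x. f x + h x *\<^sub>R v) x - (c + d *\<^sub>R v) =
        (avg k (avg l f) x - c) + (avg k (avg l h) x - d) *\<^sub>R v"
      by (simp add: scaleR_diff_left)
    also have "norm \<dots> \<le> e / 2 + \<epsilon> * norm v"
      using avg_near[OF k(1,2) x l(3)] k(3)[OF x]
      by (intro norm_triangle_le add_mono) (auto intro: mult_right_mono)
    finally show ?thesis
      using \<epsilon>(2) by linarith
  qed
  then show "\<exists>l. l \<noteq> [] \<and> set l \<subseteq> carrier G \<and>
      (\<forall>x\<in>carrier G. norm (avg l (\<lambda>x. f x + h x *\<^sub>R v) x - (c + d *\<^sub>R v)) \<le> e)"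
    using concat_products_closed[OF l(2) k(2) l(1) k(1)] by blast
qed

lemma is_mean_add_sum:
  fixes f :: "'a \<Rightarrow> 'v::real_normed_vector" and h :: "'k \<Rightarrow> 'a \<Rightarrow> real"
  assumes "finite K" "is_mean f c" "\<And>k. k \<in> K \<Longrightarrow> continuous_map T euclidean (h k) \<and> is_rmean (h k) (d k)"
  shows "is_mean (\<lambda>x. f x + (\<Sum>k\<in>K. h k x *\<^sub>R v k)) (c + (\<Sum>k\<in>K. d k *\<^sub>R v k))"
  using assms(1,3)
proof (induction K rule: finite_induct)
  case (insert k K)
  have "is_mean (\<lambda>x. (f x + (\<Sum>k\<in>K. h k x *\<^sub>R v k)) + h k x *\<^sub>R v k) ((c + (\<Sum>k\<in>K. d k *\<^sub>R v k)) + d k *\<^sub>R v k)"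
    using insert by (intro is_mean_add_scaleR) auto
  then show ?case
    using insert.hyps by (simp add: algebra_simps)
qed (use assms(2) in simp)

lemma is_mean_zero: "is_mean (\<lambda>x. 0) 0"
  unfolding is_mean_def by (intro allI impI exI[of _ "[\<one>]"]) (simp add: avg_def)

text \<open>Both sides are demanded because uniqueness compares a left mean with a right
  mean.\<close>

definition mean :: "('a \<Rightarrow> 'v::real_normed_vector) \<Rightarrow> 'v"
  where "mean f = (SOME c. is_mean f c \<and> is_rmean f c)"

definition fmat_map :: "nat \<Rightarrow> ('a \<Rightarrow> fmat) \<Rightarrow> bool"
  where "fmat_map n f \<longleftrightarrow> continuous_map T euclidean f \<and> (\<forall>x\<in>carrier G. f x \<in> fmats n)"

text \<open>Real and imaginary parts of the entries reduce matrix-valued functions to real ones, for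
  which order arguments produced the mean.\<close>

lemma fmat_map_expand:
  assumes "fmat_map n f"
  obtains K :: "(nat \<times> nat \<times> bool) set" and h :: "nat \<times> nat \<times> bool \<Rightarrow> 'a \<Rightarrow> real" and v
    where "finite K" "\<And>k. continuous_map T euclidean (h k)"
      "\<And>x. x \<in> carrier G \<Longrightarrow> f x = (\<Sum>k\<in>K. h k x *\<^sub>R v k)"
proof -
  define h :: "nat \<times> nat \<times> bool \<Rightarrow> 'a \<Rightarrow> real"
    where "h = (\<lambda>(i, j, s) x. (if s then Re (entry (f x) i j) else Im (entry (f x) i j)))"
  define v where "v = (\<lambda>(i, j, s). (if s then 1 else \<i>) *\<^sub>c elem_fmat i j)"
  have c: "continuous_map T euclidean f"
    using assms by (simp add: fmat_map_def)
  have e: "continuous_map T euclidean (\<lambda>x. entry (f x) i j)" for i j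
    using continuous_map_compose[OF c, of euclidean "\<lambda>a. entry a i j"]
      bounded_linear.continuous_on[OF bounded_linear_entry continuous_on_id]
    by (simp add: o_def continuous_map_iff_continuous2)
  have "continuous_map T euclidean (h k)" for k
  proof -
    obtain i j s where "k = (i, j, s)"
      by (cases k)
    moreover have "continuous_map T euclidean (Re \<circ> (\<lambda>x. entry (f x) i j))"
      "continuous_map T euclidean (Im \<circ> (\<lambda>x. entry (f x) i j))"
      using e by (intro continuous_map_compose[OF e]; simp add: continuous_map_iff_continuous2 continuous_intros)+
    ultimately show ?thesis
      by (cases s) (auto simp: h_def o_def)
  qed
  moreover have "f x = (\<Sum>k\<in>{..<n} \<times> {..<n} \<times> UNIV. h k x *\<^sub>R v k)" if "x \<in> carrier G" for x
  proof -
    have "(\<Sum>s\<in>UNIV. h (i, j, s) x *\<^sub>R v (i, j, s)) = entry (f x) i j *\<^sub>c elem_fmat i j" for i j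
      by (rule fmat_eqI) (simp add: UNIV_bool h_def v_def entry_elem_fmat complex_eq_iff)
    then have "(\<Sum>i<n. \<Sum>j<n. \<Sum>s\<in>UNIV. h (i, j, s) x *\<^sub>R v (i, j, s)) = f x"
      using fmat_expand[of "f x" n] assms that by (simp add: fmat_map_def)
    then show ?thesis
      by (simp add: sum.cartesian_product case_prod_unfold)
  qed
  ultimately show ?thesis
    using that[of "{..<n} \<times> {..<n} \<times> UNIV" h v] by simp
qed

lemma is_mean_cong: "(\<And>x. x \<in> carrier G \<Longrightarrow> f x = g x) \<Longrightarrow> is_mean f c \<longleftrightarrow> is_mean g c"
proof -
  assume fg: "\<And>x. x \<in> carrier G \<Longrightarrow> f x = g x"
  have "avg l f x = avg l g x" if "set l \<subseteq> carrier G" "x \<in> carrier G" for l x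
    unfolding avg_def using that fg
    by (intro arg_cong[of _ _ "\<lambda>s. _ *\<^sub>R sum_list s"] map_cong) auto
  then show ?thesis
    unfolding is_mean_def by (metis (no_types, lifting))
qed

lemma is_mean_add:
  assumes "is_mean f c" "fmat_map n g"
  obtains d where "is_mean g d" "is_rmean g d" "is_mean (\<lambda>x. f x + g x) (c + d)"
proof -
  obtain K h v where K: "finite (K :: (nat \<times> nat \<times> bool) set)" "\<And>k. continuous_map T euclidean (h k)"
      "\<And>x. x \<in> carrier G \<Longrightarrow> g x = (\<Sum>k\<in>K. h k x *\<^sub>R v k)"
    using fmat_map_expand[OF assms(2)] by metis
  have "\<exists>d. is_mean (h k) d \<and> is_rmean (h k) d" for k
    using real_mean_exists[OF K(2)] by blast
  then obtain d where d: "\<And>k. is_mean (h k) (d k)" "\<And>k. is_rmean (h k) (d k)"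
    by metis
  let ?d = "\<Sum>k\<in>K. d k *\<^sub>R v k"
  have "is_mean (\<lambda>x. 0 + (\<Sum>k\<in>K. h k x *\<^sub>R v k)) (0 + ?d)"
    using K d by (intro is_mean_add_sum is_mean_zero) auto
  then have 1: "is_mean g ?d"
    using K(3) is_mean_cong[of g] by simp
  have "continuous_map T euclidean (\<lambda>x. h k (inv x))" for k
    using continuous_map_compose[OF continuous_inv K(2)] by (simp add: o_def)
  moreover have "is_rmean (\<lambda>x. h k (inv x)) (d k)" for k
    using d(1)[of k] is_mean_cong[of "\<lambda>x. h k (inv (inv x))" "h k"] by (simp add: is_rmean_iff)
  ultimately have "is_mean (\<lambda>x. 0 + (\<Sum>k\<in>K. h k (inv x) *\<^sub>R v k)) (0 + ?d)"
    using K by (intro is_mean_add_sum is_mean_zero) auto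
  then have 2: "is_rmean g ?d"
    unfolding is_rmean_iff using K(3) is_mean_cong[of "\<lambda>x. g (inv x)"] by simp
  have "is_mean (\<lambda>x. f x + (\<Sum>k\<in>K. h k x *\<^sub>R v k)) (c + ?d)"
    using K d assms(1) by (intro is_mean_add_sum) auto
  then have "is_mean (\<lambda>x. f x + g x) (c + ?d)"
    using K(3) is_mean_cong[of "\<lambda>x. f x + g x"] by simp
  then show ?thesis
    using that 1 2 by blast
qed

lemma mean_is_mean:
  assumes "fmat_map n f"
  shows "is_mean f (mean f)" "is_rmean f (mean f)"
proof -
  obtain d where "is_mean f d" "is_rmean f d"
    using is_mean_add[OF is_mean_zero assms] by metis
  then have "is_mean f (mean f) \<and> is_rmean f (mean f)"
    unfolding mean_def by (metis (mono_tags, lifting) someI_ex)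
  then show "is_mean f (mean f)" "is_rmean f (mean f)"
    by auto
qed

lemma mean_eqI: "fmat_map n f \<Longrightarrow> is_mean f c \<Longrightarrow> mean f = c"
  using mean_is_mean is_mean_unique by blast

lemma mean_cong:
  assumes "\<And>x. x \<in> carrier G \<Longrightarrow> f x = g x" "fmat_map n f"
  shows "mean f = mean g"
proof -
  have "fmat_map n g"
    using assms topspace_T unfolding fmat_map_def by (metis continuous_map_eq)
  moreover have "is_mean g (mean f)"
    using mean_is_mean(1)[OF assms(2)] is_mean_cong[of f g "mean f", OF assms(1)] by simp
  ultimately show ?thesis
    using mean_eqI by simp
qed

lemma mean_add:
  assumes "fmat_map n f" "fmat_map n g"
  shows "mean (\<lambda>x. f x + g x) = mean f + mean g"
proof -
  obtain d where d: "is_mean g d" "is_mean (\<lambda>x. f x + g x) (mean f + d)"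
    using is_mean_add[OF mean_is_mean(1)[OF assms(1)] assms(2)] by metis
  have "fmat_map n (\<lambda>x. f x + g x)"
    using assms by (auto simp: fmat_map_def continuous_map_add)
  then show ?thesis
    using mean_eqI[OF _ d(2)] mean_eqI[OF assms(2) d(1)] by simp
qed

lemma mean_linear:
  assumes "fmat_map n f" "bounded_linear L" "\<And>a. a \<in> fmats n \<Longrightarrow> L a \<in> fmats n"
  shows "mean (\<lambda>x. L (f x)) = L (mean f)"
proof (rule mean_eqI)
  interpret L: bounded_linear L by fact
  have "continuous_map T euclidean (L \<circ> f)"
    using assms(1) L.continuous_on[OF continuous_on_id]
    by (intro continuous_map_compose[of T euclidean]) (auto simp: fmat_map_def continuous_map_iff_continuous2)
  then show "fmat_map n (\<lambda>x. L (f x))"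
    using assms by (auto simp: fmat_map_def o_def)
  show "is_mean (\<lambda>x. L (f x)) (L (mean f))"
    unfolding is_mean_def
  proof (intro allI impI)
    fix e :: real assume "0 < e"
    obtain K where K: "0 < K" "\<And>x. norm (L x) \<le> norm x * K"
      using L.pos_bounded by blast
    obtain l where l: "l \<noteq> []" "set l \<subseteq> carrier G" "\<And>x. x \<in> carrier G \<Longrightarrow> norm (avg l f x - mean f) \<le> e / K"
      using is_meanE[OF mean_is_mean(1)[OF assms(1)] divide_pos_pos[OF \<open>0 < e\<close> K(1)]] by metis
    have "norm (avg l (\<lambda>x. L (f x)) x - L (mean f)) \<le> e" if "x \<in> carrier G" for x
    proof -
      have "(\<Sum>a\<leftarrow>l. L (f (a \<otimes> x))) = L (\<Sum>a\<leftarrow>l. f (a \<otimes> x))"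
        by (induction l) (auto simp: L.add L.zero)
      then have "avg l (\<lambda>x. L (f x)) x - L (mean f) = L (avg l f x - mean f)"
        by (simp add: avg_def L.scaleR L.diff)
      also have "norm \<dots> \<le> norm (avg l f x - mean f) * K"
        by (rule K(2))
      also have "\<dots> \<le> e"
        using l(3)[OF that] K(1) by (simp add: pos_le_divide_eq)
      finally show ?thesis .
    qed
    then show "\<exists>l. l \<noteq> [] \<and> set l \<subseteq> carrier G \<and> (\<forall>x\<in>carrier G. norm (avg l (\<lambda>x. L (f x)) x - L (mean f)) \<le> e)"
      using l by blast
  qed
qed

lemma mean_near:
  assumes "fmat_map n f" "\<And>x. x \<in> carrier G \<Longrightarrow> norm (f x - d) \<le> e"
  shows "norm (mean f - d) \<le> e"
proof (rule field_le_epsilon)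
  fix \<epsilon> :: real assume "0 < \<epsilon>"
  then obtain l where l: "l \<noteq> []" "set l \<subseteq> carrier G" "\<And>x. x \<in> carrier G \<Longrightarrow> norm (avg l f x - mean f) \<le> \<epsilon>"
    using is_meanE[OF mean_is_mean(1)[OF assms(1)]] by metis
  have "norm (avg l f \<one> - d) \<le> e"
    using assms(2) by (intro avg_near[OF l(1,2)]) auto
  moreover have "norm (avg l f \<one> - mean f) \<le> \<epsilon>"
    using l by auto
  ultimately show "norm (mean f - d) \<le> e + \<epsilon>"
    using norm_triangle_ineq4[of "avg l f \<one> - d" "avg l f \<one> - mean f"] by simp
qed

lemma mean_const:
  assumes "a \<in> fmats n" "\<And>x. x \<in> carrier G \<Longrightarrow> f x = a"
  shows "mean f = a"
proof -
  have "fmat_map n f"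
    using assms topspace_T unfolding fmat_map_def
    by (metis continuous_map_const continuous_map_eq topspace_euclidean UNIV_I)
  then have "norm (mean f - a) \<le> 0"
    using assms(2) by (intro mean_near) auto
  then show ?thesis
    by simp
qed

lemma mean_diff_le:
  assumes "fmat_map n f" "fmat_map n g" "\<And>x. x \<in> carrier G \<Longrightarrow> norm (f x - g x) \<le> e"
  shows "norm (mean f - mean g) \<le> e"
proof -
  have d: "fmat_map n (\<lambda>x. f x - g x)"
    using assms(1,2) by (auto simp: fmat_map_def continuous_map_diff)
  have "mean f = mean (\<lambda>x. (f x - g x) + g x)"
    by simp
  also have "\<dots> = mean (\<lambda>x. f x - g x) + mean g"
    by (rule mean_add[OF d assms(2)])
  finally show ?thesis
    using mean_near[OF d, of 0 e] assms(3) by simp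
qed

lemma mean_translate:
  assumes "fmat_map n f" "a \<in> carrier G"
  shows "mean (\<lambda>x. f (x \<otimes> a)) = mean f"
proof (rule mean_eqI)
  have "continuous_map T euclidean (f \<circ> (\<lambda>x. x \<otimes> a))"
    using assms by (intro continuous_map_compose[OF continuous_translate_right]) (auto simp: fmat_map_def)
  then show "fmat_map n (\<lambda>x. f (x \<otimes> a))"
    using assms by (auto simp: fmat_map_def o_def)
  show "is_mean (\<lambda>x. f (x \<otimes> a)) (mean f)"
    unfolding is_mean_def
  proof (intro allI impI)
    fix e :: real assume "0 < e"
    then obtain l where l: "l \<noteq> []" "set l \<subseteq> carrier G" "\<And>x. x \<in> carrier G \<Longrightarrow> norm (avg l f x - mean f) \<le> e"
      using is_meanE[OF mean_is_mean(1)[OF assms(1)]] by metis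
    have "avg l (\<lambda>x. f (x \<otimes> a)) x = avg l f (x \<otimes> a)" if "x \<in> carrier G" for x
      unfolding avg_def using that assms(2) l(2)
      by (intro arg_cong[of _ _ "\<lambda>s. _ *\<^sub>R sum_list s"] map_cong) (auto simp: m_assoc)
    then show "\<exists>l. l \<noteq> [] \<and> set l \<subseteq> carrier G \<and> (\<forall>x\<in>carrier G. norm (avg l (\<lambda>x. f (x \<otimes> a)) x - mean f) \<le> e)"
      using l assms(2) by (intro exI[of _ l]) auto
  qed
qed

lemma fmats_sandwich: "a \<in> fmats n \<Longrightarrow> b \<in> fmats n \<Longrightarrow> a * x * b \<in> fmats n"
proof -
  assume a: "a \<in> fmats n" and b: "b \<in> fmats n"
  obtain m where m: "x \<in> fmats m"
    by (rule fmats_exist)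
  define k where "k = max m n"
  have k: "a \<in> fmats k" "b \<in> fmats k" "x \<in> fmats k"
    using a b m by (auto simp: k_def intro: fmats_mono)
  have "entry (a * x * b) i j = 0" if "\<not> (i < n \<and> j < n)" for i j
  proof (cases "i < n")
    case True
    then have "entry b l j = 0" for l
      using that fmats_entry_0[OF b] by blast
    then show ?thesis
      using k by (simp add: entry_times[of _ k])
  next
    case False
    then have "entry a i l = 0" for l
      using fmats_entry_0[OF a] by blast
    then show ?thesis
      using k by (simp add: entry_times[of _ k])
  qed
  then show ?thesis
    unfolding fmats_def by blast
qed

text \<open>Compression by \<open>unit_fmat n\<close> on both sides is linear and fixes the values
  of \<open>f\<close>, hence it fixes their mean; its image lies in the block.\<close>

lemma mean_in:
  assumes "fmat_map n f"
  shows "mean f \<in> fmats n"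
proof -
  let ?L = "\<lambda>a. unit_fmat n * a * unit_fmat n"
  have "bounded_linear ?L"
    using bounded_linear_compose[OF bounded_linear_mult_left[of "unit_fmat n"] bounded_linear_mult_right[of "unit_fmat n"]]
    by simp
  then have "mean (\<lambda>x. ?L (f x)) = ?L (mean f)"
    using assms by (intro mean_linear) auto
  moreover have "mean f = mean (\<lambda>x. ?L (f x))"
    using assms by (intro mean_cong[OF _ assms]) (simp add: fmat_map_def)
  ultimately have "mean f = ?L (mean f)"
    by simp
  then show ?thesis
    using fmats_sandwich[of "unit_fmat n" n "unit_fmat n" "mean f"] by simp
qed

lemma continuous_mean:
  fixes F :: "'z \<Rightarrow> 'a \<Rightarrow> fmat"
  assumes "continuous_map (prod_topology Z T) euclidean (\<lambda>(z, x). F z x)"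
    and "\<And>z x. z \<in> topspace Z \<Longrightarrow> x \<in> carrier G \<Longrightarrow> F z x \<in> fmats n"
  shows "continuous_map Z euclidean (\<lambda>z. mean (F z))"
    and "\<And>z. z \<in> topspace Z \<Longrightarrow> fmat_map n (F z)"
proof -
  show fm: "fmat_map n (F z)" if "z \<in> topspace Z" for z
  proof -
    have "continuous_map T (prod_topology Z T) (\<lambda>x. (z, x))"
      using that by (simp add: continuous_map_pairedI)
    from continuous_map_compose[OF this assms(1)] show ?thesis
      using assms(2) that by (simp add: fmat_map_def o_def)
  qed
  show "continuous_map Z euclidean (\<lambda>z. mean (F z))"
    unfolding continuous_map_atin
  proof
    fix z assume z: "z \<in> topspace Z"
    have "((\<lambda>z. mean (F z)) \<longlongrightarrow> mean (F z)) (atin Z z)"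
      unfolding tendsto_iff
    proof (intro allI impI)
      fix e :: real assume e: "0 < e"
      obtain U where U: "openin Z U" "z \<in> U"
        "\<And>w x. w \<in> U \<Longrightarrow> x \<in> topspace T \<Longrightarrow> norm (F w x - F z x) < e / 2"
        using uniformly_near_in_compact[OF compact_T assms(1) z, of "e / 2"] e by auto
      have "dist (mean (F w)) (mean (F z)) < e" if "w \<in> U" for w
      proof -
        have "norm (mean (F w) - mean (F z)) \<le> e / 2"
          using U that openin_subset[OF U(1)] z topspace_T
          by (intro mean_diff_le[OF fm fm]) (auto intro: less_imp_le)
        then show ?thesis
          using e by (simp add: dist_norm)
      qed
      then show "\<forall>\<^sub>F w in atin Z z. dist (mean (F w)) (mean (F z)) < e"
        unfolding eventually_atin using U(1,2) by blast
    qed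
    then show "limitin euclidean (\<lambda>z. mean (F z)) (mean (F z)) (atin Z z)"
      by simp
  qed
qed

end

section \<open>Equivariant families over the circle\<close>

lemma continuous_map_mult:
  fixes f g :: "'z \<Rightarrow> 'b::real_normed_algebra"
  assumes "continuous_map Z euclidean f" "continuous_map Z euclidean g"
  shows "continuous_map Z euclidean (\<lambda>x. f x * g x)"
  using assms by (simp add: continuous_map_atin tendsto_mult)

lemma continuous_map_compose_on:
  assumes "continuous_on A f" "continuous_map Z euclidean u" "\<And>x. x \<in> topspace Z \<Longrightarrow> u x \<in> A"
  shows "continuous_map Z euclidean (\<lambda>x. f (u x))"
proof -
  have "continuous_map Z (top_of_set A) u"
    using assms(2,3) by (auto simp: continuous_map_in_subtopology)
  moreover have "continuous_map (top_of_set A) euclidean f"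
    using assms(1) by simp
  ultimately show ?thesis
    using continuous_map_compose[of Z "top_of_set A" u euclidean f] by (simp add: o_def)
qed

text \<open>Continuity of inversion relative to varying idempotents \<open>p\<close> and
  \<open>q\<close>. A local bound for \<open>b\<close> comes first; then the difference of two
  inverses is expressed through the differences of \<open>a\<close>, \<open>p\<close> and
  \<open>q\<close>.\<close>

lemma continuous_on_inverse_fmat:
  fixes a b p q :: "'x::metric_space \<Rightarrow> fmat"
  assumes "continuous_on S a" "continuous_on S p" "continuous_on S q"
    and inv: "\<And>x. x \<in> S \<Longrightarrow> b x * a x = p x \<and> a x * b x = q x \<and> b x * q x = b x \<and> p x * b x = b x"
  shows "continuous_on S b"
  unfolding continuous_on_def
proof
  fix x assume x: "x \<in> S"
  have t: "(f \<longlongrightarrow> f x) (at x within S)" if "continuous_on S f" for f :: "'x \<Rightarrow> fmat"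
    using that x by (simp add: continuous_on_def)
  define K where "K = 2 * ((norm (p x) + 1) * norm (b x) * (norm (q x) + 1)) + norm (b x)"
  have K: "0 \<le> K" "norm (b x) \<le> K"
    by (auto simp: K_def)
  have "((\<lambda>y. p y - p y * b x * a y) \<longlongrightarrow> p x - p x * b x * a x) (at x within S)"
    using assms(1-3) by (intro tendsto_intros t)
  moreover have "p x - p x * b x * a x = 0"
    using inv[OF x] by (simp add: mult.assoc)
  ultimately have "((\<lambda>y. p y - p y * b x * a y) \<longlongrightarrow> 0) (at x within S)"
    by simp
  from tendstoD[OF this, of "1 / 2"]
  have "\<forall>\<^sub>F y in at x within S. norm (p y - p y * b x * a y) < 1 / 2"
    by simp
  moreover have "\<forall>\<^sub>F y in at x within S. norm (p y) < norm (p x) + 1"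
    "\<forall>\<^sub>F y in at x within S. norm (q y) < norm (q x) + 1"
    using assms(2,3) by (auto intro!: order_tendstoD(2) tendsto_intros t)
  moreover have "\<forall>\<^sub>F y in at x within S. y \<in> S"
    by (simp add: eventually_at_filter)
  ultimately have bound: "\<forall>\<^sub>F y in at x within S. norm (b y) \<le> K \<and> y \<in> S"
  proof eventually_elim
    case (elim y)
    \<comment> \<open>An identity in which \<open>b y\<close> reappears with a factor of norm below
      1/2; moving that term to the left bounds \<open>b y\<close> by twice the remaining
      one.\<close>
    have "b y = p y * b x * q y + (p y - p y * b x * a y) * b y"
      using inv[OF elim(4)] by (simp add: algebra_simps)
    also have "norm \<dots> \<le> norm (p y) * norm (b x) * norm (q y) + norm (p y - p y * b x * a y) * norm (b y)"
      by (intro norm_triangle_le add_mono order.trans[OF norm_mult_ineq] mult_right_mono norm_mult_ineq) auto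
    also have "\<dots> \<le> (norm (p x) + 1) * norm (b x) * (norm (q x) + 1) + 1 / 2 * norm (b y)"
      using elim by (intro add_mono mult_mono) auto
    finally have "norm (b y) \<le> K"
      using norm_ge_zero[of "b x"] unfolding K_def by linarith
    then show ?case
      using elim(4) by blast
  qed
  let ?u = "\<lambda>y. K * norm (q y - q x) + (K * norm (a x - a y) + norm (p y - p x)) * K"
  have le: "norm (b y - b x) \<le> ?u y" if y: "y \<in> S" "norm (b y) \<le> K" for y
  proof -
    have "b y - b x = (b y * (a x - a y) + (p y - p x)) * b x - b y * (q x - q y)"
      using inv[OF x] inv[OF y(1)] by (simp add: algebra_simps)
    also have "norm \<dots> \<le> (K * norm (a x - a y) + norm (p y - p x)) * K + K * norm (q x - q y)"
    proof -
      have 1: "norm (b y * v) \<le> K * norm v" for v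
        by (rule order.trans[OF norm_mult_ineq mult_right_mono[OF y(2) norm_ge_zero]])
      have "norm (b y * (a x - a y) + (p y - p x)) \<le> K * norm (a x - a y) + norm (p y - p x)"
        by (rule order.trans[OF norm_triangle_ineq add_right_mono[OF 1]])
      then have "norm ((b y * (a x - a y) + (p y - p x)) * b x) \<le> (K * norm (a x - a y) + norm (p y - p x)) * K"
        using K by (intro order.trans[OF norm_mult_ineq mult_mono]) auto
      then show ?thesis
        by (rule order.trans[OF norm_triangle_ineq4 add_mono[OF _ 1]])
    qed
    finally show ?thesis
      by (simp add: norm_minus_commute)
  qed
  have "(?u \<longlongrightarrow> K * norm (q x - q x) + (K * norm (a x - a x) + norm (p x - p x)) * K) (at x within S)"
    using assms(1-3) by (intro tendsto_intros t)
  then have "(?u \<longlongrightarrow> 0) (at x within S)"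
    by simp
  moreover have "\<forall>\<^sub>F y in at x within S. norm (b y - b x) \<le> ?u y"
    using bound by eventually_elim (use le in auto)
  ultimately have "((\<lambda>y. b y - b x) \<longlongrightarrow> 0) (at x within S)"
    by (rule Lim_null_comparison[rotated])
  then show "(b \<longlongrightarrow> b x) (at x within S)"
    by (simp add: LIM_zero_cancel)
qed

abbreviation circle :: "complex set"
  where "circle \<equiv> sphere 0 1"

text \<open>A \<open>G\<close>-vector bundle inside the trivial bundle with fibre C^N:
  \<open>c g z\<close> carries the fibre over \<open>z\<close> to the fibre over
  \<open>r g * z\<close>. The cocycle identity makes \<open>c \<one> z\<close> idempotent, and its
  range is the fibre over \<open>z\<close>.\<close>

locale circle_cocycle = compact_group G T for G (structure) and T :: "'a topology" +
  fixes N :: nat and r :: "'a \<Rightarrow> complex" and c :: "'a \<Rightarrow> complex \<Rightarrow> fmat"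
  assumes r_mult: "\<And>g h. g \<in> carrier G \<Longrightarrow> h \<in> carrier G \<Longrightarrow> r (g \<otimes> h) = r g * r h"
    and r_norm: "\<And>g. g \<in> carrier G \<Longrightarrow> cmod (r g) = 1"
    and r_cont: "continuous_map T euclidean r"
    and c_in: "\<And>g z. g \<in> carrier G \<Longrightarrow> z \<in> circle \<Longrightarrow> c g z \<in> fmats N"
    and c_mult: "\<And>g h z. g \<in> carrier G \<Longrightarrow> h \<in> carrier G \<Longrightarrow> z \<in> circle \<Longrightarrow>
      c (g \<otimes> h) z = c g (r h * z) * c h z"
    and c_cont: "continuous_map (prod_topology T (top_of_set circle)) euclidean (\<lambda>(g, z). c g z)"
begin

definition p :: "complex \<Rightarrow> fmat"
  where "p = c \<one>"

lemma r_one [simp]: "r \<one> = 1"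
  using r_mult[of \<one> \<one>] r_norm[of \<one>] by (metis l_one mult_cancel_right2 norm_zero one_closed zero_neq_one)

lemma r_inv: "g \<in> carrier G \<Longrightarrow> r (inv g) * (r g * z) = z" "g \<in> carrier G \<Longrightarrow> r g * (r (inv g) * z) = z"
  by (simp_all flip: mult.assoc r_mult)

lemma p_in [simp]: "z \<in> circle \<Longrightarrow> p z \<in> fmats N"
  by (simp add: p_def c_in)

lemma c_p: "g \<in> carrier G \<Longrightarrow> z \<in> circle \<Longrightarrow> c g z * p z = c g z"
  using c_mult[of g \<one> z] by (simp add: p_def)

lemma p_c: "g \<in> carrier G \<Longrightarrow> z \<in> circle \<Longrightarrow> p (r g * z) * c g z = c g z"
  using c_mult[of \<one> g z] by (simp add: p_def)

lemma p_p [simp]: "z \<in> circle \<Longrightarrow> p z * p z = p z"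
  using c_p[of \<one> z] by (simp add: p_def)

lemma c_inv: "g \<in> carrier G \<Longrightarrow> z \<in> circle \<Longrightarrow> c (inv g) (r g * z) * c g z = p z"
  using c_mult[of "inv g" g z] by (simp add: p_def)

lemma continuous_map_c:
  assumes "continuous_map Z T u" "continuous_map Z euclidean v" "\<And>x. x \<in> topspace Z \<Longrightarrow> v x \<in> circle"
  shows "continuous_map Z euclidean (\<lambda>x. c (u x) (v x))"
proof -
  have "continuous_map Z (top_of_set circle) v"
    using assms(2,3) by (auto simp: continuous_map_in_subtopology)
  then have "continuous_map Z (prod_topology T (top_of_set circle)) (\<lambda>x. (u x, v x))"
    using assms(1) by (simp add: continuous_map_pairedI)
  from continuous_map_compose[OF this c_cont] show ?thesis
    by (simp add: o_def)
qed

lemma p_cont: "continuous_on circle p"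
proof -
  have "continuous_map (top_of_set circle) euclidean (\<lambda>z. c \<one> z)"
    by (rule continuous_map_c) (auto simp: topspace_T continuous_map_in_subtopology)
  then show ?thesis
    by (simp add: p_def)
qed

lemma c_bounded:
  obtains K where "0 \<le> K" "\<And>g z. g \<in> carrier G \<Longrightarrow> z \<in> circle \<Longrightarrow> norm (c g z) \<le> K"
proof -
  have "compact_space (prod_topology T (top_of_set circle))"
    using compact_T by (auto simp: compact_space_prod_topology compact_space_subtopology)
  then have "compactin euclidean ((\<lambda>(g, z). c g z) ` topspace (prod_topology T (top_of_set circle)))"
    using image_compactin c_cont unfolding compact_space_def by blast
  then have "bounded ((\<lambda>(g, z). c g z) ` (carrier G \<times> circle))"
    using topspace_T by (simp add: compact_imp_bounded)
  then obtain K where K: "\<And>x. x \<in> carrier G \<times> circle \<Longrightarrow> norm ((\<lambda>(g, z). c g z) x) \<le> K"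
    unfolding bounded_iff by blast
  show ?thesis
  proof (rule that[of "\<bar>K\<bar>"])
    fix g z assume "g \<in> carrier G" "z \<in> circle"
    then show "norm (c g z) \<le> \<bar>K\<bar>"
      using K[of "(g, z)"] by auto
  qed simp
qed

text \<open>Equivariant bundle endomorphisms covering the rotation \<open>z \<mapsto> w z\<close>.\<close>

definition lift :: "complex \<Rightarrow> (complex \<Rightarrow> fmat) \<Rightarrow> bool"
  where "lift w f \<longleftrightarrow>
    (\<forall>z\<in>circle. f z \<in> fmats N \<and> f z * p z = f z) \<and>
    (\<forall>g\<in>carrier G. \<forall>z\<in>circle. f (r g * z) * c g z = c g (w * z) * f z)"

lemma liftD:
  assumes "lift w f" "z \<in> circle"
  shows "f z \<in> fmats N" "f z * p z = f z" "p (w * z) * f z = f z"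
    "g \<in> carrier G \<Longrightarrow> f (r g * z) * c g z = c g (w * z) * f z"
proof -
  show "f z \<in> fmats N" "f z * p z = f z"
    "g \<in> carrier G \<Longrightarrow> f (r g * z) * c g z = c g (w * z) * f z"
    using assms by (auto simp: lift_def)
  have "f (r \<one> * z) * c \<one> z = c \<one> (w * z) * f z"
    using assms unfolding lift_def by blast
  then show "p (w * z) * f z = f z"
    using \<open>f z * p z = f z\<close> by (simp add: p_def)
qed

lemma lift_p: "lift 1 p"
  by (auto simp: lift_def p_c c_p)

lemma lift_compose:
  assumes "lift w f" "lift v h" "cmod v = 1"
  shows "lift (w * v) (\<lambda>z. f (v * z) * h z)"
  unfolding lift_def
proof (intro conjI ballI)
  fix z assume z: "z \<in> circle"
  then have vz: "v * z \<in> circle"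
    using assms(3) by (simp add: norm_mult)
  show "f (v * z) * h z \<in> fmats N" "f (v * z) * h z * p z = f (v * z) * h z"
    using liftD[OF assms(1) vz] liftD[OF assms(2) z] by (auto simp: mult.assoc)
  fix g assume g: "g \<in> carrier G"
  have "f (v * (r g * z)) * h (r g * z) * c g z = f (r g * (v * z)) * c g (v * z) * h z"
    using liftD(4)[OF assms(2) z g] by (simp add: mult.assoc mult.left_commute[of v])
  also have "\<dots> = c g (w * v * z) * (f (v * z) * h z)"
    using liftD(4)[OF assms(1) vz g] by (simp add: mult.assoc)
  finally show "f (v * (r g * z)) * h (r g * z) * c g z = c g (w * v * z) * (f (v * z) * h z)" .
qed

text \<open>The average of the conjugates of \<open>f w\<close> by the group: move from
  \<open>z\<close> to \<open>r g * z\<close>, apply \<open>f w\<close>, and move back. The return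
  starts at \<open>r g * (w * z)\<close>, which is also \<open>w * (r g * z)\<close> because
  rotations commute.\<close>

definition avg_lift :: "(complex \<Rightarrow> complex \<Rightarrow> fmat) \<Rightarrow> complex \<Rightarrow> complex \<Rightarrow> fmat"
  where "avg_lift f w z = mean (\<lambda>g. c (inv g) (r g * (w * z)) * f w (r g * z) * c g z)"

text \<open>Equivariance is invariance of the mean under the substitution of
  \<open>g \<otimes> k\<close> for \<open>g\<close>; continuity is continuity of the mean in a
  parameter.\<close>

lemma
  assumes f: "continuous_on (circle \<times> circle) (\<lambda>(w, z). f w z)"
    and f_in: "\<And>w z. w \<in> circle \<Longrightarrow> z \<in> circle \<Longrightarrow> f w z \<in> fmats N"
  shows continuous_avg_lift: "continuous_on (circle \<times> circle) (\<lambda>(w, z). avg_lift f w z)"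
    and lift_avg_lift: "w \<in> circle \<Longrightarrow> lift w (avg_lift f w)"
    and fmat_map_avg_lift: "w \<in> circle \<Longrightarrow> z \<in> circle \<Longrightarrow>
      fmat_map N (\<lambda>g. c (inv g) (r g * (w * z)) * f w (r g * z) * c g z)"
proof -
  let ?F = "\<lambda>x g. c (inv g) (r g * (fst x * snd x)) * f (fst x) (r g * snd x) * c g (snd x)"
  let ?Z = "top_of_set (circle \<times> circle) :: (complex \<times> complex) topology"
  let ?P = "prod_topology ?Z T"
  have u: "continuous_map ?P T snd" "continuous_map ?P T (\<lambda>x. inv (snd x))"
    using continuous_map_compose[of ?P T snd T "\<lambda>x. inv x"] continuous_inv
    by (auto simp: continuous_map_snd o_def)
  have rr: "continuous_map ?P euclidean (\<lambda>x. r (snd x))"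
    using continuous_map_compose[of ?P T snd euclidean r] r_cont by (simp add: o_def continuous_map_snd)
  have "continuous_map ?P ?Z fst"
    by (rule continuous_map_fst)
  then have f1: "continuous_map ?P euclidean (\<lambda>x. fst x)"
    by (rule continuous_map_into_fulltopology)
  have w: "continuous_map ?P euclidean (\<lambda>x. fst (fst x))" "continuous_map ?P euclidean (\<lambda>x. snd (fst x))"
    using continuous_map_compose_on[OF continuous_on_fst[OF continuous_on_id] f1, of UNIV]
      continuous_map_compose_on[OF continuous_on_snd[OF continuous_on_id] f1, of UNIV] by auto
  have ff: "continuous_map ?P euclidean (\<lambda>x. f (fst (fst x)) (r (snd x) * snd (fst x)))"
  proof -
    have "continuous_map ?P euclidean (\<lambda>x. (\<lambda>(w, z). f w z) (fst (fst x), r (snd x) * snd (fst x)))"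
    proof (rule continuous_map_compose_on[OF f])
      have "continuous_map ?P (prod_topology euclidean euclidean) (\<lambda>x. (fst (fst x), r (snd x) * snd (fst x)))"
        by (intro continuous_map_pairedI continuous_map_mult w rr)
      then show "continuous_map ?P euclidean (\<lambda>x. (fst (fst x), r (snd x) * snd (fst x)))"
        by (simp add: euclidean_product_topology)
    qed (auto simp: topspace_T norm_mult r_norm)
    then show ?thesis
      by simp
  qed
  have F: "continuous_map ?P euclidean (\<lambda>(x, g). ?F x g)"
    unfolding case_prod_unfold
    by (intro continuous_map_mult continuous_map_c u w rr ff) (auto simp: topspace_T norm_mult r_norm)
  have F_in: "?F x g \<in> fmats N" if "x \<in> topspace ?Z" "g \<in> carrier G" for x g
    using that by (intro fmats_mult c_in f_in) (auto simp: norm_mult r_norm)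
  have "continuous_map ?Z euclidean (\<lambda>x. mean (?F x))"
    by (rule continuous_mean(1)[OF F F_in])
  then show "continuous_on (circle \<times> circle) (\<lambda>(w, z). avg_lift f w z)"
    unfolding avg_lift_def by (simp add: case_prod_unfold)
  show fm: "fmat_map N (\<lambda>g. c (inv g) (r g * (w * z)) * f w (r g * z) * c g z)"
    if "w \<in> circle" "z \<in> circle" for w z
    using continuous_mean(2)[OF F F_in, of "(w, z)"] that by simp
  assume w: "w \<in> circle"
  show "lift w (avg_lift f w)"
    unfolding lift_def
  proof (intro conjI ballI)
    fix z assume z: "z \<in> circle"
    show "avg_lift f w z \<in> fmats N"
      unfolding avg_lift_def using fm w z by (intro mean_in)
    have "mean (\<lambda>g. (c (inv g) (r g * (w * z)) * f w (r g * z) * c g z) * p z) = avg_lift f w z * p z"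
      unfolding avg_lift_def using fm[OF w z] z
      by (intro mean_linear[of N _ "\<lambda>a. a * p z"] bounded_linear_mult_left) auto
    moreover have "mean (\<lambda>g. (c (inv g) (r g * (w * z)) * f w (r g * z) * c g z)) =
        mean (\<lambda>g. (c (inv g) (r g * (w * z)) * f w (r g * z) * c g z) * p z)"
      using z by (intro mean_cong[OF _ fm[OF w z]]) (simp add: mult.assoc c_p)
    ultimately show "avg_lift f w z * p z = avg_lift f w z"
      by (simp add: avg_lift_def)
    fix k assume k: "k \<in> carrier G"
    have kz: "r k * z \<in> circle" "w * z \<in> circle"
      using k z w by (auto simp: norm_mult r_norm)
    let ?H = "\<lambda>g. c (inv g) (r g * (w * z)) * f w (r g * z) * c g z"
    have "avg_lift f w (r k * z) * c k z =
        mean (\<lambda>g. (c (inv g) (r g * (w * (r k * z))) * f w (r g * (r k * z)) * c g (r k * z)) * c k z)"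
      unfolding avg_lift_def
      by (rule mean_linear[OF fm[OF w kz(1)], symmetric]) (use k z c_in in \<open>auto intro: bounded_linear_mult_left\<close>)
    also have "\<dots> = mean (\<lambda>g. c k (w * z) * ?H (g \<otimes> k))"
    proof (rule mean_cong[where n = N])
      show "fmat_map N (\<lambda>g. (c (inv g) (r g * (w * (r k * z))) * f w (r g * (r k * z)) * c g (r k * z)) * c k z)"
      proof -
        have "continuous_map T euclidean (\<lambda>g. c k z)"
          by simp
        then show ?thesis
          using fm[OF w kz(1)] c_in[OF k z] unfolding fmat_map_def
          by (auto intro: continuous_map_mult)
      qed
      fix g assume g: "g \<in> carrier G"
      \<comment> \<open>Writing \<open>inv g\<close> as
        \<open>k \<otimes> inv (g \<otimes> k)\<close> brings out the factor
        \<open>c k (w * z)\<close>, which does not depend on \<open>g\<close> and leaves the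
        mean.\<close>
      have "c (inv g) (r (g \<otimes> k) * (w * z)) = c (k \<otimes> inv (g \<otimes> k)) (r (g \<otimes> k) * (w * z))"
        using g k by (simp add: inv_mult_group flip: m_assoc)
      also have "\<dots> = c k (w * z) * c (inv (g \<otimes> k)) (r (g \<otimes> k) * (w * z))"
        using g k z w c_mult[of k "inv (g \<otimes> k)" "r (g \<otimes> k) * (w * z)"] r_inv(1)[of "g \<otimes> k" "w * z"]
        by (simp add: norm_mult r_norm)
      finally have 1: "c (inv g) (r (g \<otimes> k) * (w * z)) = c k (w * z) * c (inv (g \<otimes> k)) (r (g \<otimes> k) * (w * z))" .
      have 2: "c (g \<otimes> k) z = c g (r k * z) * c k z"
        using c_mult g k z by simp
      have 3: "r g * (w * (r k * z)) = r (g \<otimes> k) * (w * z)" "r g * (r k * z) = r (g \<otimes> k) * z"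
        using g k by (simp_all add: r_mult)
      show "(c (inv g) (r g * (w * (r k * z))) * f w (r g * (r k * z)) * c g (r k * z)) * c k z =
          c k (w * z) * ?H (g \<otimes> k)"
        unfolding 3 1 2 by (simp add: mult.assoc)
    qed
    also have "\<dots> = mean (\<lambda>g. c k (w * z) * ?H g)"
    proof (rule mean_translate[of N "\<lambda>g. c k (w * z) * ?H g"])
      have "continuous_map T euclidean (\<lambda>g. c k (w * z))"
        by simp
      then show "fmat_map N (\<lambda>g. c k (w * z) * ?H g)"
        using fm[OF w z] c_in[OF k kz(2)] unfolding fmat_map_def
        by (auto intro: continuous_map_mult)
    qed fact
    also have "\<dots> = c k (w * z) * avg_lift f w z"
      unfolding avg_lift_def
      by (rule mean_linear[OF fm[OF w z]]) (use k kz c_in in \<open>auto intro: bounded_linear_mult_right\<close>)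
    finally show "avg_lift f w (r k * z) * c k z = c k (w * z) * avg_lift f w z" .
  qed
qed

end

section \<open>Invertible lifts and paths of lifts\<close>

context circle_cocycle
begin

definition invertible_lift :: "complex \<Rightarrow> (complex \<Rightarrow> fmat) \<Rightarrow> bool"
  where "invertible_lift w f \<longleftrightarrow> lift w f \<and>
    (\<forall>z\<in>circle. \<exists>b\<in>fmats N. b * f z = p z \<and> f z * b = p (w * z))"

text \<open>An inverse relative to \<open>p z\<close> and \<open>p (w * z)\<close> is unique only
  when it lives on these ranges; the last two conditions cut it down to them, and uniqueness gives
  composition rules and continuity.\<close>

definition lift_inv :: "complex \<Rightarrow> (complex \<Rightarrow> fmat) \<Rightarrow> complex \<Rightarrow> fmat"
  where "lift_inv w f z = (SOME b. b \<in> fmats N \<and> b * f z = p z \<and> f z * b = p (w * z) \<and>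
    p z * b = b \<and> b * p (w * z) = b)"

lemma circle_mult [simp]: "w \<in> circle \<Longrightarrow> z \<in> circle \<Longrightarrow> w * z \<in> circle"
  by (simp add: norm_mult)

lemma circle_cis [simp]: "cis t \<in> circle"
  by simp

lemma circle_r [simp]: "g \<in> carrier G \<Longrightarrow> r g \<in> circle"
  by (simp add: r_norm)

declare mem_sphere [simp del] mem_sphere_0 [simp del]

lemma lift_inv:
  assumes "invertible_lift w f" "w \<in> circle" "z \<in> circle"
  shows "lift_inv w f z \<in> fmats N" "lift_inv w f z * f z = p z" "f z * lift_inv w f z = p (w * z)"
    "p z * lift_inv w f z = lift_inv w f z" "lift_inv w f z * p (w * z) = lift_inv w f z"
proof -
  have f: "lift w f"
    using assms by (simp add: invertible_lift_def)
  obtain b where b: "b \<in> fmats N" "b * f z = p z" "f z * b = p (w * z)"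
    using assms unfolding invertible_lift_def by blast
  let ?P = "\<lambda>b. b \<in> fmats N \<and> b * f z = p z \<and> f z * b = p (w * z) \<and> p z * b = b \<and> b * p (w * z) = b"
  let ?b = "p z * b * p (w * z)"
  have "?b * f z = p z * (b * (p (w * z) * f z))"
    by (simp add: mult.assoc)
  then have "?b * f z = p z"
    using b liftD[OF f assms(3)] assms by simp
  moreover have "f z * ?b = (f z * p z) * b * p (w * z)"
    by (simp add: mult.assoc)
  then have "f z * ?b = p (w * z)"
    using b liftD[OF f assms(3)] assms by simp
  moreover have "p z * ?b = ?b"
    using assms by (simp flip: mult.assoc)
  moreover have "?b * p (w * z) = ?b"
    using assms by (simp add: mult.assoc)
  ultimately have "?P ?b"
    using b assms by simp
  then have "?P (lift_inv w f z)"
    unfolding lift_inv_def by (rule someI)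
  then show "lift_inv w f z \<in> fmats N" "lift_inv w f z * f z = p z" "f z * lift_inv w f z = p (w * z)"
    "p z * lift_inv w f z = lift_inv w f z" "lift_inv w f z * p (w * z) = lift_inv w f z"
    by auto
qed

lemma lift_inv_unique:
  assumes "invertible_lift w f" "w \<in> circle" "z \<in> circle" "b * f z = p z" "b * p (w * z) = b"
  shows "b = lift_inv w f z"
proof -
  have "b = b * (f z * lift_inv w f z)"
    using assms(5) lift_inv[OF assms(1-3)] by simp
  also have "\<dots> = (b * f z) * lift_inv w f z"
    by (simp only: mult.assoc)
  also have "\<dots> = lift_inv w f z"
    using assms(4) lift_inv(4)[OF assms(1-3)] by simp
  finally show ?thesis .
qed

lemma invertible_lift_p: "invertible_lift 1 p"
  unfolding invertible_lift_def
proof (intro conjI ballI lift_p)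
  fix z assume "z \<in> circle"
  then show "\<exists>b\<in>fmats N. b * p z = p z \<and> p z * b = p (1 * z)"
    by (intro bexI[of _ "p z"]) auto
qed

lemma invertible_lift_compose:
  assumes f: "invertible_lift w f" and h: "invertible_lift v h" and "w \<in> circle" "v \<in> circle"
  shows "invertible_lift (w * v) (\<lambda>z. f (v * z) * h z)"
    and "z \<in> circle \<Longrightarrow>
      lift_inv (w * v) (\<lambda>z. f (v * z) * h z) z = lift_inv v h z * lift_inv w f (v * z)"
proof -
  have l: "lift w f" "lift v h"
    using f h by (auto simp: invertible_lift_def)
  have *: "lift_inv v h z * lift_inv w f (v * z) * (f (v * z) * h z) = p z"
    "f (v * z) * h z * (lift_inv v h z * lift_inv w f (v * z)) = p (w * v * z)"
    if z: "z \<in> circle" for z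
  proof -
    have vz: "v * z \<in> circle"
      using assms z by simp
    have "lift_inv v h z * lift_inv w f (v * z) * (f (v * z) * h z) =
        lift_inv v h z * ((lift_inv w f (v * z) * f (v * z)) * h z)"
      by (simp add: mult.assoc)
    then show "lift_inv v h z * lift_inv w f (v * z) * (f (v * z) * h z) = p z"
      using lift_inv(2)[OF f _ vz] lift_inv(2)[OF h _ z] liftD(3)[OF l(2) z] assms by simp
    have "f (v * z) * h z * (lift_inv v h z * lift_inv w f (v * z)) =
        f (v * z) * ((h z * lift_inv v h z) * lift_inv w f (v * z))"
      by (simp add: mult.assoc)
    then show "f (v * z) * h z * (lift_inv v h z * lift_inv w f (v * z)) = p (w * v * z)"
      using lift_inv[OF f _ vz] lift_inv(3)[OF h _ z] assms by (simp add: mult.assoc)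
  qed
  show i: "invertible_lift (w * v) (\<lambda>z. f (v * z) * h z)"
    unfolding invertible_lift_def
  proof (intro conjI ballI)
    show "lift (w * v) (\<lambda>z. f (v * z) * h z)"
      using l assms(4) by (intro lift_compose) (auto simp: mem_sphere_0)
    fix z assume z: "z \<in> circle"
    show "\<exists>b\<in>fmats N. b * (f (v * z) * h z) = p z \<and> f (v * z) * h z * b = p (w * v * z)"
      using *[OF z] lift_inv(1)[OF f, of "v * z"] lift_inv(1)[OF h, of z] assms z
      by (intro bexI[of _ "lift_inv v h z * lift_inv w f (v * z)"]) auto
  qed
  assume z: "z \<in> circle"
  show "lift_inv (w * v) (\<lambda>z. f (v * z) * h z) z = lift_inv v h z * lift_inv w f (v * z)"
  proof (rule lift_inv_unique[symmetric, OF i])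
    show "lift_inv v h z * lift_inv w f (v * z) * p (w * v * z) = lift_inv v h z * lift_inv w f (v * z)"
      using lift_inv(5)[OF f, of "v * z"] assms z by (simp add: mult.assoc)
  qed (use *[OF z] z assms in simp_all)
qed

lemma lift_inv_equivariant:
  assumes "invertible_lift w f" "w \<in> circle" "z \<in> circle" "g \<in> carrier G"
  shows "lift_inv w f (r g * z) * c g (w * z) = c g z * lift_inv w f z"
proof -
  have f: "lift w f"
    using assms by (simp add: invertible_lift_def)
  have wz: "w * z \<in> circle" "r g * z \<in> circle"
    using assms by simp_all
  let ?b = "lift_inv w f"
  have "?b (r g * z) * c g (w * z) = ?b (r g * z) * (c g (w * z) * (f z * ?b z))"
    using lift_inv[OF assms(1-3)] c_p wz assms by simp
  also have "\<dots> = (?b (r g * z) * f (r g * z)) * c g z * ?b z"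
    using liftD(4)[OF f assms(3,4)] by (simp add: mult.assoc)
  also have "\<dots> = c g z * ?b z"
    using lift_inv(2)[OF assms(1,2) wz(2)] p_c assms by simp
  finally show ?thesis .
qed

text \<open>A generalised inverse \<open>b\<close> of \<open>f z\<close> is exact up to the defect
  \<open>x = p z - b * f z\<close>. From \<open>f z * b * f z = f z\<close> follows
  \<open>x = (p z - e * f z) * x\<close>, and a factor of norm below 1 forces \<open>x = 0\<close>;
  the other side is symmetric.\<close>

lemma invertible_near_unit:
  assumes f: "lift w f" and w: "w \<in> circle" and z: "z \<in> circle" and e: "e \<in> fmats N"
    and "norm (p z - e * f z) < 1" "norm (p (w * z) - f z * e) < 1"
  shows "\<exists>b\<in>fmats N. b * f z = p z \<and> f z * b = p (w * z)"
proof -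
  have small: "x = 0" if "x = y * x \<or> x = x * y" "norm y < 1" for x y :: fmat
  proof (rule ccontr)
    assume "x \<noteq> 0"
    have "norm x \<le> norm y * norm x"
      using that(1) norm_mult_ineq[of y x] norm_mult_ineq[of x y] by (auto simp: mult.commute)
    then show False
      using that(2) \<open>x \<noteq> 0\<close> by simp
  qed
  note D = liftD(1-3)[OF f z]
  obtain y where y: "y \<in> fmats N" "moore_penrose (f z) y"
    using moore_penrose_exists[OF D(1)] by blast
  define b where "b = p z * y * p (w * z)"
  have fbf: "f z * b * f z = f z"
  proof -
    have "f z * b * f z = (f z * p z) * y * (p (w * z) * f z)"
      by (simp add: b_def mult.assoc)
    then show ?thesis
      using D y by (simp add: moore_penrose_def)
  qed
  have b: "p z * b = b" "b * p (w * z) = b"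
    using w z by (simp_all add: b_def mult.assoc) (simp flip: mult.assoc)
  have "p z - b * f z = 0"
  proof (rule small[OF disjI1])
    have "(p z - e * f z) * (p z - b * f z) = p z * p z - p z * b * f z - e * (f z * p z - f z * b * f z)"
      by (simp add: algebra_simps)
    then show "p z - b * f z = (p z - e * f z) * (p z - b * f z)"
      using fbf D z b by simp
  qed fact
  moreover have "p (w * z) - f z * b = 0"
  proof (rule small[OF disjI2])
    have "(p (w * z) - f z * b) * (p (w * z) - f z * e) =
        p (w * z) * p (w * z) - f z * (b * p (w * z)) - (p (w * z) * f z - f z * b * f z) * e"
      by (simp add: algebra_simps)
    then show "p (w * z) - f z * b = (p (w * z) - f z * b) * (p (w * z) - f z * e)"
      using fbf D z w b by simp
  qed fact
  ultimately show ?thesis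
    using y w z by (intro bexI[of _ b]) (auto simp: b_def)
qed

definition lift_path :: "real set \<Rightarrow> (real \<Rightarrow> complex \<Rightarrow> fmat) \<Rightarrow> bool"
  where "lift_path I f \<longleftrightarrow> continuous_on (I \<times> circle) (\<lambda>(t, z). f t z) \<and>
    (\<forall>t\<in>I. invertible_lift (cis t) (f t)) \<and> (\<forall>z\<in>circle. f 0 z = p z)"

lemma lift_path_subset: "lift_path I f \<Longrightarrow> J \<subseteq> I \<Longrightarrow> lift_path J f"
  unfolding lift_path_def by (meson Sigma_mono continuous_on_subset order_refl subsetD)

lemma lift_pathD:
  assumes "lift_path I f"
  shows "continuous_on (I \<times> circle) (\<lambda>(t, z). f t z)" "t \<in> I \<Longrightarrow> invertible_lift (cis t) (f t)"
    "t \<in> I \<Longrightarrow> lift (cis t) (f t)" "z \<in> circle \<Longrightarrow> f 0 z = p z"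
  using assms by (auto simp: lift_path_def invertible_lift_def)

lemma continuous_lift_path_comp:
  assumes "lift_path I f" "continuous_on A u" "continuous_on A v" "u ` A \<subseteq> I" "v ` A \<subseteq> circle"
  shows "continuous_on A (\<lambda>x. f (u x) (v x))"
  using continuous_on_compose2[OF lift_pathD(1)[OF assms(1)], of A "\<lambda>x. (u x, v x)"] assms
  by (auto intro: continuous_on_Pair)

lemma continuous_p_comp:
  assumes "continuous_on A v" "v ` A \<subseteq> circle"
  shows "continuous_on A (\<lambda>x. p (v x))"
  using continuous_on_compose2[OF p_cont assms] .

lemma continuous_lift_inv_comp:
  fixes u :: "'z::metric_space \<Rightarrow> real"
  assumes "lift_path I f" "continuous_on A u" "continuous_on A v" "u ` A \<subseteq> I" "v ` A \<subseteq> circle"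
  shows "continuous_on A (\<lambda>x. lift_inv (cis (u x)) (f (u x)) (v x))"
proof (rule continuous_on_inverse_fmat)
  show "continuous_on A (\<lambda>x. f (u x) (v x))"
    using assms by (rule continuous_lift_path_comp)
  show "continuous_on A (\<lambda>x. p (v x))"
    using assms by (intro continuous_p_comp) auto
  have "continuous_on A (\<lambda>x. cis (u x) * v x)"
    using assms(2,3) by (intro continuous_intros continuous_on_cis)
  then show "continuous_on A (\<lambda>x. p (cis (u x) * v x))"
    using assms by (intro continuous_p_comp) (auto simp: image_subset_iff)
  fix x assume "x \<in> A"
  then have "u x \<in> I" "v x \<in> circle"
    using assms by auto
  then show "lift_inv (cis (u x)) (f (u x)) (v x) * f (u x) (v x) = p (v x) \<and>
      f (u x) (v x) * lift_inv (cis (u x)) (f (u x)) (v x) = p (cis (u x) * v x) \<and>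
      lift_inv (cis (u x)) (f (u x)) (v x) * p (cis (u x) * v x) = lift_inv (cis (u x)) (f (u x)) (v x) \<and>
      p (v x) * lift_inv (cis (u x)) (f (u x)) (v x) = lift_inv (cis (u x)) (f (u x)) (v x)"
    using lift_inv[OF lift_pathD(2)[OF assms(1)] circle_cis] by blast
qed

text \<open>At \<open>w = 1\<close> the averaged projection is the identity \<open>p z\<close> of
  the fibre, and by compactness of the circle it remains invertible, uniformly in \<open>z\<close>,
  for \<open>w\<close> near 1.\<close>

lemma local_lift_path:
  obtains e f where "0 < e" "lift_path {0..e} f"
proof -
  \<comment> \<open>\<open>p (w * z)\<close>, restricted to the fibre over \<open>z\<close>, is the
    projection to the fibre over \<open>w * z\<close>.\<close>
  define a where "a = avg_lift (\<lambda>w z. p (w * z))"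
  have pc: "continuous_on (circle \<times> circle) (\<lambda>(w, z). p (w * z))"
    unfolding case_prod_unfold by (intro continuous_p_comp continuous_intros) (auto intro: circle_mult)
  have a_cont: "continuous_on (circle \<times> circle) (\<lambda>(w, z). a w z)"
    unfolding a_def by (rule continuous_avg_lift[OF pc]) simp
  have a_lift: "lift w (a w)" if "w \<in> circle" for w
    unfolding a_def by (rule lift_avg_lift[OF pc _ that]) simp
  have one: "(1::complex) \<in> circle"
    by (simp add: mem_sphere_0)
  have a_one: "a 1 z = p z" if z: "z \<in> circle" for z
    unfolding a_def avg_lift_def
    by (rule mean_const[of _ N]) (use z one p_c c_inv in \<open>simp_all add: mult.assoc\<close>)
  have cnj_circle: "cnj w \<in> circle" "cnj w * (w * z) = z" if "w \<in> circle" "z \<in> circle" for w z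
    using that by (simp_all add: mem_sphere_0 complex_norm_square[symmetric] mult.assoc[symmetric] mult.commute[of "cnj w"])
  \<comment> \<open>The lift of the inverse rotation \<open>cnj w\<close> serves as approximate
    inverse. The defect on the other side is the same function at \<open>(cnj w, w * z)\<close>, so
    one estimate covers both.\<close>
  define h where "h = (\<lambda>(w, z). p z - a (cnj w) (w * z) * a w z)"
  have h_cont: "continuous_on (circle \<times> circle) h"
  proof -
    have "continuous_on (circle \<times> circle) (\<lambda>x. (\<lambda>(w, z). a w z) (cnj (fst x), fst x * snd x))"
      by (rule continuous_on_compose2[OF a_cont]) (auto intro!: continuous_intros circle_mult simp: mem_sphere_0 norm_mult)
    moreover have "continuous_on (circle \<times> circle) (\<lambda>x. p (snd x))"
      by (intro continuous_p_comp continuous_intros) auto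
    ultimately show ?thesis
      using a_cont unfolding h_def case_prod_unfold by (intro continuous_intros) auto
  qed
  have "compact (circle \<times> circle)"
    by (intro compact_Times compact_sphere)
  then have "uniformly_continuous_on (circle \<times> circle) h"
    using h_cont compact_uniformly_continuous by blast
  then obtain d where d: "0 < d" "\<And>x y. x \<in> circle \<times> circle \<Longrightarrow> y \<in> circle \<times> circle \<Longrightarrow> dist y x < d \<Longrightarrow> dist (h y) (h x) < 1"
    unfolding uniformly_continuous_on_def by (metis zero_less_one)
  have h_small: "norm (h (w, z)) < 1" if "w \<in> circle" "z \<in> circle" "dist w 1 < d" for w z
  proof -
    have "h (1, z) = 0"
      using that a_one by (simp add: h_def)
    then show ?thesis
      using d(2)[of "(1, z)" "(w, z)"] that one by (simp add: dist_Pair_Pair)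
  qed
  have inv: "invertible_lift w (a w)" if w: "w \<in> circle" "dist w 1 < d" for w
    unfolding invertible_lift_def
  proof (intro conjI ballI a_lift w)
    fix z assume z: "z \<in> circle"
    have wz: "w * z \<in> circle"
      using w z by simp
    have cw: "cnj w \<in> circle" "dist (cnj w) 1 < d"
    proof -
      have "cnj w - 1 = cnj (w - 1)"
        by simp
      then show "dist (cnj w) 1 < d"
        using w(2) by (metis complex_mod_cnj dist_norm)
      show "cnj w \<in> circle"
        using cnj_circle(1)[OF w(1) z] .
    qed
    show "\<exists>b\<in>fmats N. b * a w z = p z \<and> a w z * b = p (w * z)"
    proof (rule invertible_near_unit[OF a_lift[OF w(1)] w(1) z])
      show "a (cnj w) (w * z) \<in> fmats N"
        using liftD(1)[OF a_lift[OF cw(1)] wz] .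
      show "norm (p z - a (cnj w) (w * z) * a w z) < 1"
        using h_small[OF w(1) z w(2)] by (simp add: h_def)
      show "norm (p (w * z) - a w z * a (cnj w) (w * z)) < 1"
        using h_small[OF cw(1) wz cw(2)] cnj_circle(2)[OF w(1) z] by (simp add: h_def)
    qed
  qed
  have "isCont cis 0"
    using continuous_on_cis[OF continuous_on_id, of UNIV] by (simp add: continuous_on_eq_continuous_at)
  then obtain e where e: "0 < e" "\<And>t. dist t 0 < e \<Longrightarrow> dist (cis t) (cis 0) < d"
    using d(1) unfolding continuous_at_eps_delta by metis
  show ?thesis
  proof (rule that[of "e / 2" "\<lambda>t. a (cis t)"])
    show "lift_path {0..e / 2} (\<lambda>t. a (cis t))"
      unfolding lift_path_def
    proof (intro conjI ballI)
      have "continuous_on ({0..e / 2} \<times> circle) (\<lambda>x. (\<lambda>(w, z). a w z) (cis (fst x), snd x))"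
        by (rule continuous_on_compose2[OF a_cont]) (auto intro!: continuous_intros continuous_on_cis)
      then show "continuous_on ({0..e / 2} \<times> circle) (\<lambda>(t, z). a (cis t) z)"
        by (simp add: case_prod_unfold)
      show "invertible_lift (cis t) (a (cis t))" if "t \<in> {0..e / 2}" for t
        using e that by (intro inv) auto
      show "a (cis 0) z = p z" if "z \<in> circle" for z
        using a_one that by simp
    qed
  qed (use e in simp)
qed

primrec step_power :: "real \<Rightarrow> (real \<Rightarrow> complex \<Rightarrow> fmat) \<Rightarrow> nat \<Rightarrow> complex \<Rightarrow> fmat"
  where
    "step_power e f 0 z = p z"
  | "step_power e f (Suc k) z = step_power e f k (cis e * z) * f e z"

text \<open>For \<open>t\<close> between \<open>k * e\<close> and \<open>(k + 1) * e\<close>, take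
  \<open>k\<close> copies of the lift \<open>f e\<close> followed by \<open>f (t - k * e)\<close>.
  The last conclusion, exact splitting of one step \<open>e\<close>, is what the extension provides
  beyond continuity.\<close>

lemma lift_path_extend:
  assumes e: "0 < e" and f: "lift_path {0..e} f"
  obtains h where "lift_path {0..} h" "\<And>t z. t \<in> {0..e} \<Longrightarrow> z \<in> circle \<Longrightarrow> h t z = f t z"
    "\<And>t z. 0 \<le> t \<Longrightarrow> z \<in> circle \<Longrightarrow> h (t + e) z = h t (cis e * z) * f e z"
proof -
  note fe = lift_pathD(2)[OF f, of e]
  let ?s = "step_power e f"
  have ind: "invertible_lift (cis (real k * e)) (?s k)" for k
  proof (induction k)
    case 0
    have "?s 0 = p"
      by (rule ext) simp
    then show ?case
      using invertible_lift_p by simp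
  next
    case (Suc k)
    have "invertible_lift (cis (real k * e) * cis e) (\<lambda>z. ?s k (cis e * z) * f e z)"
      using Suc fe e by (intro invertible_lift_compose) auto
    moreover have "cis (real k * e) * cis e = cis (real (Suc k) * e)"
      by (simp add: cis_mult algebra_simps)
    moreover have "?s (Suc k) = (\<lambda>z. ?s k (cis e * z) * f e z)"
      by (rule ext) simp
    ultimately show ?case
      by metis
  qed
  \<comment> \<open>\<open>step_power\<close> splits off the factor that acts first; consecutive
    pieces of \<open>h\<close> meet at the factor that acts last. All factors lift the same
    rotation, so both are possible.\<close>
  have s_alt: "?s (Suc k) z = f e (cis (real k * e) * z) * ?s k z" if "z \<in> circle" for k z
    using that
  proof (induction k arbitrary: z)
    case 0
    have "lift (cis e) (f e)"
      using lift_pathD(3)[OF f, of e] e by simp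
    then show ?case
      using liftD(2,3)[of "cis e" "f e" z] 0 by simp
  next
    case (Suc k)
    have "?s (Suc (Suc k)) z = ?s (Suc k) (cis e * z) * f e z"
      by simp
    also have "\<dots> = f e (cis (real k * e) * (cis e * z)) * ?s k (cis e * z) * f e z"
      using Suc by simp
    also have "cis (real k * e) * (cis e * z) = cis (real (Suc k) * e) * z"
      by (simp add: cis_mult algebra_simps flip: mult.assoc)
    finally show ?case
      by (simp add: mult.assoc)
  qed
  define h where "h = (\<lambda>t z. f (t - real (nat \<lfloor>t / e\<rfloor>) * e) (cis (real (nat \<lfloor>t / e\<rfloor>) * e) * z) *
      ?s (nat \<lfloor>t / e\<rfloor>) z)"
  \<comment> \<open>The formula of each piece holds at its right endpoint too, where the floor
    already selects the next piece; this agreement allows the closed pieces to be glued.\<close>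
  have piece: "h t z = f (t - real k * e) (cis (real k * e) * z) * ?s k z"
    if "real k * e \<le> t" "t \<le> real (Suc k) * e" "z \<in> circle" for k t z
  proof (cases "t = real (Suc k) * e")
    case True
    have "nat \<lfloor>t / e\<rfloor> = Suc k"
      using True e by simp
    then have "h t z = p (cis (real (Suc k) * e) * z) * ?s (Suc k) z"
      using True that(3) lift_pathD(4)[OF f] by (simp add: h_def)
    also have "\<dots> = ?s (Suc k) z"
      using ind[of "Suc k"] liftD(3) that(3) unfolding invertible_lift_def by blast
    also have "\<dots> = f e (cis (real k * e) * z) * ?s k z"
      using s_alt that by blast
    finally have "h t z = f e (cis (real k * e) * z) * ?s k z" .
    moreover have "t - real k * e = e"
      using True by (simp add: algebra_simps)
    ultimately show ?thesis
      by simp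
  next
    case False
    then have "real k \<le> t / e" "t / e < real k + 1"
      using that e by (auto simp: field_simps)
    then have "\<lfloor>t / e\<rfloor> = int k"
      by (simp add: floor_eq_iff)
    then show ?thesis
      by (simp add: h_def)
  qed
  have ex_k: "\<exists>k. real k * e \<le> t \<and> t \<le> real (Suc k) * e" if "0 \<le> t" for t
  proof (intro exI conjI)
    have "0 \<le> t / e"
      using that e by simp
    then have "real (nat \<lfloor>t / e\<rfloor>) \<le> t / e" "t / e < real (nat \<lfloor>t / e\<rfloor>) + 1"
      by linarith+
    then show "real (nat \<lfloor>t / e\<rfloor>) * e \<le> t" "t \<le> real (Suc (nat \<lfloor>t / e\<rfloor>)) * e"
      using e by (simp_all add: field_simps)
  qed
  have inv: "invertible_lift (cis t) (h t)" if "0 \<le> t" for t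
  proof -
    obtain k where k: "real k * e \<le> t" "t \<le> real (Suc k) * e"
      using ex_k \<open>0 \<le> t\<close> by blast
    let ?h = "\<lambda>z. f (t - real k * e) (cis (real k * e) * z) * ?s k z"
    have tk: "t - real k * e \<in> {0..e}"
      using k by (simp add: algebra_simps)
    have "invertible_lift (cis (t - real k * e) * cis (real k * e)) ?h"
      by (rule invertible_lift_compose(1)[OF lift_pathD(2)[OF f tk] ind]) auto
    then have h': "invertible_lift (cis t) ?h"
      by (simp add: cis_mult)
    have eq: "h t z = ?h z" if "z \<in> circle" for z
      using piece[OF k that] .
    have lift: "lift (cis t) (h t)"
      using h' eq unfolding invertible_lift_def lift_def by simp
    show ?thesis
      unfolding invertible_lift_def using h' lift eq unfolding invertible_lift_def by simp
  qed
  have cont_k: "continuous_on ({real k * e..real (Suc k) * e} \<times> circle) (\<lambda>(t, z). h t z)" for k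
  proof -
    have s_cont: "continuous_on circle (?s k)" for k
    proof (induction k)
      case 0
      have "?s 0 = p"
        by (rule ext) simp
      then show ?case
        using p_cont by simp
    next
      case (Suc k)
      have "continuous_on circle (\<lambda>z. ?s k (cis e * z) * f e z)"
        using e by (intro continuous_on_mult continuous_on_compose2[OF Suc] continuous_lift_path_comp[OF f] continuous_intros) auto
      moreover have "?s (Suc k) = (\<lambda>z. ?s k (cis e * z) * f e z)"
        by (rule ext) simp
      ultimately show ?case
        by metis
    qed
    have "continuous_on ({real k * e..real (Suc k) * e} \<times> circle)
        (\<lambda>x. f (fst x - real k * e) (cis (real k * e) * snd x) * ?s k (snd x))"
      by (intro continuous_on_mult continuous_lift_path_comp[OF f] continuous_on_compose2[OF s_cont] continuous_intros)
        (auto simp: algebra_simps)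
    then show ?thesis
      by (rule continuous_on_eq) (auto simp: piece)
  qed
  have cont_upto: "continuous_on ({0..real k * e} \<times> circle) (\<lambda>(t, z). h t z)" for k
  proof (induction k)
    case 0
    show ?case
      by (rule continuous_on_subset[OF cont_k[of 0]]) (use e in auto)
  next
    case (Suc k)
    have "continuous_on ({0..real k * e} \<times> circle \<union> {real k * e..real (Suc k) * e} \<times> circle) (\<lambda>(t, z). h t z)"
      by (intro continuous_on_closed_Un Suc cont_k closed_Times) auto
    moreover have "{0..real k * e} \<times> circle \<union> {real k * e..real (Suc k) * e} \<times> circle = {0..real (Suc k) * e} \<times> circle"
      using e by (auto simp: algebra_simps) (smt (verit) mult_nonneg_nonneg of_nat_0_le_iff)
    ultimately show ?case
      by simp
  qed
  have cont: "continuous_on ({0..} \<times> circle) (\<lambda>(t, z). h t z)"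
    unfolding continuous_on_eq_continuous_within
  proof
    fix x :: "real \<times> complex" assume x: "x \<in> {0..} \<times> circle"
    obtain k where k: "fst x < real k * e"
      using ex_less_of_nat_mult[OF e] by blast
    have "continuous (at x within {0..real k * e} \<times> circle) (\<lambda>(t, z). h t z)"
      using cont_upto[of k] x k by (auto simp: continuous_on_eq_continuous_within)
    moreover have "at x within {0..real k * e} \<times> circle = at x within {0..} \<times> circle"
      by (rule at_within_nhd[of _ "{..<real k * e} \<times> UNIV"]) (use k in \<open>auto intro: open_Times simp: mem_Times_iff\<close>)
    ultimately show "continuous (at x within {0..} \<times> circle) (\<lambda>(t, z). h t z)"
      by simp
  qed
  have h_f: "h t z = f t z" if "t \<in> {0..e}" "z \<in> circle" for t z
    using piece[of 0 t z] that liftD(2)[OF lift_pathD(3)[OF f that(1)] that(2)] by simp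
  show ?thesis
  proof (rule that[of h])
    show "lift_path {0..} h"
      unfolding lift_path_def using cont inv h_f[of 0] lift_pathD(4)[OF f] e by auto
    show "h (t + e) z = h t (cis e * z) * f e z" if "0 \<le> t" "z \<in> circle" for t z
    proof -
      obtain k where k: "real k * e \<le> t" "t \<le> real (Suc k) * e"
        using ex_k \<open>0 \<le> t\<close> by blast
      have "h (t + e) z = f (t + e - real (Suc k) * e) (cis (real (Suc k) * e) * z) * ?s (Suc k) z"
        using k that by (intro piece) (auto simp: algebra_simps)
      also have "\<dots> = f (t - real k * e) (cis (real k * e) * (cis e * z)) * ?s k (cis e * z) * f e z"
        by (simp add: algebra_simps cis_mult flip: mult.assoc cis_mult)
      also have "\<dots> = h t (cis e * z) * f e z"
        using piece[OF k, of "cis e * z"] that by simp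
      finally show ?thesis .
    qed
  qed (use h_f in auto)
qed

end

section \<open>Periodic equivariant flows\<close>

lemma cis_Arg2pi_circle: "z \<in> circle \<Longrightarrow> cis (Arg2pi z) = z"
  using Arg2pi_eq[of z] by (simp add: cis_conv_exp mem_sphere_0)

text \<open>A function of \<open>cis t\<close> is continuous as soon as it is continuous in
  \<open>t\<close>: two branches of the argument, one cut at 1 and one at -1, are continuous right
  inverses of \<open>cis\<close> on open sets covering the circle.\<close>

lemma continuous_on_circle_param:
  fixes h :: "'x::topological_space \<Rightarrow> real \<Rightarrow> 'b::topological_space"
  assumes h: "continuous_on (A \<times> {0..}) (\<lambda>(x, t). h x t)"
    and f: "\<And>x t. x \<in> A \<Longrightarrow> 0 \<le> t \<Longrightarrow> f x (cis t) = h x t"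
  shows "continuous_on (A \<times> circle) (\<lambda>(x, z). f x z)"
proof -
  let ?S = "A \<times> (circle - {1})" and ?T = "A \<times> (circle - {-1})"
  have ST: "A \<times> circle = ?S \<union> ?T"
    by auto
  have arg: "isCont Arg2pi z" if "z \<in> circle" "z \<noteq> 1" for z
  proof (rule continuous_at_Arg2pi)
    show "z \<notin> \<real>\<^sub>\<ge>\<^sub>0"
      using that by (auto simp: complex_nonneg_Reals_iff mem_sphere_0 complex_eq_iff cmod_eq_Re)
  qed
  have "continuous_on ?S (\<lambda>y. (\<lambda>(x, t). h x t) (fst y, Arg2pi (snd y)))"
  proof (rule continuous_on_compose2[OF h])
    have "continuous_on (circle - {1}) Arg2pi"
      using arg by (intro continuous_at_imp_continuous_on) auto
    then have "continuous_on ?S (\<lambda>y. Arg2pi (snd y))"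
      by (rule continuous_on_compose2) (auto intro: continuous_intros)
    then show "continuous_on ?S (\<lambda>y. (fst y, Arg2pi (snd y)))"
      by (intro continuous_intros)
  qed (use Arg2pi in auto)
  then have S: "continuous_on ?S (\<lambda>(x, z). f x z)"
  proof (rule continuous_on_eq)
    fix y assume "y \<in> ?S"
    then show "(\<lambda>(x, t). h x t) (fst y, Arg2pi (snd y)) = (\<lambda>(x, z). f x z) y"
      using f[of "fst y" "Arg2pi (snd y)"] Arg2pi[of "snd y"] cis_Arg2pi_circle[of "snd y"] by auto
  qed
  \<comment> \<open>\<open>Arg2pi (- z) + pi\<close> is the branch cut at -1; it stays nonnegative,
    as the domain of \<open>h\<close> requires.\<close>
  have "continuous_on ?T (\<lambda>y. (\<lambda>(x, t). h x t) (fst y, Arg2pi (- snd y) + pi))"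
  proof (rule continuous_on_compose2[OF h])
    have "continuous_on (circle - {1}) Arg2pi"
      using arg by (intro continuous_at_imp_continuous_on) auto
    then have "continuous_on ?T (\<lambda>y. Arg2pi (- snd y))"
      by (rule continuous_on_compose2)
        (auto intro!: continuous_on_minus continuous_on_snd continuous_on_id simp: mem_sphere_0 minus_equation_iff[of _ 1])
    then show "continuous_on ?T (\<lambda>y. (fst y, Arg2pi (- snd y) + pi))"
      by (intro continuous_intros)
  qed (use Arg2pi in \<open>auto intro: add_nonneg_nonneg\<close>)
  then have T: "continuous_on ?T (\<lambda>(x, z). f x z)"
  proof (rule continuous_on_eq)
    fix y assume y: "y \<in> ?T"
    then have "cis (Arg2pi (- snd y) + pi) = snd y"
      using cis_Arg2pi_circle[of "- snd y"] by (auto simp: mem_sphere_0 simp flip: cis_mult)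
    then show "(\<lambda>(x, t). h x t) (fst y, Arg2pi (- snd y) + pi) = (\<lambda>(x, z). f x z) y"
      using f[of "fst y" "Arg2pi (- snd y) + pi"] Arg2pi[of "- snd y"] y by auto
  qed
  have "openin (top_of_set (A \<times> circle)) ((A \<times> circle) \<inter> (UNIV \<times> (- {a})))" for a
    by (intro openin_open_Int open_Times) auto
  moreover have "(A \<times> circle) \<inter> (UNIV \<times> (- {1})) = ?S" "(A \<times> circle) \<inter> (UNIV \<times> (- {-1})) = ?T"
    by auto
  ultimately have "openin (top_of_set (?S \<union> ?T)) ?S" "openin (top_of_set (?S \<union> ?T)) ?T"
    unfolding ST[symmetric] by metis+
  then show ?thesis
    unfolding ST by (rule continuous_on_Un_local_open[OF _ _ S T])
qed

section \<open>Flows, irreducibility and Schur's lemma\<close>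

context circle_cocycle
begin

lemma one_circle [simp]: "1 \<in> circle"
  by (simp add: mem_sphere_0)

definition flow :: "(real \<Rightarrow> complex \<Rightarrow> fmat) \<Rightarrow> bool"
  where "flow f \<longleftrightarrow> lift_path {0..} f \<and>
    (\<forall>s\<ge>0. \<forall>t\<ge>0. \<forall>z\<in>circle. f (s + t) z = f s (cis t * z) * f t z)"

text \<open>Irreducible in the sense that no continuous equivariant idempotent splits the bundle.
  The test is made at 1, where the induction also counts dimensions.\<close>

definition irreducible_cocycle :: bool
  where "irreducible_cocycle \<longleftrightarrow> (\<forall>q. continuous_on circle q \<longrightarrow> lift 1 q \<longrightarrow>
    (\<forall>z\<in>circle. q z * q z = q z) \<longrightarrow> q 1 = 0 \<or> q 1 = p 1)"

text \<open>Schur's lemma. Let \<open>n\<close> be \<open>f\<close> minus an eigenvalue of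
  \<open>f 1\<close>. The maps \<open>u\<close> and \<open>v\<close> conjugate \<open>n 1\<close>
  into every \<open>n z\<close>, so \<open>n\<close> has uniformly bounded generalised inverses,
  hence a continuous one, and by averaging an equivariant one \<open>a\<close>. Then
  \<open>a * n\<close> is an equivariant idempotent; the eigenvalue keeps it from being the identity
  at 1, so it is 0 there and \<open>n\<close> vanishes. Boundedness of \<open>u\<close> and
  \<open>v\<close> is enough, so they may jump along the circle.\<close>

lemma irreducible_endomorphism_scalar:
  assumes irr: "irreducible_cocycle" and p1: "p 1 \<noteq> 0"
    and f: "lift 1 f" "continuous_on circle f"
    and UV: "\<And>z. z \<in> circle \<Longrightarrow> v z * u z = p 1" "\<And>z. z \<in> circle \<Longrightarrow> u z * v z = p z"
    and fu: "\<And>z. z \<in> circle \<Longrightarrow> f z * u z = u z * f 1"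
    and bound: "\<And>z. z \<in> circle \<Longrightarrow> norm (u z) \<le> K" "\<And>z. z \<in> circle \<Longrightarrow> norm (v z) \<le> K"
  obtains l where "\<And>z. z \<in> circle \<Longrightarrow> f z = l *\<^sub>c p z"
proof -
  have "p 1 * f 1 = f 1"
    using liftD(3)[OF f(1) one_circle] by simp
  then obtain l where l: "\<nexists>y. y * (f 1 - l *\<^sub>c p 1) = p 1"
    using eigenvalue_exists[of "p 1" N "f 1"] liftD(1)[OF f(1) one_circle] p1 by auto
  define n where "n = (\<lambda>z. f z - l *\<^sub>c p z)"
  have n: "lift 1 n"
    unfolding lift_def n_def
  proof (intro conjI ballI)
    fix z assume z: "z \<in> circle"
    show "f z - l *\<^sub>c p z \<in> fmats N" "(f z - l *\<^sub>c p z) * p z = f z - l *\<^sub>c p z"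
      using liftD[OF f(1) z] z by (simp_all add: left_diff_distrib)
    fix g assume "g \<in> carrier G"
    then show "(f (r g * z) - l *\<^sub>c p (r g * z)) * c g z = c g (1 * z) * (f z - l *\<^sub>c p z)"
      using liftD(4)[OF f(1) z] z by (simp add: left_diff_distrib right_diff_distrib p_c c_p)
  qed
  have n_cont: "continuous_on circle n"
    unfolding n_def using f(2) p_cont by (intro continuous_intros)
  have p_n: "p z * n z = n z" "n z * p z = n z" "n z \<in> fmats N" if "z \<in> circle" for z
    using liftD(1-3)[OF n that] by simp_all
  have n_conj: "n z = u z * n 1 * v z" if z: "z \<in> circle" for z
  proof -
    have "p z * u z = u z * p 1"
      using UV[OF z] by (metis mult.assoc)
    then have "n z * u z = u z * n 1"
      using fu[OF z] by (simp add: n_def left_diff_distrib right_diff_distrib)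
    then have "u z * n 1 * v z = n z * (u z * v z)"
      by (simp add: mult.assoc[symmetric])
    then show ?thesis
      using UV(2)[OF z] p_n(2)[OF z] by simp
  qed
  obtain y where y: "n 1 * y * n 1 = n 1"
    using moore_penrose_exists[OF p_n(3)[OF one_circle]] unfolding moore_penrose_def by metis
  \<comment> \<open>A fixed generalised inverse \<open>y\<close> of \<open>n 1\<close>, transported
    to the fibre over \<open>z\<close>, is bounded by the bounds of \<open>u\<close> and
    \<open>v\<close>.\<close>
  have "\<exists>x. n z * x * n z = n z \<and> norm x \<le> K * norm y * K" if z: "z \<in> circle" for z
  proof (intro exI conjI)
    have "n z * (u z * y * v z) * n z = u z * (n 1 * (v z * u z)) * y * ((v z * u z) * n 1) * v z"
      unfolding n_conj[OF z] by (simp add: mult.assoc)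
    also have "\<dots> = u z * (n 1 * y * n 1) * v z"
      using UV(1)[OF z] p_n[OF one_circle] by (simp add: mult.assoc)
    finally show "n z * (u z * y * v z) * n z = n z"
      using y n_conj[OF z] by simp
    have "norm (u z * y * v z) \<le> norm (u z) * norm y * norm (v z)"
      by (meson mult_right_mono norm_ge_zero norm_mult_ineq order_trans)
    also have "\<dots> \<le> K * norm y * K"
      using bound[OF z] order_trans[OF norm_ge_zero bound(1)[OF z]] by (intro mult_mono) auto
    finally show "norm (u z * y * v z) \<le> K * norm y * K" .
  qed
  then obtain y0 where y0: "continuous_on circle y0"
    "\<And>z. z \<in> circle \<Longrightarrow> y0 z \<in> fmats N \<and> n z * y0 z * n z = n z"
    using continuous_generalised_inverse[OF n_cont p_n(3)] by metis
  have yc: "continuous_on (circle \<times> circle) (\<lambda>(w, z). y0 z)"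
    unfolding case_prod_unfold by (rule continuous_on_compose2[OF y0(1)]) (auto intro!: continuous_intros)
  have yin: "w \<in> circle \<Longrightarrow> z \<in> circle \<Longrightarrow> y0 z \<in> fmats N" for w z
    using y0(2) by simp
  define a where "a = avg_lift (\<lambda>w z. y0 z) 1"
  have a: "lift 1 a"
    unfolding a_def by (rule lift_avg_lift[OF yc yin one_circle])
  have a_cont: "continuous_on circle a"
  proof -
    have "continuous_on circle (\<lambda>z. (\<lambda>(w, z). avg_lift (\<lambda>w z. y0 z) w z) (1, z))"
      by (rule continuous_on_compose2[OF continuous_avg_lift[OF yc yin]]) (auto intro!: continuous_intros)
    then show ?thesis
      by (simp add: a_def)
  qed
  \<comment> \<open>The equation is linear in \<open>a\<close> and invariant under conjugation by
    the group, because \<open>n\<close> is equivariant; so averaging preserves it.\<close>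
  have nan: "n z * a z * n z = n z" if z: "z \<in> circle" for z
  proof -
    let ?H = "\<lambda>g. c (inv g) (r g * (1 * z)) * y0 (r g * z) * c g z"
    have fm: "fmat_map N ?H"
      by (rule fmat_map_avg_lift[OF yc yin one_circle z])
    have "bounded_linear (\<lambda>x. n z * x * n z)"
      using bounded_linear_compose[OF bounded_linear_mult_left[of "n z"] bounded_linear_mult_right[of "n z"]]
      by simp
    then have "n z * a z * n z = mean (\<lambda>g. n z * ?H g * n z)"
      unfolding a_def avg_lift_def using p_n(3)[OF z] by (intro mean_linear[OF fm, symmetric]) auto
    also have "\<dots> = n z"
    proof (rule mean_const[OF p_n(3)[OF z]])
      fix g assume g: "g \<in> carrier G"
      have rz: "r g * z \<in> circle"
        using g z by simp
      have "n z * c (inv g) (r g * z) = c (inv g) (r g * z) * n (r g * z)"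
        using liftD(4)[OF n rz, of "inv g"] g r_inv(1)[OF g, of z] by simp
      moreover have "c g z * n z = n (r g * z) * c g z"
        using liftD(4)[OF n z g] by simp
      ultimately have "n z * ?H g * n z = c (inv g) (r g * z) * (n (r g * z) * y0 (r g * z) * n (r g * z)) * c g z"
        by (simp add: mult.assoc) (simp flip: mult.assoc)
      also have "\<dots> = c (inv g) (r g * z) * (n (r g * z) * c g z)"
        using y0(2)[OF rz] by (simp add: mult.assoc)
      also have "\<dots> = c (inv g) (r g * z) * c g z * n z"
        using \<open>c g z * n z = n (r g * z) * c g z\<close> by (simp add: mult.assoc)
      also have "\<dots> = n z"
        using c_inv[OF g z] p_n(1)[OF z] by simp
      finally show "n z * ?H g * n z = n z" .
    qed
    finally show ?thesis .
  qed
  define q where "q = (\<lambda>z. a z * n z)"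
  have "lift 1 q"
    using lift_compose[OF a n] by (simp add: q_def)
  moreover have "continuous_on circle q"
    unfolding q_def using a_cont n_cont by (intro continuous_intros)
  moreover have "q z * q z = q z" if "z \<in> circle" for z
    using nan[OF that] by (simp add: q_def mult.assoc)
  ultimately have "q 1 = 0 \<or> q 1 = p 1"
    using irr unfolding irreducible_cocycle_def by blast
  \<comment> \<open>Equality would make \<open>a 1\<close> a left inverse of
    \<open>f 1 - l *\<^sub>c p 1\<close>, against the choice of \<open>l\<close>.\<close>
  moreover have "q 1 \<noteq> p 1"
    using l unfolding q_def n_def by blast
  ultimately have "n 1 = 0"
    using nan[OF one_circle] by (simp add: q_def mult.assoc)
  then have "f z = l *\<^sub>c p z" if "z \<in> circle" for z
    using n_conj[OF that] by (simp add: n_def)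
  then show ?thesis
    using that by blast
qed

lemma invertible_lift_cscale:
  assumes "invertible_lift w f" "a \<noteq> 0"
  shows "invertible_lift w (\<lambda>z. a *\<^sub>c f z)"
  unfolding invertible_lift_def
proof (intro conjI ballI)
  have f: "lift w f"
    using assms by (simp add: invertible_lift_def)
  then show "lift w (\<lambda>z. a *\<^sub>c f z)"
    unfolding lift_def by simp
  fix z assume z: "z \<in> circle"
  obtain b where "b \<in> fmats N" "b * f z = p z" "f z * b = p (w * z)"
    using assms z unfolding invertible_lift_def by blast
  then show "\<exists>b\<in>fmats N. b * a *\<^sub>c f z = p z \<and> a *\<^sub>c f z * b = p (w * z)"
    using assms(2) by (intro bexI[of _ "inverse a *\<^sub>c b"]) auto
qed

lemma lift_path_cscale:
  assumes "lift_path I f" "continuous_on I a" "\<And>t. t \<in> I \<Longrightarrow> a t \<noteq> 0" "a 0 = 1"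
  shows "lift_path I (\<lambda>t z. a t *\<^sub>c f t z)"
  unfolding lift_path_def
proof (intro conjI ballI)
  have "continuous_on (I \<times> circle) (\<lambda>x. a (fst x))"
    by (rule continuous_on_compose2[OF assms(2)]) (auto intro: continuous_intros)
  then show "continuous_on (I \<times> circle) (\<lambda>(t, z). a t *\<^sub>c f t z)"
    using lift_pathD(1)[OF assms(1)] unfolding case_prod_unfold by (intro continuous_intros)
  show "invertible_lift (cis t) (\<lambda>z. a t *\<^sub>c f t z)" if "t \<in> I" for t
    using that assms by (intro invertible_lift_cscale lift_pathD(2))
  show "a 0 *\<^sub>c f 0 z = p z" if "z \<in> circle" for z
    using that assms lift_pathD(4) by simp
qed

text \<open>The full turn \<open>f (2 * pi)\<close> lifts the identity and commutes with the flow,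
  so moving along the flow from 1 to \<open>z\<close> conjugates its values; by Schur's lemma it is
  a scalar.\<close>

lemma flow_periodic:
  assumes irr: "irreducible_cocycle" and p1: "p 1 \<noteq> 0" and f: "flow f"
  obtains h where "flow h" "\<And>z. z \<in> circle \<Longrightarrow> h (2 * pi) z = p z"
proof -
  have path: "lift_path {0..} f" and add: "\<And>s t z. 0 \<le> s \<Longrightarrow> 0 \<le> t \<Longrightarrow> z \<in> circle \<Longrightarrow> f (s + t) z = f s (cis t * z) * f t z"
    using f by (auto simp: flow_def)
  have F: "lift 1 (f (2 * pi))"
    using lift_pathD(3)[OF path, of "2 * pi"] by simp
  have F_cont: "continuous_on circle (\<lambda>z. f (2 * pi) z)"
    by (rule continuous_lift_path_comp[OF path]) (auto intro: continuous_intros)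
  define u where "u = (\<lambda>z. f (Arg2pi z) 1)"
  define v where "v = (\<lambda>z. lift_inv (cis (Arg2pi z)) (f (Arg2pi z)) 1)"
  have "continuous_on {0..2 * pi} (\<lambda>s. f s 1)"
    by (rule continuous_lift_path_comp[OF path]) (auto intro: continuous_intros)
  moreover have "continuous_on {0..2 * pi} (\<lambda>s. lift_inv (cis s) (f s) 1)"
    by (rule continuous_lift_inv_comp[OF path]) (auto intro: continuous_intros)
  ultimately have "bounded ((\<lambda>s. f s 1) ` {0..2 * pi})" "bounded ((\<lambda>s. lift_inv (cis s) (f s) 1) ` {0..2 * pi})"
    by (auto intro!: compact_imp_bounded compact_continuous_image)
  then have "\<exists>K. \<forall>s\<in>{0..2 * pi}. norm (f s 1) \<le> K"
      "\<exists>K. \<forall>s\<in>{0..2 * pi}. norm (lift_inv (cis s) (f s) 1) \<le> K"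
    by (simp_all only: bounded_iff ball_simps)
  then obtain K1 K2 where K: "\<forall>s\<in>{0..2 * pi}. norm (f s 1) \<le> K1"
      "\<forall>s\<in>{0..2 * pi}. norm (lift_inv (cis s) (f s) 1) \<le> K2"
    by blast
  have arg: "Arg2pi z \<in> {0..2 * pi}" "0 \<le> Arg2pi z" for z
    using Arg2pi[of z] by auto
  have inv: "invertible_lift (cis (Arg2pi z)) (f (Arg2pi z))" for z
    using lift_pathD(2)[OF path] arg by simp
  obtain l where l: "\<And>z. z \<in> circle \<Longrightarrow> f (2 * pi) z = l *\<^sub>c p z"
  proof (rule irreducible_endomorphism_scalar[OF irr p1 F F_cont, where u = u and v = v and K = "max K1 K2"])
    fix z assume z: "z \<in> circle"
    show "v z * u z = p 1" "u z * v z = p z"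
      using lift_inv(2,3)[OF inv[of z] circle_cis one_circle] cis_Arg2pi_circle[OF z]
      by (simp_all add: u_def v_def)
    show "f (2 * pi) z * u z = u z * f (2 * pi) 1"
      using add[of "2 * pi" "Arg2pi z" 1] add[of "Arg2pi z" "2 * pi" 1] arg(2)[of z] cis_Arg2pi_circle[OF z]
      by (simp add: u_def add.commute)
    show "norm (u z) \<le> max K1 K2" "norm (v z) \<le> max K1 K2"
      using bspec[OF K(1) arg(1)[of z]] bspec[OF K(2) arg(1)[of z]] by (simp_all add: u_def v_def)
  qed (rule that)
  have "l \<noteq> 0"
  proof
    assume "l = 0"
    then have "f (2 * pi) 1 = 0"
      using l[OF one_circle] by simp
    then show False
      using lift_inv(2)[OF lift_pathD(2)[OF path, of "2 * pi"], of 1] p1 by simp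
  qed
  \<comment> \<open>A one-parameter group of numbers with value \<open>1 / l\<close> at
    \<open>2 * pi\<close>, so the flow law survives the rescaling.\<close>
  define a where "a = (\<lambda>t. exp (- complex_of_real (t / (2 * pi)) * Ln l))"
  show ?thesis
  proof (rule that[of "\<lambda>t z. a t *\<^sub>c f t z"])
    show "flow (\<lambda>t z. a t *\<^sub>c f t z)"
      unfolding flow_def
    proof (intro conjI allI impI ballI)
      show "lift_path {0..} (\<lambda>t z. a t *\<^sub>c f t z)"
        using path by (rule lift_path_cscale) (auto simp: a_def intro!: continuous_intros)
      fix s t :: real and z assume "0 \<le> s" "0 \<le> t" "z \<in> circle"
      moreover have "a (s + t) = a t * a s"
        unfolding a_def exp_add[symmetric] by (rule arg_cong[of _ _ exp]) (simp add: field_simps)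
      ultimately show "a (s + t) *\<^sub>c f (s + t) z = a s *\<^sub>c f s (cis t * z) * a t *\<^sub>c f t z"
        using add by simp
    qed
    show "a (2 * pi) *\<^sub>c f (2 * pi) z = p z" if "z \<in> circle" for z
      using l[OF that] \<open>l \<noteq> 0\<close> by (simp add: a_def exp_minus exp_Ln)
  qed
qed

lemma lift_path_multiples:
  assumes e: "0 < e" and h: "lift_path {0..} h"
    and step: "\<And>t z. 0 \<le> t \<Longrightarrow> z \<in> circle \<Longrightarrow> h (t + e) z = h t (cis e * z) * h e z"
    and "0 \<le> t" "z \<in> circle"
  shows "h (t + real j * e) z = h t (cis (real j * e) * z) * h (real j * e) z"
  using assms(4,5)
proof (induction j arbitrary: t z)
  case 0
  then show ?case
    using liftD(2)[OF lift_pathD(3)[OF h, of t], of z] lift_pathD(4)[OF h] by simp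
next
  case (Suc j)
  have "h (t + real (Suc j) * e) z = h ((t + real j * e) + e) z"
    by (simp add: algebra_simps)
  also have "\<dots> = h (t + real j * e) (cis e * z) * h e z"
    using Suc.prems e by (intro step) auto
  also have "\<dots> = h t (cis (real j * e) * (cis e * z)) * (h (real j * e) (cis e * z) * h e z)"
    using Suc by (simp add: mult.assoc)
  also have "h (real j * e) (cis e * z) * h e z = h (real j * e + e) z"
    using Suc.prems e by (intro step[symmetric]) auto
  also have "real j * e + e = real (Suc j) * e"
    by (simp add: algebra_simps)
  also have "cis (real j * e) * (cis e * z) = cis (real (Suc j) * e) * z"
    by (simp add: cis_mult algebra_simps flip: mult.assoc)
  finally show ?case .
qed

text \<open>The step may be any sufficiently small number, so it can be adapted to the order of the
  image of \<open>G\<close>.\<close>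

lemma extended_lift_path:
  obtains e0 where "0 < e0"
    "\<And>e. 0 < e \<Longrightarrow> e \<le> e0 \<Longrightarrow> \<exists>h. lift_path {0..} h \<and>
      (\<forall>t\<ge>0. \<forall>z\<in>circle. h (t + e) z = h t (cis e * z) * h e z)"
proof -
  obtain e0 f where e0: "0 < e0" and f: "lift_path {0..e0} f"
    by (rule local_lift_path)
  have "\<exists>h. lift_path {0..} h \<and> (\<forall>t\<ge>0. \<forall>z\<in>circle. h (t + e) z = h t (cis e * z) * h e z)"
    if e: "0 < e" "e \<le> e0" for e
  proof -
    have "lift_path {0..e} f"
      using lift_path_subset[OF f] e by simp
    from lift_path_extend[OF e(1) this] obtain h where h: "lift_path {0..} h"
      "\<And>t z. t \<in> {0..e} \<Longrightarrow> z \<in> circle \<Longrightarrow> h t z = f t z"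
      "\<And>t z. 0 \<le> t \<Longrightarrow> z \<in> circle \<Longrightarrow> h (t + e) z = h t (cis e * z) * f e z"
      by metis
    then show ?thesis
      using e by auto
  qed
  then show ?thesis
    using that e0 by blast
qed

text \<open>The quotient \<open>h (s + t)\<close> by \<open>h t\<close> is additive in
  \<open>s\<close> by cancellation. What is in doubt is that it depends on \<open>cis t\<close> only
  and is equivariant. Both reduce to shifts of \<open>t\<close> by multiples of the step
  \<open>e\<close>: the full turn is one, and so is every rotation \<open>r g\<close>.\<close>

lemma finite_image_flow:
  assumes m: "0 < m" "\<And>g. g \<in> carrier G \<Longrightarrow> r g ^ m = 1"
  obtains f where "flow f"
proof -
  obtain e0 where e0: "0 < e0" "\<And>e. 0 < e \<Longrightarrow> e \<le> e0 \<Longrightarrow> \<exists>h. lift_path {0..} h \<and>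
      (\<forall>t\<ge>0. \<forall>z\<in>circle. h (t + e) z = h t (cis e * z) * h e z)"
    using extended_lift_path by metis
  obtain K where K: "2 * pi / (real m * e0) < real K"
    using reals_Archimedean2 by blast
  then have K0: "0 < K"
    using e0(1) m(1) by (metis divide_pos_pos gr0I mult_pos_pos not_less_iff_gr_or_eq of_nat_0 of_nat_0_less_iff order_less_trans pi_gt_zero zero_less_numeral)
  \<comment> \<open>\<open>m * K\<close> steps make a full turn, and \<open>K\<close> is large
    enough for the step to be at most \<open>e0\<close>.\<close>
  define e where "e = 2 * pi / (real m * real K)"
  have e: "0 < e" "e \<le> e0" "real (m * K) * e = 2 * pi"
    using K K0 m e0 by (auto simp: e_def field_simps)
  obtain h where h: "lift_path {0..} h"
    and step: "\<And>t z. 0 \<le> t \<Longrightarrow> z \<in> circle \<Longrightarrow> h (t + e) z = h t (cis e * z) * h e z"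
    using e0(2)[OF e(1,2)] by blast
  have mult: "h (t + real j * e) z = h t (cis (real j * e) * z) * h (real j * e) z" if "0 \<le> t" "z \<in> circle" for t z j
    using lift_path_multiples[OF e(1) h step that] by blast
  have inv: "invertible_lift (cis t) (h t)" if "0 \<le> t" for t
    using lift_pathD(2)[OF h] that by simp
  let ?i = "\<lambda>t z. lift_inv (cis t) (h t) z"
  have i_mult: "?i (t + real j * e) z = ?i (real j * e) z * ?i t (cis (real j * e) * z)"
    if t: "0 \<le> t" and z: "z \<in> circle" for t z j
  proof -
    let ?w = "cis (real j * e)"
    have j: "0 \<le> real j * e"
      using e by simp
    have "lift_inv (cis t * ?w) (\<lambda>z. h t (?w * z) * h (real j * e) z) z = ?i (real j * e) z * ?i t (?w * z)"
      by (rule invertible_lift_compose(2)[OF inv[OF t] inv[OF j] _ _ z]) auto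
    have "?i (real j * e) z * ?i t (?w * z) = ?i (t + real j * e) z"
    proof (rule lift_inv_unique[OF inv])
      have "?i (real j * e) z * ?i t (?w * z) * (h t (?w * z) * h (real j * e) z) = p z"
        using lift_inv(2)[OF invertible_lift_compose(1)[OF inv[OF t] inv[OF j]], of z]
          invertible_lift_compose(2)[OF inv[OF t] inv[OF j] _ _ z] z by simp
      then show "?i (real j * e) z * ?i t (?w * z) * h (t + real j * e) z = p z"
        using mult[OF t z] by simp
      have "?i t (?w * z) * p (cis t * (?w * z)) = ?i t (?w * z)"
        using lift_inv(5)[OF inv[OF t]] z by simp
      moreover have w: "cis (t + real j * e) * z = cis t * (?w * z)"
        by (simp add: cis_mult flip: mult.assoc)
      ultimately show "?i (real j * e) z * ?i t (?w * z) * p (cis (t + real j * e) * z) =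
          ?i (real j * e) z * ?i t (?w * z)"
        unfolding w by (simp only: mult.assoc)
    qed (use t j z in auto)
    then show ?thesis
      by simp
  qed
  \<comment> \<open>From the fibre over \<open>cis t\<close> back to the fibre over 1, then forward
    to the one over \<open>cis (t + s)\<close>.\<close>
  define F where "F = (\<lambda>s t. h (t + s) 1 * ?i t 1)"
  \<comment> \<open>The shift replaces the base point 1 of both factors by
    \<open>cis (real j * e)\<close>: the common initial stretch of \<open>j\<close> steps
    cancels.\<close>
  have F_shift: "F s (t + real j * e) = h (t + s) (cis (real j * e)) * ?i t (cis (real j * e))"
    if "0 \<le> s" "0 \<le> t" for s t j
  proof -
    let ?w = "cis (real j * e)"
    have j: "0 \<le> real j * e"
      using e by simp
    have "F s (t + real j * e) = (h (t + s) ?w * h (real j * e) 1) * (?i (real j * e) 1 * ?i t ?w)"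
      using mult[of "t + s" 1 j] i_mult[of t 1 j] that by (simp add: F_def algebra_simps)
    also have "\<dots> = h (t + s) ?w * ((h (real j * e) 1 * ?i (real j * e) 1) * ?i t ?w)"
      by (simp add: mult.assoc)
    also have "\<dots> = h (t + s) ?w * (p ?w * ?i t ?w)"
      using lift_inv(3)[OF inv[OF j], of 1] by simp
    also have "p ?w * ?i t ?w = ?i t ?w"
      using lift_inv(4)[OF inv[OF that(2)], of ?w] by simp
    finally show ?thesis .
  qed
  \<comment> \<open>After \<open>m * K\<close> steps the base point is 1 again.\<close>
  have F_2pi: "F s (t + 2 * pi * real k) = F s t" if "0 \<le> s" "0 \<le> t" for s t k
  proof (induction k)
    case (Suc k)
    have "F s ((t + 2 * pi * real k) + real (m * K) * e) = F s (t + 2 * pi * real k)"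
      using F_shift[of s "t + 2 * pi * real k" "m * K"] that unfolding e(3) by (simp add: F_def)
    then show ?case
      using Suc unfolding e(3) by (simp add: algebra_simps)
  qed simp
  define f where "f = (\<lambda>s z. F s (Arg2pi z))"
  have f_cis: "f s (cis t) = F s t" if "0 \<le> s" "0 \<le> t" for s t
  proof -
    have "cis (Arg2pi (cis t)) = cis t"
      by (rule cis_Arg2pi_circle) simp
    then obtain k :: int where k: "t = Arg2pi (cis t) + 2 * pi * of_int k"
      using sin_cos_eq_iff[of t "Arg2pi (cis t)"] by (auto simp: complex_eq_iff)
    have "- 1 < real_of_int k"
    proof (rule ccontr)
      assume "\<not> - 1 < real_of_int k"
      then have "2 * pi * of_int k \<le> 2 * pi * (- 1)"
        by (intro mult_left_mono) auto
      then show False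
        using k Arg2pi[of "cis t"] that by linarith
    qed
    then have "0 \<le> k"
      by linarith
    then have "t = Arg2pi (cis t) + 2 * pi * real (nat k)"
      using k by simp
    then show ?thesis
      using F_2pi[OF that(1), of "Arg2pi (cis t)" "nat k"] Arg2pi[of "cis t"] by (simp add: f_def)
  qed
  have circ: "\<exists>t\<ge>0. z = cis t" if "z \<in> circle" for z
    using cis_Arg2pi_circle[OF that] Arg2pi[of z] by metis
  have cont: "continuous_on ({0..} \<times> circle) (\<lambda>(s, z). f s z)"
  proof (rule continuous_on_circle_param)
    have "continuous_on ({0..} \<times> {0..}) (\<lambda>x. h (snd x + fst x) 1 * ?i (snd x) 1)"
      by (intro continuous_on_mult continuous_lift_path_comp[OF h] continuous_lift_inv_comp[OF h] continuous_intros)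
        auto
    then show "continuous_on ({0..} \<times> {0..}) (\<lambda>(s, t). F s t)"
      by (simp add: F_def case_prod_unfold)
  qed (use f_cis in auto)
  have inv_f: "invertible_lift (cis s) (f s)" if s: "0 \<le> s" for s
    unfolding invertible_lift_def lift_def
  proof (intro conjI ballI)
    fix z assume "z \<in> circle"
    then obtain t where t: "0 \<le> t" "z = cis t"
      using circ by blast
    note D = lift_inv[OF inv[OF t(1)] circle_cis one_circle]
    have ts: "0 \<le> t + s"
      using s t by simp
    note D' = lift_inv[OF inv[OF ts] circle_cis one_circle]
    have lh: "lift (cis (t + s)) (h (t + s))"
      using lift_pathD(3)[OF h] ts by simp
    have fz: "f s z = h (t + s) 1 * ?i t 1"
      using f_cis[OF s t(1)] t by (simp add: F_def)
    show "f s z \<in> fmats N" "f s z * p z = f s z"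
      unfolding fz using D liftD(1)[OF lh one_circle] t(2) by (simp_all add: mult.assoc)
    show "\<exists>b\<in>fmats N. b * f s z = p z \<and> f s z * b = p (cis s * z)"
    proof (intro bexI conjI)
      have "h t 1 * ?i (t + s) 1 * f s z = h t 1 * ((?i (t + s) 1 * h (t + s) 1) * ?i t 1)"
        by (simp add: fz mult.assoc)
      then show "h t 1 * ?i (t + s) 1 * f s z = p z"
        using D D' t(2) by simp
      have "f s z * (h t 1 * ?i (t + s) 1) = h (t + s) 1 * ((?i t 1 * h t 1) * ?i (t + s) 1)"
        by (simp add: fz mult.assoc)
      then show "f s z * (h t 1 * ?i (t + s) 1) = p (cis s * z)"
        using D D' t(2) by (simp add: cis_mult add.commute)
      show "h t 1 * ?i (t + s) 1 \<in> fmats N"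
        using D' liftD(1)[OF lift_pathD(3)[OF h, of t] one_circle] t(1) by simp
    qed
    fix g assume g: "g \<in> carrier G"
    \<comment> \<open>\<open>r g\<close> is an m-th root of unity, hence lies at a multiple of
      \<open>2 * pi / m\<close> and so at a multiple of \<open>e\<close>.\<close>
    obtain j where j: "r g = cis (real j * e)"
    proof -
      define a where "a = Arg2pi (r g)"
      have ra: "r g = cis a" "0 \<le> a"
        using cis_Arg2pi_circle[OF circle_r[OF g]] Arg2pi[of "r g"] by (simp_all add: a_def)
      have "cis (real m * a) = 1"
        using m(2)[OF g] unfolding ra Complex.DeMoivre .
      then have "cos (real m * a) = 1"
        by (simp add: complex_eq_iff)
      then obtain k :: int where k: "real m * a = of_int k * 2 * pi"
        unfolding cos_one_2pi_int by blast
      have "0 \<le> k"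
      proof (rule ccontr)
        assume "\<not> 0 \<le> k"
        then have "of_int k * 2 * pi < 0"
          by (simp add: mult_neg_pos)
        then show False
          using k ra(2) by (metis less_le_not_le mult_nonneg_nonneg of_nat_0_le_iff)
      qed
      then have "a = real (nat k * K) * e"
        using k m(1) K0 by (simp add: e_def field_simps)
      then show ?thesis
        using that ra by blast
    qed
    have lt: "lift_inv (cis t) (h t) (r g) * c g z = c g 1 * ?i t 1"
      using lift_inv_equivariant[OF inv[OF t(1)] circle_cis one_circle g] t(2) by simp
    have lts: "h (t + s) (r g) * c g 1 = c g (cis s * z) * h (t + s) 1"
      using liftD(4)[OF lh one_circle g] t(2) by (simp add: cis_mult add.commute)
    have "f s (r g * z) = F s (t + real j * e)"
      using f_cis[of s "t + real j * e"] s t e(1) unfolding j t(2) by (simp add: cis_mult add.commute)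
    also have "\<dots> = h (t + s) (r g) * ?i t (r g)"
      using F_shift[OF s t(1)] j by simp
    finally have "f s (r g * z) * c g z = h (t + s) (r g) * c g 1 * ?i t 1"
      using lt by (simp add: mult.assoc)
    then show "f s (r g * z) * c g z = c g (cis s * z) * f s z"
      using lts by (simp add: fz mult.assoc[symmetric])
  qed
  have "flow f"
    unfolding flow_def lift_path_def
  proof (intro conjI ballI allI impI cont)
    show "invertible_lift (cis s) (f s)" if "s \<in> {0..}" for s
      using inv_f that by simp
    fix z assume "z \<in> circle"
    then obtain t where t: "0 \<le> t" "z = cis t"
      using circ by blast
    note D = lift_inv[OF inv[OF t(1)] circle_cis one_circle]
    show "f 0 z = p z"
      using f_cis[of 0 t] t D by (simp add: F_def)
    fix s s' :: real assume s: "0 \<le> s" "0 \<le> s'"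
    have ts: "0 \<le> t + s'"
      using s t by simp
    have "f s (cis s' * z) = F s (t + s')"
      using f_cis[of s "t + s'"] s t by (simp add: cis_mult add.commute)
    then have "f s (cis s' * z) * f s' z = h (t + s' + s) 1 * (?i (t + s') 1 * h (t + s') 1) * ?i t 1"
      using f_cis[of s' t] s t by (simp add: F_def mult.assoc)
    also have "\<dots> = h (t + s' + s) 1 * ?i t 1"
      using lift_inv(2)[OF inv[OF ts] circle_cis one_circle] D(4) by (simp add: mult.assoc)
    also have "\<dots> = f (s + s') z"
      using f_cis[of "s + s'" t] s t by (simp add: F_def algebra_simps)
    finally show "f (s + s') z = f s (cis s' * z) * f s' z"
      by simp
  qed
  then show ?thesis
    using that by blast
qed

end

text \<open>Used to average over one period; stated on a half line because the functions in question
  exist for nonnegative times.\<close>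

lemma periodic_integral_shift:
  fixes f :: "real \<Rightarrow> 'b::euclidean_space"
  assumes f: "continuous_on {0..} f" and per: "\<And>x. 0 \<le> x \<Longrightarrow> f (x + e) = f x"
    and "0 \<le> t" "t \<le> e"
  shows "integral {0..e} (\<lambda>x. f (t + x)) = integral {0..e} f"
proof -
  have int: "f integrable_on {a..b}" if "0 \<le> a" for a b
    using continuous_on_subset[OF f] that by (intro integrable_continuous_real) auto
  have "integral {0..e} (\<lambda>x. f (t + x)) = integral {t..e + t} f"
    using integral_shift_Icc_real[of 0 e f t] by (simp add: o_def)
  also have "\<dots> = integral {t..e} f + integral {e..e + t} f"
    using assms by (intro Henstock_Kurzweil_Integration.integral_combine[symmetric] int) auto
  also have "integral {e..e + t} f = integral {0..t} (\<lambda>x. f (e + x))"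
    using integral_shift_Icc_real[of 0 t f e] by (simp add: o_def add.commute)
  also have "\<dots> = integral {0..t} f"
    by (intro integral_cong) (simp add: per add.commute)
  also have "integral {t..e} f + integral {0..t} f = integral {0..e} f"
    using Henstock_Kurzweil_Integration.integral_combine[of 0 t e f] assms int by (simp add: add.commute)
  finally show ?thesis .
qed

section \<open>Transitive action: the scalar 2-cocycle of a path of lifts\<close>

context circle_cocycle
begin

definition transitive_irreducible :: bool
  where "transitive_irreducible \<longleftrightarrow>
    irreducible_cocycle \<and> p 1 \<noteq> 0 \<and> (\<forall>z\<in>circle. \<exists>g\<in>carrier G. r g = z)"

text \<open>The scalar by which \<open>h s\<close> after \<open>h t\<close> differs from
  \<open>h (s + t)\<close>; associativity of composition makes it a 2-cocycle.\<close>

definition ratio :: "(real \<Rightarrow> complex \<Rightarrow> fmat) \<Rightarrow> real \<Rightarrow> real \<Rightarrow> complex"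
  where "ratio h s t = (SOME l. \<forall>z\<in>circle. h s (cis t * z) * h t z = l *\<^sub>c h (s + t) z)"

text \<open>The inverse of \<open>h\<close> composed with \<open>f\<close> lifts the identity, so
  Schur's lemma makes it a scalar. The conjugations between fibres come from the group itself, which
  moves 1 to every point.\<close>

lemma lifts_proportional:
  assumes tr: "transitive_irreducible" and h: "invertible_lift w h" and f: "lift w f" and w: "w \<in> circle"
    and cont: "continuous_on circle h" "continuous_on circle f"
  obtains l where "\<And>z. z \<in> circle \<Longrightarrow> f z = l *\<^sub>c h z"
proof -
  have irr: "irreducible_cocycle" "p 1 \<noteq> 0"
    using tr by (auto simp: transitive_irreducible_def)
  \<comment> \<open>An arbitrary choice, in general discontinuous; compactness of \<open>G\<close>
    and of the circle bounds the resulting maps \<open>c (k z) 1\<close>.\<close>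
  obtain k where k: "\<And>z. z \<in> circle \<Longrightarrow> k z \<in> carrier G \<and> r (k z) = z"
    using tr unfolding transitive_irreducible_def by metis
  let ?i = "lift_inv w h"
  let ?s = "\<lambda>z. ?i z * f z"
  have lh: "lift w h"
    using h by (simp add: invertible_lift_def)
  have s: "lift 1 ?s"
    unfolding lift_def
  proof (intro conjI ballI)
    fix z assume z: "z \<in> circle"
    show "?i z * f z \<in> fmats N" "?i z * f z * p z = ?i z * f z"
      using lift_inv[OF h w z] liftD[OF f z] by (simp_all add: mult.assoc)
    fix g assume g: "g \<in> carrier G"
    have "?i (r g * z) * f (r g * z) * c g z = ?i (r g * z) * c g (w * z) * f z"
      using liftD(4)[OF f z g] by (simp add: mult.assoc)
    then show "?i (r g * z) * f (r g * z) * c g z = c g (1 * z) * (?i z * f z)"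
      using lift_inv_equivariant[OF h w z g] by (simp add: mult.assoc)
  qed
  have "continuous_on circle ?i"
  proof (rule continuous_on_inverse_fmat[OF cont(1) p_cont])
    show "continuous_on circle (\<lambda>z. p (w * z))"
      using w by (intro continuous_p_comp) (auto intro!: continuous_intros circle_mult)
  qed (use lift_inv[OF h w] in blast)
  then have s_cont: "continuous_on circle ?s"
    using cont by (intro continuous_intros)
  obtain K where K: "\<And>g z. g \<in> carrier G \<Longrightarrow> z \<in> circle \<Longrightarrow> norm (c g z) \<le> K"
    using c_bounded by metis
  obtain l where l: "\<And>z. z \<in> circle \<Longrightarrow> ?s z = l *\<^sub>c p z"
  proof (rule irreducible_endomorphism_scalar[OF irr s s_cont,
        where u = "\<lambda>z. c (k z) 1" and v = "\<lambda>z. c (inv (k z)) z" and K = K])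
    fix z assume z: "z \<in> circle"
    have kz: "k z \<in> carrier G" "r (k z) = z"
      using k[OF z] by auto
    have "r (inv (k z)) * z = 1"
      using r_inv(1)[OF kz(1), of 1] kz(2) by simp
    then show "c (inv (k z)) z * c (k z) 1 = p 1" "c (k z) 1 * c (inv (k z)) z = p z"
      using c_inv[OF kz(1) one_circle] c_mult[OF kz(1) inv_closed[OF kz(1)] z] kz by (simp_all add: p_def)
    show "?s z * c (k z) 1 = c (k z) 1 * ?s 1"
      using liftD(4)[OF s one_circle kz(1)] kz(2) by simp
    show "norm (c (k z) 1) \<le> K" "norm (c (inv (k z)) z) \<le> K"
      using K kz(1) z by simp_all
  qed (rule that)
  have "f z = l *\<^sub>c h z" if z: "z \<in> circle" for z
  proof -
    have "f z = (h z * ?i z) * f z"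
      using lift_inv(3)[OF h w z] liftD(3)[OF f z] by simp
    also have "\<dots> = h z * ?s z"
      by (simp only: mult.assoc)
    finally show ?thesis
      using l[OF z] liftD(2)[OF lh z] by simp
  qed
  then show ?thesis
    using that by blast
qed

lemma continuous_lift_path_at:
  assumes "lift_path I h" "t \<in> I"
  shows "continuous_on circle (\<lambda>z. h t z)"
  by (rule continuous_lift_path_comp[OF assms(1)]) (use assms(2) in \<open>auto intro: continuous_intros\<close>)

lemma lift_path_nonzero:
  assumes "p 1 \<noteq> 0" "lift_path I h" "t \<in> I"
  shows "h t 1 \<noteq> 0"
  using lift_inv(2)[OF lift_pathD(2)[OF assms(2,3)] circle_cis one_circle] assms(1) by auto

lemma
  assumes tr: "transitive_irreducible" and h: "lift_path I h" and st: "s \<in> I" "t \<in> I" "s + t \<in> I"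
  shows ratio: "z \<in> circle \<Longrightarrow> h s (cis t * z) * h t z = ratio h s t *\<^sub>c h (s + t) z"
    and ratio_unique: "h s (cis t) * h t 1 = l *\<^sub>c h (s + t) 1 \<Longrightarrow> ratio h s t = l"
    and ratio_nonzero: "ratio h s t \<noteq> 0"
proof -
  have p1: "p 1 \<noteq> 0"
    using tr by (simp add: transitive_irreducible_def)
  have inv: "invertible_lift (cis s * cis t) (\<lambda>z. h s (cis t * z) * h t z)"
    by (intro invertible_lift_compose(1) lift_pathD(2)[OF h] st circle_cis)
  have "continuous_on circle (\<lambda>z. h s (cis t * z) * h t z)"
    using st by (intro continuous_on_mult continuous_lift_path_comp[OF h] continuous_intros) (auto intro!: circle_mult)
  then obtain a where "\<And>z. z \<in> circle \<Longrightarrow> h s (cis t * z) * h t z = a *\<^sub>c h (s + t) z"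
    using lifts_proportional[OF tr lift_pathD(2)[OF h st(3)] _ circle_cis continuous_lift_path_at[OF h st(3)],
        of "\<lambda>z. h s (cis t * z) * h t z"] inv unfolding invertible_lift_def cis_mult by metis
  then have "\<exists>l. \<forall>z\<in>circle. h s (cis t * z) * h t z = l *\<^sub>c h (s + t) z"
    by blast
  then have "\<forall>z\<in>circle. h s (cis t * z) * h t z = ratio h s t *\<^sub>c h (s + t) z"
    unfolding ratio_def by (rule someI_ex)
  then show eq: "z \<in> circle \<Longrightarrow> h s (cis t * z) * h t z = ratio h s t *\<^sub>c h (s + t) z" for z
    by blast
  show "ratio h s t = l" if "h s (cis t) * h t 1 = l *\<^sub>c h (s + t) 1"
    using eq[OF one_circle] that cscale_cancel[OF _ lift_path_nonzero[OF p1 h st(3)]] by simp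
  show "ratio h s t \<noteq> 0"
  proof
    assume "ratio h s t = 0"
    then have "h s (cis t * 1) * h t 1 = 0"
      using eq[OF one_circle] by simp
    then show False
      using lift_inv(2)[OF inv circle_mult[OF circle_cis circle_cis] one_circle] p1 by simp
  qed
qed

text \<open>Dividing by \<open>h (s + t)\<close> leaves the ratio times \<open>p 1\<close>, and any
  nonzero entry of \<open>p 1\<close> recovers it.\<close>

lemma continuous_ratio:
  fixes u v :: "'z::metric_space \<Rightarrow> real"
  assumes tr: "transitive_irreducible" and h: "lift_path I h"
    and uv: "continuous_on A u" "continuous_on A v" "\<And>x. x \<in> A \<Longrightarrow> u x \<in> I \<and> v x \<in> I \<and> u x + v x \<in> I"
  shows "continuous_on A (\<lambda>x. ratio h (u x) (v x))"
proof -
  obtain i j where ij: "entry (p 1) i j \<noteq> 0"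
    using tr fmat_eqI[of "p 1" 0] unfolding transitive_irreducible_def by auto
  let ?g = "\<lambda>x. entry (lift_inv (cis (u x + v x)) (h (u x + v x)) 1 * (h (u x) (cis (v x)) * h (v x) 1)) i j / entry (p 1) i j"
  have "continuous_on A ?g"
    using uv ij by (intro continuous_intros continuous_lift_path_comp[OF h] continuous_lift_inv_comp[OF h]
        continuous_on_cis) auto
  then show ?thesis
  proof (rule continuous_on_eq)
    fix x assume x: "x \<in> A"
    then have "h (u x) (cis (v x)) * h (v x) 1 = ratio h (u x) (v x) *\<^sub>c h (u x + v x) 1"
      using ratio[OF tr h _ _ _ one_circle, of "u x" "v x"] uv(3)[OF x] by simp
    then show "?g x = ratio h (u x) (v x)"
      using lift_inv(2)[OF lift_pathD(2)[OF h] circle_cis one_circle, of "u x + v x"] uv(3)[OF x] ij by simp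
  qed
qed

text \<open>The 2-cocycle is trivialised by averaging. Continuing the path by steps of length
  \<open>e\<close> makes the ratio periodic in its second argument, and for a small step its real
  part is positive, so the logarithm \<open>v\<close> satisfies the cocycle identity exactly.
  Integrating that identity over one period of its last variable gives
  \<open>v s t = w s + w t - w (s + t)\<close>, and \<open>exp (- w t)\<close> corrects the
  lifts.\<close>

lemma transitive_local_flow:
  assumes tr: "transitive_irreducible"
  obtains e f where "0 < e" "lift_path {0..e} f"
    "\<And>s t z. 0 \<le> s \<Longrightarrow> 0 \<le> t \<Longrightarrow> s + t \<le> e \<Longrightarrow> z \<in> circle \<Longrightarrow> f (s + t) z = f s (cis t * z) * f t z"
proof -
  obtain e0 f0 where e0: "0 < e0" and f0: "lift_path {0..e0} f0"
    by (rule local_lift_path)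
  define D where "D = {x :: real \<times> real. 0 \<le> fst x \<and> 0 \<le> snd x \<and> fst x + snd x \<le> e0}"
  have "continuous_on D (\<lambda>x. ratio f0 (fst x) (snd x))"
    by (rule continuous_ratio[OF tr f0]) (auto simp: D_def intro: continuous_intros)
  moreover have "(0, 0) \<in> D"
    using e0 by (simp add: D_def)
  ultimately obtain d where d: "0 < d" "\<And>x. x \<in> D \<Longrightarrow> dist x (0, 0) < d \<Longrightarrow>
      dist (ratio f0 (fst x) (snd x)) (ratio f0 0 0) < 1 / 3"
    unfolding continuous_on_iff by (metis fst_conv snd_conv zero_less_divide_1_iff zero_less_numeral)
  have r0: "ratio f0 0 0 = 1"
    using e0 lift_pathD(4)[OF f0] by (intro ratio_unique[OF tr f0]) auto
  \<comment> \<open>\<open>e0 / 2\<close> keeps \<open>s + t\<close> in the domain of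
    \<open>f0\<close> when \<open>s\<close> and \<open>t\<close> are at most \<open>e\<close>;
    \<open>d / 3\<close> keeps the pair \<open>(s, t)\<close> within \<open>d\<close> of the origin,
    where the ratio is close to 1.\<close>
  define e where "e = min (e0 / 2) (d / 3)"
  have e: "0 < e" "2 * e \<le> e0" "2 * e < d"
    using e0 d(1) by (auto simp: e_def)
  have near: "cmod (ratio f0 s t - 1) < 1 / 3" if "0 \<le> s" "s \<le> e" "0 \<le> t" "t \<le> e" for s t
  proof -
    have "norm (s, t) \<le> norm s + norm t"
      by (rule norm_Pair_le)
    then have "dist (s, t) (0, 0) < d"
      using that e(3) by (simp add: dist_norm flip: zero_prod_def)
    then show ?thesis
      using d(2)[of "(s, t)"] that e(2) by (simp add: D_def r0 dist_norm)
  qed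
  have "lift_path {0..e} f0"
    by (rule lift_path_subset[OF f0]) (use e in auto)
  then obtain h where h: "lift_path {0..} h"
    and hf: "\<And>t z. t \<in> {0..e} \<Longrightarrow> z \<in> circle \<Longrightarrow> h t z = f0 t z"
    and h_step0: "\<And>t z. 0 \<le> t \<Longrightarrow> z \<in> circle \<Longrightarrow> h (t + e) z = h t (cis e * z) * f0 e z"
    using lift_path_extend[OF e(1)] by metis
  have h_step: "h (t + e) z = h t (cis e * z) * h e z" if "0 \<le> t" "z \<in> circle" for t z
    using h_step0[OF that] hf[of e z] that e(1) by simp
  let ?u = "ratio h"
  have u: "h s (cis t * z) * h t z = ?u s t *\<^sub>c h (s + t) z" if "0 \<le> s" "0 \<le> t" "z \<in> circle" for s t z
    using ratio[OF tr h _ _ _ that(3)] that by simp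
  have u_uniq: "?u s t = l" if "0 \<le> s" "0 \<le> t" "h s (cis t) * h t 1 = l *\<^sub>c h (s + t) 1" for s t l
    using ratio_unique[OF tr h _ _ _ that(3)] that by simp
  have p1: "p 1 \<noteq> 0"
    using tr by (simp add: transitive_irreducible_def)
  \<comment> \<open>The last step \<open>e\<close> splits off exactly from both \<open>h t\<close>
    and \<open>h (s + t)\<close>, so it does not contribute to the ratio.\<close>
  have per: "?u s (t + e) = ?u s t" if "0 \<le> s" "0 \<le> t" for s t
  proof (rule u_uniq)
    have "h s (cis (t + e)) * h (t + e) 1 = (h s (cis t * cis e) * h t (cis e)) * h e 1"
      using h_step[of t 1] that by (simp add: cis_mult mult.assoc)
    also have "\<dots> = ?u s t *\<^sub>c (h (s + t) (cis e) * h e 1)"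
      using u[of s t "cis e"] that by simp
    also have "h (s + t) (cis e) * h e 1 = h (s + (t + e)) 1"
      using h_step[of "s + t" 1] that by (simp add: add.assoc)
    finally show "h s (cis (t + e)) * h (t + e) 1 = ?u s t *\<^sub>c h (s + (t + e)) 1" .
  qed (use that e in auto)
  have pos1: "0 < Re (?u s t)" if st: "0 \<le> s" "s \<le> e" "0 \<le> t" "t \<le> e" for s t
  proof -
    have f0_ratio: "f0 a (cis b) * f0 b 1 = ratio f0 a b *\<^sub>c f0 (a + b) 1"
      if "0 \<le> a" "a \<le> e" "0 \<le> b" "b \<le> e" for a b
      using ratio[OF tr f0 _ _ _ one_circle, of a b] that e by simp
    have hf_cis: "h a (cis b) = f0 a (cis b)" "h a 1 = f0 a 1" if "0 \<le> a" "a \<le> e" for a b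
      using hf that by simp_all
    show ?thesis
    proof (cases "s + t \<le> e")
      case True
      have "?u s t = ratio f0 s t"
        using f0_ratio[OF st] hf_cis st True by (intro u_uniq) auto
      moreover have "\<bar>Re (ratio f0 s t - 1)\<bar> < 1 / 3"
        using near[OF st] abs_Re_le_cmod order_le_less_trans by blast
      ultimately show ?thesis
        by (auto simp: abs_if split: if_splits)
    next
      case False
      \<comment> \<open>Past \<open>e\<close>, the continued path is \<open>f0 q\<close> after
        \<open>f0 e\<close>, which differs from \<open>f0 (s + t)\<close> by a ratio of
        \<open>f0\<close>; so the ratio of \<open>h\<close> is a quotient of two ratios of
        \<open>f0\<close>.\<close>
      define q where "q = s + t - e"
      have q: "0 \<le> q" "q \<le> e" "q + e = s + t"
        using False st by (auto simp: q_def)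
      let ?a = "ratio f0 s t" and ?b = "ratio f0 q e"
      have b0: "?b \<noteq> 0"
        using ratio_nonzero[OF tr f0, of q e] q e st by simp
      have "h (s + t) 1 = ?b *\<^sub>c f0 (s + t) 1"
        using h_step0[of q 1] f0_ratio[of q e] q hf_cis e(1) by simp
      then have "h s (cis t) * h t 1 = (?a / ?b) *\<^sub>c h (s + t) 1"
        using f0_ratio[OF st] hf_cis st b0 by simp
      then have uab: "?u s t = ?a / ?b"
        using st by (intro u_uniq)
      have ab: "cmod (?a - 1) < 1 / 3" "cmod (?b - 1) < 1 / 3"
        using near st q e by auto
      have bounds: "2 / 3 < Re x \<and> \<bar>Im x\<bar> < 1 / 3" if "cmod (x - 1) < 1 / 3" for x
        using that abs_Re_le_cmod[of "x - 1"] abs_Im_le_cmod[of "x - 1"] by auto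
      \<comment> \<open>Two numbers within 1/3 of 1 have real parts above 2/3 and imaginary parts
        below 1/3; since 4/9 exceeds 1/9, their quotient has positive real part.\<close>
      have "4 / 9 < Re ?a * Re ?b"
        using bounds[OF ab(1)] bounds[OF ab(2)] mult_strict_mono[of "2/3" "Re ?a" "2/3" "Re ?b"] by simp
      moreover have "\<bar>Im ?a * Im ?b\<bar> \<le> 1 / 3 * (1 / 3)"
        using bounds[OF ab(1)] bounds[OF ab(2)] unfolding abs_mult by (intro mult_mono) auto
      ultimately have "0 < Re ?a * Re ?b + Im ?a * Im ?b"
        by linarith
      then show ?thesis
        using b0 unfolding uab Re_divide by (simp add: complex_eq_iff sum_power2_gt_zero_iff)
    qed
  qed
  have pos: "0 < Re (?u s t)" if s: "0 \<le> s" "s \<le> e" and t: "0 \<le> t" for s t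
  proof -
    have step: "0 < Re (?u s (t + real k * e))" if "0 \<le> t" "t \<le> e" for t k
    proof (induction k)
      case (Suc k)
      have "?u s (t + real (Suc k) * e) = ?u s ((t + real k * e) + e)"
        by (simp add: algebra_simps)
      then show ?case
        using per[of s "t + real k * e"] Suc s that e(1) by simp
    qed (use pos1[OF s that] in simp)
    define k where "k = nat \<lfloor>t / e\<rfloor>"
    have "0 \<le> t / e"
      using t e by simp
    then have "real k \<le> t / e" "t / e < real k + 1"
      unfolding k_def by linarith+
    then have "0 \<le> t - real k * e" "t - real k * e \<le> e"
      using e(1) by (simp_all add: field_simps)
    from step[OF this, of k] show ?thesis
      by simp
  qed
  have cocycle: "?u s t * ?u (s + t) x = ?u t x * ?u s (t + x)" if "0 \<le> s" "0 \<le> t" "0 \<le> x" for s t x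
  proof -
    have "h s (cis t * cis x) * h t (cis x) * h x 1 = (?u s t * ?u (s + t) x) *\<^sub>c h (s + t + x) 1"
      using u[of s t "cis x"] u[of "s + t" x 1] that by simp
    moreover have "h s (cis t * cis x) * (h t (cis x) * h x 1) = (?u t x * ?u s (t + x)) *\<^sub>c h (s + (t + x)) 1"
      using u[of t x 1] u[of s "t + x" 1] that by (simp add: cis_mult)
    ultimately have "(?u s t * ?u (s + t) x) *\<^sub>c h (s + t + x) 1 = (?u t x * ?u s (t + x)) *\<^sub>c h (s + t + x) 1"
      by (simp add: mult.assoc add.assoc)
    then show ?thesis
      by (rule cscale_cancel) (use lift_path_nonzero[OF p1 h] that in auto)
  qed
  define v where "v = (\<lambda>s t. Ln (?u s t))"
  have u_ne: "?u s t \<noteq> 0" if "0 \<le> s" "0 \<le> t" for s t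
    using ratio_nonzero[OF tr h] that by simp
  have exp_v: "exp (v s t) = ?u s t" if "0 \<le> s" "0 \<le> t" for s t
    using u_ne[OF that] by (simp add: v_def)
  have im_v: "\<bar>Im (v s t)\<bar> < pi / 2" if "0 \<le> s" "s \<le> e" "0 \<le> t" for s t
    unfolding v_def Re_Ln_pos_lt[OF u_ne[OF that(1,3)]] by (rule pos[OF that])
  have v_cocycle: "v s t + v (s + t) x = v t x + v s (t + x)"
    if "0 \<le> s" "0 \<le> t" "s + t \<le> e" "0 \<le> x" for s t x
  proof (rule exp_complex_eqI)
    \<comment> \<open>Four imaginary parts below \<open>pi / 2\<close> leave no room for a multiple
      of \<open>2 * pi\<close> between the two sides.\<close>
    show "\<bar>Im (v s t + v (s + t) x) - Im (v t x + v s (t + x))\<bar> < 2 * pi"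
      using im_v[of s t] im_v[of "s + t" x] im_v[of t x] im_v[of s "t + x"] that by simp
    show "exp (v s t + v (s + t) x) = exp (v t x + v s (t + x))"
      using cocycle[of s t x] that by (simp add: exp_add exp_v)
  qed
  have v_per: "v s (t + e) = v s t" if "0 \<le> s" "0 \<le> t" for s t
    using per[OF that] by (simp add: v_def)
  have v_cont: "continuous_on A (\<lambda>x. v (a x) (b x))"
    if "continuous_on A a" "continuous_on A b" "\<And>x. x \<in> A \<Longrightarrow> 0 \<le> a x \<and> a x \<le> e \<and> 0 \<le> b x"
    for A and a b :: "'z::metric_space \<Rightarrow> real"
    unfolding v_def
  proof (rule continuous_on_Ln')
    show "continuous_on A (\<lambda>x. ?u (a x) (b x))"
      using that by (intro continuous_ratio[OF tr h]) auto
    fix x assume "x \<in> A"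
    then show "?u (a x) (b x) \<notin> \<real>\<^sub>\<le>\<^sub>0"
      using pos[of "a x" "b x"] that(3)[of x] by (auto simp: complex_nonpos_Reals_iff)
  qed
  \<comment> \<open>The mean of \<open>v s\<close> over one period. By periodicity the shift by
    \<open>t\<close> in \<open>v s (t + x)\<close> does not change it.\<close>
  define w where "w = (\<lambda>s. (1 / e) *\<^sub>R integral {0..e} (v s))"
  have v_int: "v s integrable_on {0..e}" if "0 \<le> s" "s \<le> e" for s
  proof -
    have "continuous_on {0..e} (\<lambda>x. v s x)"
      by (rule v_cont[of "{0..e}" "\<lambda>x. s" "\<lambda>x. x"]) (use that in \<open>auto intro: continuous_intros\<close>)
    then show ?thesis
      by (rule integrable_continuous_real)
  qed
  have v_w: "v s t + w (s + t) = w t + w s" if st: "0 \<le> s" "0 \<le> t" "s + t \<le> e" for s t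
  proof -
    have "integral {0..e} (\<lambda>x. v s t + v (s + t) x) = integral {0..e} (\<lambda>x. v t x + v s (t + x))"
      using st by (intro integral_cong v_cocycle) auto
    moreover have "integral {0..e} (\<lambda>x. v s t + v (s + t) x) = e *\<^sub>R v s t + integral {0..e} (v (s + t))"
      using v_int[of "s + t"] st e(1) by (subst integral_add) auto
    moreover have "integral {0..e} (\<lambda>x. v t x + v s (t + x)) = integral {0..e} (v t) + integral {0..e} (\<lambda>x. v s (t + x))"
    proof (rule integral_add)
      have "continuous_on {0..e} (\<lambda>x. v s (t + x))"
        by (rule v_cont[of "{0..e}" "\<lambda>x. s" "\<lambda>x. t + x"]) (use st in \<open>auto intro: continuous_intros\<close>)
      then show "(\<lambda>x. v s (t + x)) integrable_on {0..e}"
        by (rule integrable_continuous_real)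
    qed (use v_int[of t] st in auto)
    moreover have "integral {0..e} (\<lambda>x. v s (t + x)) = integral {0..e} (v s)"
    proof (rule periodic_integral_shift)
      show "continuous_on {0..} (\<lambda>x. v s x)"
        by (rule v_cont[of "{0..}" "\<lambda>x. s" "\<lambda>x. x"]) (use st in \<open>auto intro: continuous_intros\<close>)
    qed (use v_per st in auto)
    ultimately have "(1 / e) *\<^sub>R (e *\<^sub>R v s t + integral {0..e} (v (s + t))) =
        (1 / e) *\<^sub>R (integral {0..e} (v t) + integral {0..e} (v s))"
      by simp
    then show ?thesis
      using e(1) by (simp add: w_def scaleR_add_right)
  qed
  have w0: "w 0 = 0"
  proof -
    have "v 0 x = 0" if "0 \<le> x" for x
    proof -
      have "?u 0 x = 1"
        using lift_pathD(4)[OF h, of "cis x"] liftD(3)[OF lift_pathD(3)[OF h, of x] one_circle] that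
        by (intro u_uniq) auto
      then show ?thesis
        by (simp add: v_def)
    qed
    then have "integral {0..e} (v 0) = integral {0..e} (\<lambda>x. 0)"
      by (intro integral_cong) auto
    then show ?thesis
      by (simp add: w_def)
  qed
  have w_cont: "continuous_on {0..e} w"
  proof -
    have "continuous_on ({0..e} \<times> cbox 0 e) (\<lambda>(s, x). v s x)"
      unfolding case_prod_unfold by (intro v_cont continuous_intros) auto
    then have "continuous_on {0..e} (\<lambda>s. integral (cbox 0 e) (v s))"
      by (rule integral_continuous_on_param)
    then show ?thesis
      unfolding w_def by (intro continuous_intros) simp
  qed
  show ?thesis
  proof (rule that[OF e(1)])
    show "lift_path {0..e} (\<lambda>t z. exp (- w t) *\<^sub>c h t z)"
      using w_cont w0 lift_path_subset[OF h] by (intro lift_path_cscale continuous_intros) auto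
    fix s t z assume st: "0 \<le> s" "0 \<le> t" "s + t \<le> e" and z: "z \<in> circle"
    have "w (s + t) = w t + w s - v s t"
      using v_w[OF st] by (simp add: algebra_simps)
    then have "exp (- w (s + t)) = exp (- w s) * exp (- w t) * exp (v s t)"
      unfolding exp_add[symmetric] by (intro arg_cong[of _ _ exp]) simp
    then show "exp (- w (s + t)) *\<^sub>c h (s + t) z = exp (- w s) *\<^sub>c h s (cis t * z) * exp (- w t) *\<^sub>c h t z"
      using u[OF st(1,2) z] exp_v[OF st(1,2)] by (simp add: mult_ac)
  qed
qed

text \<open>The continuation by steps of length \<open>e\<close> is additive for all times. The law
  is extended from sums up to \<open>e\<close> to two times up to \<open>e\<close>, then to an
  arbitrary second time, and last to an arbitrary first time, by splitting off whole steps.\<close>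

lemma transitive_flow:
  assumes tr: "transitive_irreducible"
  obtains f where "flow f"
proof -
  obtain e f0 where e: "0 < e" and f0: "lift_path {0..e} f0"
    and loc0: "\<And>s t z. 0 \<le> s \<Longrightarrow> 0 \<le> t \<Longrightarrow> s + t \<le> e \<Longrightarrow> z \<in> circle \<Longrightarrow> f0 (s + t) z = f0 s (cis t * z) * f0 t z"
    using transitive_local_flow[OF tr] by metis
  obtain f where f: "lift_path {0..} f" and ff0: "\<And>t z. t \<in> {0..e} \<Longrightarrow> z \<in> circle \<Longrightarrow> f t z = f0 t z"
    and f_step0: "\<And>t z. 0 \<le> t \<Longrightarrow> z \<in> circle \<Longrightarrow> f (t + e) z = f t (cis e * z) * f0 e z"
    using lift_path_extend[OF e f0] by metis
  have loc: "f (s + t) z = f s (cis t * z) * f t z" if "0 \<le> s" "0 \<le> t" "s + t \<le> e" "z \<in> circle" for s t z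
    using loc0[OF that] ff0 that by simp
  have f_step: "f (t + e) z = f t (cis e * z) * f e z" if "0 \<le> t" "z \<in> circle" for t z
    using f_step0[OF that] ff0[of e z] that e by simp
  have loc2: "f (s + t) z = f s (cis t * z) * f t z" if st: "0 \<le> s" "s \<le> e" "0 \<le> t" "t \<le> e" and z: "z \<in> circle" for s t z
  proof (cases "s + t \<le> e")
    case False
    \<comment> \<open>\<open>s\<close> is cut into \<open>q\<close> and \<open>e - t\<close>, so
      that \<open>e - t\<close> and \<open>t\<close> combine to one full step, which splits off
      exactly.\<close>
    define q where "q = s + t - e"
    have q: "0 \<le> q" "s = q + (e - t)" "s + t = q + e" "q \<le> e"
      using False st by (auto simp: q_def)
    have "f (q + (e - t)) (cis t * z) = f q (cis (e - t) * (cis t * z)) * f (e - t) (cis t * z)"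
      using q st z by (intro loc) auto
    then have "f s (cis t * z) * f t z = f q (cis (e - t) * (cis t * z)) * f (e - t) (cis t * z) * f t z"
      unfolding q(2)[symmetric] by simp
    also have "\<dots> = f q (cis e * z) * (f (e - t) (cis t * z) * f t z)"
      by (simp add: mult.assoc cis_mult flip: mult.assoc[of "cis _" "cis _"])
    also have "f (e - t) (cis t * z) * f t z = f e z"
      using loc[of "e - t" t z] st z by simp
    also have "f q (cis e * z) * f e z = f (s + t) z"
      using f_step[OF q(1) z] q(3) by simp
    finally show ?thesis
      by simp
  qed (use loc st z in auto)
  have mult: "f (t + real k * e) z = f t (cis (real k * e) * z) * f (real k * e) z" if "0 \<le> t" "z \<in> circle" for t z k
    using lift_path_multiples[OF e f f_step that] by blast
  have decomp: "\<exists>k q. t = q + real k * e \<and> 0 \<le> q \<and> q \<le> e" if "0 \<le> t" for t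
  proof (intro exI[of _ "nat \<lfloor>t / e\<rfloor>"] exI[of _ "t - real (nat \<lfloor>t / e\<rfloor>) * e"] conjI)
    have "0 \<le> t / e"
      using that e by simp
    then have "real (nat \<lfloor>t / e\<rfloor>) \<le> t / e" "t / e < real (nat \<lfloor>t / e\<rfloor>) + 1"
      by linarith+
    then show "0 \<le> t - real (nat \<lfloor>t / e\<rfloor>) * e" "t - real (nat \<lfloor>t / e\<rfloor>) * e \<le> e"
      using e by (simp_all add: field_simps)
  qed simp
  have half: "f (s + t) z = f s (cis t * z) * f t z" if s: "0 \<le> s" "s \<le> e" and t: "0 \<le> t" and z: "z \<in> circle" for s t z
  proof -
    obtain k q where q: "t = q + real k * e" "0 \<le> q" "q \<le> e"
      using decomp[OF t] by blast
    let ?w = "cis (real k * e)"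
    have "f (s + t) z = f ((s + q) + real k * e) z"
      using q by (simp add: add.assoc)
    also have "\<dots> = f (s + q) (?w * z) * f (real k * e) z"
      using mult s q z by simp
    also have "f (s + q) (?w * z) = f s (cis q * (?w * z)) * f q (?w * z)"
      using loc2 s q z by simp
    also have "cis q * (?w * z) = cis t * z"
      by (simp add: q(1) cis_mult flip: mult.assoc)
    also have "f s (cis t * z) * f q (?w * z) * f (real k * e) z = f s (cis t * z) * f t z"
      using mult[OF q(2) z] q(1) by (simp add: mult.assoc)
    finally show ?thesis .
  qed
  have multi: "f (q + real k * e + t) z = f (q + real k * e) (cis t * z) * f t z"
    if "0 \<le> q" "q \<le> e" "0 \<le> t" "z \<in> circle" for q k t z
    using that(3,4)
  proof (induction k arbitrary: t z)
    case 0
    then show ?case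
      using half that by simp
  next
    case (Suc k)
    have "f (q + real (Suc k) * e + t) z = f (q + real k * e + (e + t)) z"
      by (simp add: algebra_simps)
    also have "\<dots> = f (q + real k * e) (cis (e + t) * z) * f (e + t) z"
      using Suc e by simp
    also have "f (e + t) z = f e (cis t * z) * f t z"
      using half Suc.prems e by simp
    also have "f (q + real k * e) (cis (e + t) * z) * (f e (cis t * z) * f t z) =
        f (q + real k * e) (cis e * (cis t * z)) * f e (cis t * z) * f t z"
      by (simp add: mult.assoc flip: cis_mult)
    also have "f (q + real k * e) (cis e * (cis t * z)) * f e (cis t * z) = f (q + real k * e + e) (cis t * z)"
      using f_step[of "q + real k * e" "cis t * z"] Suc.prems that e by simp
    finally show ?case
      by (simp add: algebra_simps)
  qed
  have "flow f"
    unfolding flow_def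
  proof (intro conjI allI impI ballI f)
    fix s t :: real and z assume "0 \<le> s" "0 \<le> t" "z \<in> circle"
    then show "f (s + t) z = f s (cis t * z) * f t z"
      using decomp[of s] multi by blast
  qed
  then show ?thesis
    using that by blast
qed

end

lemma cis_uniformly_continuous:
  assumes "0 < e"
  obtains d where "0 < d" "\<And>a b. \<bar>a - b\<bar> < d \<Longrightarrow> dist (cis a) (cis b) < e"
proof -
  have "isCont cis 0"
    using continuous_on_cis[OF continuous_on_id, of UNIV] by (simp add: continuous_on_eq_continuous_at)
  then obtain d where d: "0 < d" "\<And>t. dist t 0 < d \<Longrightarrow> dist (cis t) (cis 0) < e"
    using assms unfolding continuous_at_eps_delta by metis
  have "dist (cis a) (cis b) < e" if "\<bar>a - b\<bar> < d" for a b
  proof -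
    have "cis a - cis b = cis b * (cis (a - b) - 1)"
      by (simp add: right_diff_distrib cis_mult)
    then have "dist (cis a) (cis b) = dist (cis (a - b)) (cis 0)"
      by (simp add: dist_norm norm_mult)
    then show ?thesis
      using d(2)[of "a - b"] that by (simp add: dist_norm)
  qed
  then show ?thesis
    using that d(1) by blast
qed

text \<open>Stated outside the locale because the induction on summands varies \<open>c\<close>.
  Invertibility is implicit: for \<open>t\<close> up to \<open>2 * pi\<close>, the flow over
  \<open>2 * pi - t\<close> undoes the flow over \<open>t\<close>.\<close>

definition periodic_flow ::
  "('g, 'm) monoid_scheme \<Rightarrow> nat \<Rightarrow> ('g \<Rightarrow> complex) \<Rightarrow> ('g \<Rightarrow> complex \<Rightarrow> fmat) \<Rightarrow>
    (real \<Rightarrow> complex \<Rightarrow> fmat) \<Rightarrow> bool"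
  where "periodic_flow G N r c h \<longleftrightarrow>
    continuous_on ({0..} \<times> circle) (\<lambda>(t, z). h t z) \<and>
    (\<forall>t\<ge>0. \<forall>z\<in>circle. h t z \<in> fmats N) \<and>
    (\<forall>z\<in>circle. h 0 z = c \<one>\<^bsub>G\<^esub> z \<and> h (2 * pi) z = c \<one>\<^bsub>G\<^esub> z) \<and>
    (\<forall>s\<ge>0. \<forall>t\<ge>0. \<forall>z\<in>circle. h (s + t) z = h s (cis t * z) * h t z) \<and>
    (\<forall>g\<in>carrier G. \<forall>t\<ge>0. \<forall>z\<in>circle. h t (r g * z) * c g z = c g (cis t * z) * h t z)"

lemma periodic_flowD:
  assumes "periodic_flow G N r c h" "z \<in> circle"
  shows "0 \<le> t \<Longrightarrow> h t z \<in> fmats N" "h 0 z = c \<one>\<^bsub>G\<^esub> z" "h (2 * pi) z = c \<one>\<^bsub>G\<^esub> z"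
    "0 \<le> s \<Longrightarrow> 0 \<le> t \<Longrightarrow> h (s + t) z = h s (cis t * z) * h t z"
    "g \<in> carrier G \<Longrightarrow> 0 \<le> t \<Longrightarrow> h t (r g * z) * c g z = c g (cis t * z) * h t z"
  using assms unfolding periodic_flow_def by blast+

section \<open>Finite or full image, and splitting into irreducible cocycles\<close>

context circle_cocycle
begin

text \<open>The image is a compact subgroup of the circle. If it is infinite, it has a limit point,
  hence contains rotations by arbitrarily small nonzero angles, whose powers are dense; being
  closed, it is everything.\<close>

lemma rotation_image_dichotomy:
  "(\<exists>m>0. \<forall>g\<in>carrier G. r g ^ m = 1) \<or> (\<forall>z\<in>circle. \<exists>g\<in>carrier G. r g = z)"
proof -
  let ?R = "r ` carrier G"
  have R_mult: "x * y \<in> ?R" if "x \<in> ?R" "y \<in> ?R" for x y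
    using that r_mult by (metis (no_types, opaque_lifting) imageE image_eqI m_closed)
  have R_one: "1 \<in> ?R"
    using r_one by (metis image_eqI one_closed)
  have R_pow: "x ^ k \<in> ?R" if "x \<in> ?R" for x k
    using that R_mult R_one by (induction k) auto
  have R_circle: "x \<in> circle" if "x \<in> ?R" for x
    using that by auto
  have R_inv: "inverse x \<in> ?R" if x: "x \<in> ?R" for x
  proof -
    obtain g where g: "g \<in> carrier G" "x = r g"
      using x by (auto elim: imageE)
    have "r g * r (inv g) = 1"
      using r_inv(2)[OF g(1), of 1] by simp
    then have "inverse x = r (inv g)"
      unfolding g(2) by (rule inverse_unique)
    then show ?thesis
      using g(1) by auto
  qed
  show ?thesis
  proof (cases "finite ?R")
    case True
    define n where "n = card ?R"
    \<comment> \<open>Two of the first \<open>n + 1\<close> powers coincide, so the order of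
      \<open>r g\<close> is at most \<open>n\<close> and divides the factorial.\<close>
    have "r g ^ fact n = 1" if g: "g \<in> carrier G" for g
    proof -
      have x: "r g \<in> ?R" "r g \<noteq> 0"
        using g r_norm[OF g] by auto
      have "\<not> inj_on (\<lambda>k. r g ^ k) {..n}"
      proof
        assume "inj_on (\<lambda>k. r g ^ k) {..n}"
        then have "card {..n} \<le> card ?R"
          using R_pow[OF x(1)] True by (intro card_inj_on_le) auto
        then show False
          by (simp add: n_def)
      qed
      then obtain i j where ij: "i < j" "j \<le> n" "r g ^ i = r g ^ j"
        unfolding inj_on_def by (metis atMost_iff linorder_neq_iff)
      have "r g ^ i * r g ^ (j - i) = r g ^ j"
        using ij(1) by (simp flip: power_add)
      then have "r g ^ i * r g ^ (j - i) = r g ^ i * 1"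
        using ij(3) by simp
      then have "r g ^ (j - i) = 1"
        using x(2) by (metis mult_left_cancel power_not_zero)
      moreover have "j - i dvd fact n"
        using ij by (intro dvd_fact) auto
      ultimately show ?thesis
        by (metis dvdE power_mult power_one)
    qed
    then show ?thesis
      by (intro disjI1 exI[of _ "fact n"]) (auto simp: fact_gt_zero)
  next
    case False
    have "compactin euclidean (r ` topspace T)"
      using image_compactin r_cont compact_T unfolding compact_space_def by blast
    then have comp: "compact ?R"
      by (simp add: topspace_T)
    have dense: "\<exists>y\<in>?R. dist y z < e" if z: "z \<in> circle" and e: "0 < e" for z e
    proof -
      obtain d where d: "0 < d" "\<And>a b. \<bar>a - b\<bar> < d \<Longrightarrow> dist (cis a) (cis b) < e"
        using cis_uniformly_continuous[OF e] by blast
      have "isCont Arg 1"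
        by (rule continuous_at_Arg) (simp add: complex_nonpos_Reals_iff)
      then obtain d' where d': "0 < d'" "\<And>x. dist x 1 < d' \<Longrightarrow> dist (Arg x) (Arg 1) < d"
        using d(1) unfolding continuous_at_eps_delta by metis
      obtain l where l: "l islimpt ?R"
        using comp False unfolding compact_eq_Bolzano_Weierstrass by blast
      obtain x where x: "x \<in> ?R" "x \<noteq> l" "dist x l < d' / 2"
        using l d'(1) unfolding islimpt_approachable by (meson half_gt_zero)
      obtain y where y: "y \<in> ?R" "y \<noteq> l" "dist y l < min (d' / 2) (dist x l)"
        using l d'(1) x(2) unfolding islimpt_approachable by (metis half_gt_zero min_less_iff_conj zero_less_dist_iff)
      have "dist y l < d' / 2" "dist y l < dist x l"
        using y(3) by auto
      then have "x \<noteq> y" "dist x y < d'"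
        using x(3) dist_triangle2[of x y l] by auto
      \<comment> \<open>The quotient of two distinct elements near the limit point is a nontrivial
        rotation near 1.\<close>
      define u where "u = x * inverse y"
      have u: "u \<in> ?R" "u \<noteq> 1" "u \<in> circle"
      proof -
        show "u \<in> ?R"
          unfolding u_def by (rule R_mult[OF x(1) R_inv[OF y(1)]])
        then show "u \<in> circle"
          by (rule R_circle)
        have "y \<noteq> 0"
          using R_circle[OF y(1)] by (auto simp: mem_sphere_0)
        then show "u \<noteq> 1"
          using \<open>x \<noteq> y\<close> by (simp add: u_def field_simps)
      qed
      have "dist u 1 < d'"
      proof -
        have y1: "cmod y = 1" "y \<noteq> 0"
          using R_circle[OF y(1)] by (auto simp: mem_sphere_0)
        then have "u - 1 = (x - y) * inverse y"
          by (simp add: u_def left_diff_distrib)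
        then have "cmod (u - 1) = cmod (x - y)"
          using y1 by (simp add: norm_mult norm_inverse)
        then show ?thesis
          using \<open>dist x y < d'\<close> by (simp add: dist_norm)
      qed
      then have arg_u: "\<bar>Arg u\<bar> < d"
        using d'(2)[of u] by (simp add: dist_norm)
      have u_cis: "u = cis (Arg u)"
        using u(3) cis_Arg[of u] by (force simp: mem_sphere_0 sgn_div_norm)
      then have "Arg u \<noteq> 0"
        using u(2) by (metis cis_zero)
      define a where "a = \<bar>Arg u\<bar>"
      have a: "0 < a" "a < d" "cis a \<in> ?R"
      proof -
        have "cis (- Arg u) = inverse u"
          using u_cis by (metis cis_inverse)
        then show "cis a \<in> ?R"
          using u(1) R_inv[OF u(1)] u_cis by (simp add: a_def abs_if)
      qed (use arg_u \<open>Arg u \<noteq> 0\<close> in \<open>simp_all add: a_def\<close>)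
      \<comment> \<open>The largest number of steps of angle \<open>a\<close> that does not pass
        \<open>z\<close>; the remaining gap is below \<open>a\<close>, hence below
        \<open>d\<close>.\<close>
      define k where "k = nat \<lfloor>Arg2pi z / a\<rfloor>"
      have "0 \<le> Arg2pi z / a"
        using Arg2pi[of z] a(1) by simp
      then have "real k \<le> Arg2pi z / a" "Arg2pi z / a < real k + 1"
        unfolding k_def by linarith+
      then have "0 \<le> Arg2pi z - real k * a" "Arg2pi z - real k * a < a"
        using a(1) by (simp_all add: field_simps)
      then have "dist (cis (real k * a)) (cis (Arg2pi z)) < e"
        using a(2) by (intro d(2)) simp
      moreover have "cis (real k * a) \<in> ?R"
        using R_pow[OF a(3), of k] by (simp add: Complex.DeMoivre)
      ultimately show ?thesis
        using cis_Arg2pi_circle[OF z] by metis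
    qed
    have "z \<in> ?R" if "z \<in> circle" for z
    proof -
      have "z \<in> closure ?R"
        using dense[OF that] by (simp add: closure_approachable)
      then show ?thesis
        using comp by (simp add: compact_imp_closed)
    qed
    then show ?thesis
      by (intro disjI2) force
  qed
qed

lemma periodic_flow_of_flow:
  assumes "flow h" "\<And>z. z \<in> circle \<Longrightarrow> h (2 * pi) z = p z"
  shows "periodic_flow G N r c h"
proof -
  have h: "lift_path {0..} h"
    using assms(1) by (simp add: flow_def)
  show ?thesis
    unfolding periodic_flow_def
  proof (intro conjI allI impI ballI)
    show "continuous_on ({0..} \<times> circle) (\<lambda>(t, z). h t z)"
      by (rule lift_pathD(1)[OF h])
    show "h t z \<in> fmats N" if "0 \<le> t" "z \<in> circle" for t z
      using liftD(1)[OF lift_pathD(3)[OF h]] that by simp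
    show "h 0 z = c \<one> z" "h (2 * pi) z = c \<one> z" if "z \<in> circle" for z
      using lift_pathD(4)[OF h that] assms(2)[OF that] by (simp_all add: p_def)
    show "h (s + t) z = h s (cis t * z) * h t z" if "0 \<le> s" "0 \<le> t" "z \<in> circle" for s t z
      using assms(1) that by (simp add: flow_def)
    show "h t (r g * z) * c g z = c g (cis t * z) * h t z" if "g \<in> carrier G" "0 \<le> t" "z \<in> circle" for g t z
      using liftD(4)[OF lift_pathD(3)[OF h]] that by simp
  qed
qed

text \<open>Schur's lemma presupposes a nonzero fibre. If the fibre over 1 is zero, the invertible
  lifts starting at 1 show that all fibres are, and the zero flow will do.\<close>

lemma irreducible_periodic_flow:
  assumes irr: "irreducible_cocycle"
  obtains h where "periodic_flow G N r c h"
proof (cases "p 1 = 0")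
  case True
  obtain e h where h: "lift_path {0..} h"
    using extended_lift_path by (metis order_refl)
  have pz: "p z = 0" if "z \<in> circle" for z
  proof -
    define t where "t = Arg2pi z"
    have t: "t \<in> {0..}" "cis t = z"
      using Arg2pi[of z] cis_Arg2pi_circle[OF that] by (auto simp: t_def)
    have "h t 1 = 0"
      using liftD(2)[OF lift_pathD(3)[OF h t(1)] one_circle] True by simp
    then show ?thesis
      using lift_inv(3)[OF lift_pathD(2)[OF h t(1)] circle_cis one_circle] t(2) by simp
  qed
  then have "periodic_flow G N r c (\<lambda>t z. 0)"
    by (auto simp: periodic_flow_def p_def)
  then show ?thesis
    using that by blast
next
  case False
  obtain f where "flow f"
    using rotation_image_dichotomy
  proof
    assume "\<exists>m>0. \<forall>g\<in>carrier G. r g ^ m = 1"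
    then show ?thesis
      using finite_image_flow that by metis
  next
    assume "\<forall>z\<in>circle. \<exists>g\<in>carrier G. r g = z"
    then have "transitive_irreducible"
      using irr False by (simp add: transitive_irreducible_def)
    then show ?thesis
      using transitive_flow that by metis
  qed
  then show ?thesis
    using flow_periodic[OF irr False] periodic_flow_of_flow that by metis
qed

lemma sub_cocycle:
  assumes q: "lift 1 q" and q_cont: "continuous_on circle q" and qq: "\<And>z. z \<in> circle \<Longrightarrow> q z * q z = q z"
  shows "circle_cocycle G T N r (\<lambda>g z. c g z * q z)"
proof unfold_locales
  fix g h z assume g: "g \<in> carrier G" "h \<in> carrier G" and z: "z \<in> circle"
  show "c g z * q z \<in> fmats N"
    using c_in[OF g(1) z] liftD(1)[OF q z] by simp
  have "c g (r h * z) * q (r h * z) * (c h z * q z) = c g (r h * z) * ((q (r h * z) * c h z) * q z)"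
    by (simp add: mult.assoc)
  also have "\<dots> = c g (r h * z) * c h z * (q z * q z)"
    using liftD(4)[OF q z g(2)] by (simp add: mult.assoc)
  finally show "c (g \<otimes> h) z * q z = c g (r h * z) * q (r h * z) * (c h z * q z)"
    using c_mult[OF g z] qq[OF z] by simp
next
  show "continuous_map (prod_topology T (top_of_set circle)) euclidean (\<lambda>(g, z). c g z * q z)"
  proof -
    have s: "continuous_map (prod_topology T (top_of_set circle)) euclidean snd"
      by (rule continuous_map_into_fulltopology[OF continuous_map_snd])
    have "continuous_map (prod_topology T (top_of_set circle)) euclidean (\<lambda>x. c (fst x) (snd x) * q (snd x))"
      by (intro continuous_map_mult continuous_map_compose_on[OF q_cont] continuous_map_c s continuous_map_fst) auto
    then show ?thesis
      by (simp add: case_prod_unfold)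
  qed
qed (use r_mult r_norm r_cont in auto)

lemma lift_complement:
  assumes "lift 1 q" 
  shows "lift 1 (\<lambda>z. p z - q z)"
  unfolding lift_def
proof (intro conjI ballI)
  fix z assume z: "z \<in> circle"
  show "p z - q z \<in> fmats N" "(p z - q z) * p z = p z - q z"
    using liftD[OF assms z] z by (simp_all add: left_diff_distrib)
  fix g assume "g \<in> carrier G"
  then show "(p (r g * z) - q (r g * z)) * c g z = c g (1 * z) * (p z - q z)"
    using liftD(4)[OF assms z] z by (simp add: left_diff_distrib right_diff_distrib p_c c_p)
qed

text \<open>The flow at time 0 is the projection to the summand, so the flow law confines
  \<open>h\<close> to the range of \<open>q\<close>; there the action of the summand and of the
  whole bundle agree.\<close>

lemma periodic_flow_part:
  assumes q: "lift 1 q" and h: "periodic_flow G N r (\<lambda>g z. c g z * q z) h"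
    and t: "0 \<le> t" and z: "z \<in> circle"
  shows "h t z * q z = h t z" "q (cis t * z) * h t z = h t z"
    "g \<in> carrier G \<Longrightarrow> h t (r g * z) * c g z = c g (cis t * z) * h t z"
proof -
  have pq: "c \<one> z * q z = q z" if "z \<in> circle" for z
    using liftD(3)[OF q that] by (simp add: p_def)
  have wz: "cis t * z \<in> circle"
    using z by simp
  have 1: "h t z * q z = h t z" if "z \<in> circle" for z
    using periodic_flowD(4)[OF h that t, of 0] periodic_flowD(2)[OF h that] pq[OF that] by simp
  show "h t z * q z = h t z"
    using 1 z by blast
  show 2: "q (cis t * z) * h t z = h t z"
    using periodic_flowD(4)[OF h z _ t, of 0] periodic_flowD(2)[OF h wz] pq[OF wz] by simp
  assume g: "g \<in> carrier G"
  have "h t (r g * z) * c g z = h t (r g * z) * (q (r g * z) * c g z)"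
    using 1[of "r g * z"] g z by (simp flip: mult.assoc)
  also have "\<dots> = c g (cis t * z) * q (cis t * z) * h t z"
    using liftD(4)[OF q z g] periodic_flowD(5)[OF h z g t] by simp
  finally show "h t (r g * z) * c g z = c g (cis t * z) * h t z"
    using 2 by (simp add: mult.assoc)
qed

text \<open>The mixed products in the flow law vanish because \<open>q\<close> and
  \<open>p - q\<close> annihilate each other.\<close>

lemma periodic_flow_sum:
  assumes q: "lift 1 q" "\<And>z. z \<in> circle \<Longrightarrow> q z * q z = q z"
    and h: "periodic_flow G N r (\<lambda>g z. c g z * q z) h"
    and k: "periodic_flow G N r (\<lambda>g z. c g z * (p z - q z)) k"
  shows "periodic_flow G N r c (\<lambda>t z. h t z + k t z)"
proof -
  note q' = lift_complement[OF q(1)]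
  note H = periodic_flow_part[OF q(1) h]
  note K = periodic_flow_part[OF q' k]
  have e: "c \<one> z * q z + c \<one> z * (p z - q z) = c \<one> z" if "z \<in> circle" for z
    using that by (simp add: right_diff_distrib flip: p_def)
  show ?thesis
    unfolding periodic_flow_def
  proof (intro conjI allI impI ballI)
    show "continuous_on ({0..} \<times> circle) (\<lambda>(t, z). h t z + k t z)"
      using h k unfolding periodic_flow_def case_prod_unfold by (intro continuous_intros) auto
    fix z assume z: "z \<in> circle"
    show "h 0 z + k 0 z = c \<one> z" "h (2 * pi) z + k (2 * pi) z = c \<one> z"
      using periodic_flowD(2,3)[OF h z] periodic_flowD(2,3)[OF k z] e[OF z] by simp_all
    show "h t z + k t z \<in> fmats N" if "0 \<le> t" for t
      using periodic_flowD(1)[OF h z that] periodic_flowD(1)[OF k z that] by simp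
    show "(h t (r g * z) + k t (r g * z)) * c g z = c g (cis t * z) * (h t z + k t z)"
      if "g \<in> carrier G" "0 \<le> t" for g t
      using H(3)[OF that(2) z that(1)] K(3)[OF that(2) z that(1)] by (simp add: distrib_left distrib_right)
    fix s t :: real assume s: "0 \<le> s" and t: "0 \<le> t"
    have w: "cis t * z \<in> circle"
      using z by simp
    have "q (cis t * z) * (p (cis t * z) - q (cis t * z)) = 0" "(p (cis t * z) - q (cis t * z)) * q (cis t * z) = 0"
      using q(2)[OF w] liftD(2,3)[OF q(1) w] by (simp_all add: right_diff_distrib left_diff_distrib)
    moreover have "h s (cis t * z) * k t z =
        h s (cis t * z) * (q (cis t * z) * (p (cis t * z) - q (cis t * z))) * k t z"
      using H(1)[OF s w] K(2)[OF t z] by (metis mult.assoc)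
    moreover have "k s (cis t * z) * h t z =
        k s (cis t * z) * ((p (cis t * z) - q (cis t * z)) * q (cis t * z)) * h t z"
      using K(1)[OF s w] H(2)[OF t z] by (metis mult.assoc)
    ultimately have "h s (cis t * z) * k t z = 0" "k s (cis t * z) * h t z = 0"
      by simp_all
    then show "h (s + t) z + k (s + t) z = (h s (cis t * z) + k s (cis t * z)) * (h t z + k t z)"
      using periodic_flowD(4)[OF h z s t] periodic_flowD(4)[OF k z s t]
      by (simp add: distrib_left distrib_right)
  qed
qed

end

text \<open>Induction on the rank of the fibre over 1, measured by a real dimension equal to
  \<open>2 * N\<close> times that rank. A nontrivial idempotent \<open>q\<close> splits the cocycle
  into the parts of \<open>q\<close> and \<open>p - q\<close>, both of smaller rank.\<close>

theorem periodic_flow_exists: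
  assumes "circle_cocycle G T N r c"
  shows "\<exists>h. periodic_flow G N r c h"
  using assms
proof (induction "dim {a \<in> fmats N. c \<one>\<^bsub>G\<^esub> 1 * a = a}" arbitrary: c rule: less_induct)
  case less
  interpret circle_cocycle G T N r c
    by (rule less.prems)
  show ?case
  proof (cases irreducible_cocycle)
    case True
    then show ?thesis
      using irreducible_periodic_flow by metis
  next
    case False
    then obtain q where q_cont: "continuous_on circle q" and q: "lift 1 q"
      and qq: "\<And>z. z \<in> circle \<Longrightarrow> q z * q z = q z" and q1: "q 1 \<noteq> 0" "q 1 \<noteq> p 1"
      unfolding irreducible_cocycle_def by blast
    have sub: "\<exists>h. periodic_flow G N r (\<lambda>g z. c g z * e z) h"
      if e: "continuous_on circle e" "lift 1 e" "\<And>z. z \<in> circle \<Longrightarrow> e z * e z = e z" "e 1 \<noteq> p 1" for e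
    proof (rule less.hyps)
      have e1: "c \<one>\<^bsub>G\<^esub> 1 * e 1 = e 1"
        using liftD(3)[OF e(2) one_circle] by (simp add: p_def)
      show "dim {a \<in> fmats N. c \<one>\<^bsub>G\<^esub> 1 * e 1 * a = a} < dim {a \<in> fmats N. c \<one>\<^bsub>G\<^esub> 1 * a = a}"
        unfolding e1 p_def[symmetric]
        using dim_range_less[of "p 1" N "e 1"] liftD(1-3)[OF e(2) one_circle] e(4) by simp
      show "circle_cocycle G T N r (\<lambda>g z. c g z * e z)"
        by (rule sub_cocycle[OF e(2,1,3)])
    qed
    have "(p z - q z) * (p z - q z) = p z - q z" if "z \<in> circle" for z
      using liftD[OF q that] qq[OF that] that by (simp add: left_diff_distrib right_diff_distrib)
    then obtain k where k: "periodic_flow G N r (\<lambda>g z. c g z * (p z - q z)) k"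
      using sub[OF _ lift_complement[OF q]] q1(1) q_cont p_cont by (auto intro: continuous_on_diff)
    obtain h where h: "periodic_flow G N r (\<lambda>g z. c g z * q z) h"
      using sub[OF q_cont q qq q1(2)] by blast
    show ?thesis
      using periodic_flow_sum[OF q qq h k] by blast
  qed
qed

section \<open>Frames of complex vector bundles\<close>

lemma topspace_Complex_space: "topspace (Complex_space n) = {w. \<forall>i\<ge>n. w i = 0}"
  by (simp add: Complex_space_def)

lemma continuous_map_Complex_space:
  "continuous_map Z (Complex_space n) f \<longleftrightarrow>
    (\<forall>k. continuous_map Z euclidean (\<lambda>x. f x k)) \<and> (\<forall>x\<in>topspace Z. \<forall>k\<ge>n. f x k = 0)"
  unfolding Complex_space_def continuous_map_in_subtopology continuous_map_componentwise_UNIV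
  by auto

lemma continuous_map_locally:
  assumes "\<And>x. x \<in> topspace Z \<Longrightarrow> \<exists>V. openin Z V \<and> x \<in> V \<and> continuous_map (subtopology Z V) Y f"
  shows "continuous_map Z Y f"
  unfolding continuous_map_def
proof (intro conjI allI impI)
  show "f \<in> topspace Z \<rightarrow> topspace Y"
  proof
    fix x assume x: "x \<in> topspace Z"
    then obtain V where "x \<in> V" "continuous_map (subtopology Z V) Y f"
      using assms by blast
    then show "f x \<in> topspace Y"
      using x by (auto simp: continuous_map_def)
  qed
  fix W assume W: "openin Y W"
  show "openin Z {x \<in> topspace Z. f x \<in> W}"
  proof (subst openin_subopen, intro ballI)
    fix x assume x: "x \<in> {x \<in> topspace Z. f x \<in> W}"
    then obtain V where V: "openin Z V" "x \<in> V" "continuous_map (subtopology Z V) Y f"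
      using assms by blast
    have "openin (subtopology Z V) {y \<in> topspace (subtopology Z V). f y \<in> W}"
      using V(3) W by (rule openin_continuous_map_preimage)
    then have "openin Z {y \<in> topspace (subtopology Z V). f y \<in> W}"
      using V(1) by (simp add: openin_open_subtopology)
    then show "\<exists>U. openin Z U \<and> x \<in> U \<and> U \<subseteq> {x \<in> topspace Z. f x \<in> W}"
      using V(2) x by (intro exI[of _ "{y \<in> topspace (subtopology Z V). f y \<in> W}"]) auto
  qed
qed

text \<open>Chart coordinates and local sections are meaningful on \<open>V\<close> only; the cutoff
  \<open>u\<close> extends them by zero, whatever values \<open>f\<close> takes elsewhere.\<close>

lemma continuous_map_cutoff:
  fixes u f :: "'z \<Rightarrow> complex"
  assumes "openin Z V" "closedin Z K" "K \<subseteq> V" "continuous_map Z euclidean u"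
    and "continuous_map (subtopology Z V) euclidean f" "\<And>x. x \<in> topspace Z \<Longrightarrow> x \<notin> K \<Longrightarrow> u x = 0"
  shows "continuous_map Z euclidean (\<lambda>x. u x * f x)"
proof (rule continuous_map_locally)
  fix x assume x: "x \<in> topspace Z"
  show "\<exists>V. openin Z V \<and> x \<in> V \<and> continuous_map (subtopology Z V) euclidean (\<lambda>x. u x * f x)"
  proof (cases "x \<in> K")
    case True
    have "continuous_map (subtopology Z V) euclidean (\<lambda>x. u x * f x)"
      by (rule continuous_map_mult[OF continuous_map_from_subtopology[OF assms(4)] assms(5)])
    then show ?thesis
      using True assms(1,3) by blast
  next
    case False
    have "continuous_map (subtopology Z (topspace Z - K)) euclidean (\<lambda>x. u x * f x)"
    proof (rule continuous_map_eq)
      show "continuous_map (subtopology Z (topspace Z - K)) euclidean (\<lambda>x. 0 :: complex)"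
        by simp
    qed (use assms(6) in simp)
    then show ?thesis
      using False x assms(2) by (intro exI[of _ "topspace Z - K"]) (auto simp: closedin_def)
  qed
qed

lemma linear_functional_expand:
  fixes f :: "(nat \<Rightarrow> complex) \<Rightarrow> complex"
  assumes add: "\<And>u v. u \<in> topspace (Complex_space n) \<Longrightarrow> v \<in> topspace (Complex_space n) \<Longrightarrow>
      f (\<lambda>i. u i + v i) = f u + f v"
    and scale: "\<And>a u. u \<in> topspace (Complex_space n) \<Longrightarrow> f (\<lambda>i. a * u i) = a * f u"
    and w: "w \<in> topspace (Complex_space n)"
  shows "f w = (\<Sum>k<n. w k * f (\<lambda>i. if i = k then 1 else 0))"
proof -
  have upto: "f (\<lambda>i. if i < m then w i else 0) = (\<Sum>k<m. w k * f (\<lambda>i. if i = k then 1 else 0))" if "m \<le> n" for m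
    using that
  proof (induction m)
    case 0
    show ?case
      using scale[of "\<lambda>i. 0" 0] by (simp add: topspace_Complex_space)
  next
    case (Suc m)
    have "(\<lambda>i. if i < Suc m then w i else 0) =
        (\<lambda>i. (if i < m then w i else 0) + w m * (if i = m then 1 else 0))"
      by (auto simp: less_Suc_eq)
    then have "f (\<lambda>i. if i < Suc m then w i else 0) =
        f (\<lambda>i. if i < m then w i else 0) + f (\<lambda>i. w m * (if i = m then 1 else 0))"
      using Suc.prems by (simp only:) (rule add, auto simp: topspace_Complex_space)
    also have "f (\<lambda>i. w m * (if i = m then 1 else 0)) = w m * f (\<lambda>i. if i = m then 1 else 0)"
      using Suc.prems by (intro scale) (auto simp: topspace_Complex_space)
    finally show ?case
      using Suc by simp
  qed
  have "(\<lambda>i. if i < n then w i else 0) = w"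
    using w by (auto simp: topspace_Complex_space)
  then show ?thesis
    using upto[OF order_refl] by (simp only:)
qed

text \<open>A local trivialisation taken apart: \<open>h\<close> is its component in complex
  \<open>n\<close>-space, and \<open>k\<close> is the inverse with the base point as first
  argument.\<close>

definition local_chart ::
  "('x, 'e) vbundle \<Rightarrow> 'x set \<Rightarrow> nat \<Rightarrow> ('e \<Rightarrow> nat \<Rightarrow> complex) \<Rightarrow> ('x \<Rightarrow> (nat \<Rightarrow> complex) \<Rightarrow> 'e) \<Rightarrow> bool"
  where "local_chart E U n h k \<longleftrightarrow>
    openin (base_space E) U \<and>
    (\<forall>e\<in>topspace (total_space E). proj E e \<in> U \<longrightarrow>
      h e \<in> topspace (Complex_space n) \<and> k (proj E e) (h e) = e) \<and>
    (\<forall>y\<in>U. \<forall>w\<in>topspace (Complex_space n).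
      k y w \<in> topspace (total_space E) \<and> proj E (k y w) = y \<and> h (k y w) = w) \<and>
    (\<forall>y\<in>U. \<forall>u\<in>carrier (fibre E y).
      (\<forall>v\<in>carrier (fibre E y). h (u \<oplus>\<^bsub>fibre E y\<^esub> v) = (\<lambda>i. h u i + h v i)) \<and>
      (\<forall>c. h (c \<odot>\<^bsub>fibre E y\<^esub> u) = (\<lambda>i. c * h u i))) \<and>
    continuous_map (subtopology (total_space E) {e \<in> topspace (total_space E). proj E e \<in> U}) (Complex_space n) h \<and>
    continuous_map (prod_topology (subtopology (base_space E) U) (Complex_space n)) (total_space E) (\<lambda>(y, w). k y w)"

lemma local_chartD:
  assumes "local_chart E U n h k"
  shows "openin (base_space E) U"
    "e \<in> topspace (total_space E) \<Longrightarrow> proj E e \<in> U \<Longrightarrow> h e \<in> topspace (Complex_space n)"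
    "e \<in> topspace (total_space E) \<Longrightarrow> proj E e \<in> U \<Longrightarrow> k (proj E e) (h e) = e"
    "y \<in> U \<Longrightarrow> w \<in> topspace (Complex_space n) \<Longrightarrow> k y w \<in> topspace (total_space E)"
    "y \<in> U \<Longrightarrow> w \<in> topspace (Complex_space n) \<Longrightarrow> proj E (k y w) = y"
    "y \<in> U \<Longrightarrow> w \<in> topspace (Complex_space n) \<Longrightarrow> h (k y w) = w"
    "y \<in> U \<Longrightarrow> u \<in> carrier (fibre E y) \<Longrightarrow> v \<in> carrier (fibre E y) \<Longrightarrow>
      h (u \<oplus>\<^bsub>fibre E y\<^esub> v) = (\<lambda>i. h u i + h v i)"
    "y \<in> U \<Longrightarrow> u \<in> carrier (fibre E y) \<Longrightarrow> h (c \<odot>\<^bsub>fibre E y\<^esub> u) = (\<lambda>i. c * h u i)"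
    "continuous_map (subtopology (total_space E) {e \<in> topspace (total_space E). proj E e \<in> U}) (Complex_space n) h"
    "continuous_map (prod_topology (subtopology (base_space E) U) (Complex_space n)) (total_space E) (\<lambda>(y, w). k y w)"
  using assms unfolding local_chart_def by blast+

lemma local_chart_subset:
  assumes "local_chart E U n h k" "openin (base_space E) V" "V \<subseteq> U"
  shows "local_chart E V n h k"
proof -
  have h: "continuous_map (subtopology (total_space E) {e \<in> topspace (total_space E). proj E e \<in> V}) (Complex_space n) h"
    using assms(3) by (intro continuous_map_from_subtopology_mono[OF local_chartD(9)[OF assms(1)]]) auto
  have "continuous_map (prod_topology (subtopology (base_space E) V) (Complex_space n))
      (prod_topology (subtopology (base_space E) U) (Complex_space n)) (\<lambda>x. x)"
  proof -
    have "continuous_map (subtopology (base_space E) V) (subtopology (base_space E) U) (\<lambda>x. x)"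
      using assms(3) by (auto simp: continuous_map_in_subtopology continuous_map_from_subtopology)
    from continuous_map_pairedI[OF continuous_map_compose[OF continuous_map_fst this] continuous_map_snd]
    show ?thesis
      by (simp add: o_def)
  qed
  from continuous_map_compose[OF this local_chartD(10)[OF assms(1)]]
  have k: "continuous_map (prod_topology (subtopology (base_space E) V) (Complex_space n)) (total_space E) (\<lambda>(y, w). k y w)"
    by (simp add: o_def)
  show ?thesis
    unfolding local_chart_def
  proof (intro conjI ballI impI allI h k assms(2))
    show "h e \<in> topspace (Complex_space n)" "k (proj E e) (h e) = e"
      if "e \<in> topspace (total_space E)" "proj E e \<in> V" for e
      using local_chartD(2,3)[OF assms(1) that(1) subsetD[OF assms(3) that(2)]] by auto
    show "k y w \<in> topspace (total_space E)" "proj E (k y w) = y" "h (k y w) = w"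
      if "y \<in> V" "w \<in> topspace (Complex_space n)" for y w
      using local_chartD(4-6)[OF assms(1) subsetD[OF assms(3) that(1)] that(2)] by auto
    show "h (u \<oplus>\<^bsub>fibre E y\<^esub> v) = (\<lambda>i. h u i + h v i)"
      if "y \<in> V" "u \<in> carrier (fibre E y)" "v \<in> carrier (fibre E y)" for y u v
      by (rule local_chartD(7)[OF assms(1) subsetD[OF assms(3) that(1)] that(2,3)])
    show "h (c \<odot>\<^bsub>fibre E y\<^esub> u) = (\<lambda>i. c * h u i)"
      if "y \<in> V" "u \<in> carrier (fibre E y)" for y u c
      by (rule local_chartD(8)[OF assms(1) subsetD[OF assms(3) that(1)] that(2)])
  qed
qed

lemma fibre_carrier:
  assumes "complex_vector_bundle E" "x \<in> topspace (base_space E)"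
  shows "carrier (fibre E x) = {e \<in> topspace (total_space E). proj E e = x}"
  using assms by (auto simp: complex_vector_bundle_def)

lemma fibre_closed:
  assumes "complex_vector_bundle E" "x \<in> topspace (base_space E)" "u \<in> carrier (fibre E x)"
  shows "v \<in> carrier (fibre E x) \<Longrightarrow> u \<oplus>\<^bsub>fibre E x\<^esub> v \<in> carrier (fibre E x)"
    and "c \<odot>\<^bsub>fibre E x\<^esub> u \<in> carrier (fibre E x)"
proof -
  interpret module complex_field "fibre E x"
    using assms by (auto simp: complex_vector_bundle_def)
  show "v \<in> carrier (fibre E x) \<Longrightarrow> u \<oplus>\<^bsub>fibre E x\<^esub> v \<in> carrier (fibre E x)"
    using assms(3) by simp
  have "c \<in> carrier complex_field"
    by (simp add: complex_field_def ring_of_type_algebra_def)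
  then show "c \<odot>\<^bsub>fibre E x\<^esub> u \<in> carrier (fibre E x)"
    using assms(3) by simp
qed

lemma local_chart_exists:
  assumes "complex_vector_bundle E" "x \<in> topspace (base_space E)"
  obtains U n h k where "local_chart E U n h k" "x \<in> U"
proof -
  let ?B = "base_space E" and ?T = "total_space E"
  obtain U n H where U: "openin ?B U" "x \<in> U"
    and iso: "bundle_iso (restrict_bundle E U) (product_bundle (subtopology ?B U) n) H"
    using assms unfolding complex_vector_bundle_def by blast
  have UB: "U \<subseteq> topspace ?B"
    using U(1) by (rule openin_subset)
  let ?TU = "subtopology ?T {e \<in> topspace ?T. proj E e \<in> U}"
  let ?PU = "prod_topology (subtopology ?B U) (Complex_space n)"
  have hom: "homeomorphic_map ?TU ?PU H"
    and fst_H: "\<And>e. e \<in> topspace ?T \<Longrightarrow> proj E e \<in> U \<Longrightarrow> fst (H e) = proj E e"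
    and lin: "\<And>y. y \<in> U \<Longrightarrow> linear_on (fibre E y) (fibre (product_bundle (subtopology ?B U) n) y) H"
    using iso UB by (auto simp: bundle_iso_def restrict_bundle_def product_bundle_def)
  obtain K where K: "homeomorphic_maps ?TU ?PU H K"
    using hom homeomorphic_map_maps by blast
  have top: "topspace ?TU = {e \<in> topspace ?T. proj E e \<in> U}" "topspace ?PU = U \<times> topspace (Complex_space n)"
    using UB by auto
  have cH: "continuous_map ?TU ?PU H" and cK: "continuous_map ?PU ?TU K"
    and KH: "\<And>e. e \<in> topspace ?T \<Longrightarrow> proj E e \<in> U \<Longrightarrow> K (H e) = e"
    and HK: "\<And>y w. y \<in> U \<Longrightarrow> w \<in> topspace (Complex_space n) \<Longrightarrow> H (K (y, w)) = (y, w)"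
    using K top UB unfolding homeomorphic_maps_def by (blast, blast, simp, auto)
  have H_in: "snd (H e) \<in> topspace (Complex_space n)" if "e \<in> topspace ?T" "proj E e \<in> U" for e
    using continuous_map_image_subset_topspace[OF cH] that top by (auto simp: mem_Times_iff)
  have K_in: "K (y, w) \<in> topspace ?T" "proj E (K (y, w)) \<in> U" if "y \<in> U" "w \<in> topspace (Complex_space n)" for y w
  proof -
    have "K (y, w) \<in> {e \<in> topspace ?T. proj E e \<in> U}"
      using continuous_map_image_subset_topspace[OF cK] that unfolding top by blast
    then show "K (y, w) \<in> topspace ?T" "proj E (K (y, w)) \<in> U"
      by simp_all
  qed
  show ?thesis
  proof (rule that[of U n "\<lambda>e. snd (H e)" "\<lambda>y w. K (y, w)"])
    show "local_chart E U n (\<lambda>e. snd (H e)) (\<lambda>y w. K (y, w))"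
      unfolding local_chart_def
    proof (intro conjI ballI impI allI U)
      fix e assume e: "e \<in> topspace ?T" "proj E e \<in> U"
      show "snd (H e) \<in> topspace (Complex_space n)"
        by (rule H_in[OF e])
      have "H e = (proj E e, snd (H e))"
        using fst_H[OF e] by (metis prod.collapse)
      then show "K (proj E e, snd (H e)) = e"
        using KH[OF e] by simp
    next
      fix y w assume yw: "y \<in> U" "w \<in> topspace (Complex_space n)"
      show "K (y, w) \<in> topspace ?T" "snd (H (K (y, w))) = w"
        using K_in[OF yw] HK[OF yw] by auto
      show "proj E (K (y, w)) = y"
        using fst_H[OF K_in[OF yw]] HK[OF yw] by simp
    next
      fix y u v c assume y: "y \<in> U" and u: "u \<in> carrier (fibre E y)" and v: "v \<in> carrier (fibre E y)"
      have "y \<in> topspace ?B"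
        using y UB by blast
      then have uv: "u \<in> topspace ?T" "proj E u = y" "v \<in> topspace ?T" "proj E v = y"
        using u v fibre_carrier[OF assms(1)] by auto
      have H: "H u = (y, snd (H u))" "H v = (y, snd (H v))"
        using fst_H uv y by (metis prod.collapse)+
      show "snd (H (u \<oplus>\<^bsub>fibre E y\<^esub> v)) = (\<lambda>i. snd (H u) i + snd (H v) i)"
        using lin[OF y] u v by (subst (2 3) prod.collapse[symmetric])
          (auto simp: linear_on_def product_bundle_def complex_vectors_def case_prod_unfold)
    next
      fix y u c assume y: "y \<in> U" and u: "u \<in> carrier (fibre E y)"
      show "snd (H (c \<odot>\<^bsub>fibre E y\<^esub> u)) = (\<lambda>i. c * snd (H u) i)"
        using lin[OF y] u
        by (auto simp: linear_on_def product_bundle_def complex_vectors_def case_prod_unfold)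
    next
      show "continuous_map ?TU (Complex_space n) (\<lambda>e. snd (H e))"
        using continuous_map_compose[OF cH continuous_map_snd] by (simp add: o_def)
      have "continuous_map ?PU ?T K"
        using cK by (rule continuous_map_into_fulltopology)
      then show "continuous_map ?PU ?T (\<lambda>(y, w). K (y, w))"
        by simp
    qed
  qed fact
qed

definition fibre_functional :: "('x, 'e) vbundle \<Rightarrow> 'x \<Rightarrow> ('e \<Rightarrow> complex) \<Rightarrow> bool"
  where "fibre_functional E x f \<longleftrightarrow>
    (\<forall>u\<in>carrier (fibre E x).
      (\<forall>v\<in>carrier (fibre E x). f (u \<oplus>\<^bsub>fibre E x\<^esub> v) = f u + f v) \<and>
      (\<forall>c. f (c \<odot>\<^bsub>fibre E x\<^esub> u) = c * f u))"

text \<open>A chart records linearity of \<open>h\<close> only; it passes to \<open>k\<close>, which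
  inverts \<open>h\<close> on each fibre.\<close>

lemma chart_inverse_linear:
  assumes vb: "complex_vector_bundle E" and ch: "local_chart E U n h k" and y: "y \<in> U"
    and f: "fibre_functional E y f" 
    and u: "u \<in> topspace (Complex_space n)"
  shows "v \<in> topspace (Complex_space n) \<Longrightarrow> f (k y (\<lambda>i. u i + v i)) = f (k y u) + f (k y v)"
    and "f (k y (\<lambda>i. c * u i)) = c * f (k y u)"
proof -
  note D = local_chartD[OF ch]
  have yB: "y \<in> topspace (base_space E)"
    using y openin_subset[OF D(1)] by blast
  have k_in: "k y w \<in> carrier (fibre E y)" if "w \<in> topspace (Complex_space n)" for w
    using D(4,5)[OF y that] fibre_carrier[OF vb yB] by simp
  have kh: "k y (h e) = e" if "e \<in> carrier (fibre E y)" for e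
    using D(3)[of e] that y fibre_carrier[OF vb yB] by auto
  show "f (k y (\<lambda>i. u i + v i)) = f (k y u) + f (k y v)" if v: "v \<in> topspace (Complex_space n)"
  proof -
    have "h (k y u \<oplus>\<^bsub>fibre E y\<^esub> k y v) = (\<lambda>i. u i + v i)"
      using D(7)[OF y k_in[OF u] k_in[OF v]] D(6)[OF y] u v by simp
    then have "k y (\<lambda>i. u i + v i) = k y u \<oplus>\<^bsub>fibre E y\<^esub> k y v"
      using kh[OF fibre_closed(1)[OF vb yB k_in[OF u] k_in[OF v]]] by simp
    then show ?thesis
      using f k_in[OF u] k_in[OF v] by (simp add: fibre_functional_def)
  qed
  have "h (c \<odot>\<^bsub>fibre E y\<^esub> k y u) = (\<lambda>i. c * u i)"
    using D(8)[OF y k_in[OF u]] D(6)[OF y] u by simp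
  then have "k y (\<lambda>i. c * u i) = c \<odot>\<^bsub>fibre E y\<^esub> k y u"
    using kh[OF fibre_closed(2)[OF vb yB k_in[OF u]]] by metis
  then show "f (k y (\<lambda>i. c * u i)) = c * f (k y u)"
    using f k_in[OF u] by (simp add: fibre_functional_def)
qed

lemma chart_functional_expand:
  assumes vb: "complex_vector_bundle E" and ch: "local_chart E U n h k" and y: "y \<in> U"
    and f: "fibre_functional E y f" and e: "e \<in> carrier (fibre E y)"
  shows "f e = (\<Sum>l<n. h e l * f (k y (\<lambda>i. if i = l then 1 else 0)))"
proof -
  note D = local_chartD[OF ch]
  have yB: "y \<in> topspace (base_space E)"
    using y openin_subset[OF D(1)] by blast
  have e': "e \<in> topspace (total_space E)" "proj E e = y"
    using e fibre_carrier[OF vb yB] by auto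
  have "f (k y (h e)) = (\<Sum>l<n. h e l * f (k y (\<lambda>i. if i = l then 1 else 0)))"
    using D(2)[OF e'(1)] e'(2) y chart_inverse_linear[OF vb ch y f]
    by (intro linear_functional_expand[of n "\<lambda>w. f (k y w)"]) auto
  then show ?thesis
    using D(3)[OF e'(1)] e'(2) y by simp
qed

text \<open>
  A frame \<open>(\<xi>, \<theta>, s)\<close> writes every vector of the fibre over \<open>y\<close> as the sum of the
  \<open>\<xi> m e * \<theta> m y\<close>-multiples of \<open>s m y\<close>; the sections \<open>s m\<close> are arbitrary where \<open>\<theta> m\<close> vanishes.
  To avoid sums in the fibres, this is expressed through linear functionals.
\<close>

definition frame ::
  "('x, 'e) vbundle \<Rightarrow> nat \<Rightarrow> (nat \<Rightarrow> 'e \<Rightarrow> complex) \<Rightarrow> (nat \<Rightarrow> 'x \<Rightarrow> complex) \<Rightarrow> (nat \<Rightarrow> 'x \<Rightarrow> 'e) \<Rightarrow> bool"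
  where "frame E N \<xi> \<theta> s \<longleftrightarrow>
    (\<forall>m<N. continuous_map (total_space E) euclidean (\<xi> m)) \<and>
    (\<forall>m<N. \<forall>y\<in>topspace (base_space E). fibre_functional E y (\<xi> m)) \<and>
    (\<forall>m<N. continuous_map (base_space E) euclidean (\<theta> m)) \<and>
    (\<forall>m<N. \<exists>V K. openin (base_space E) V \<and> closedin (base_space E) K \<and> K \<subseteq> V \<and>
      (\<forall>y\<in>topspace (base_space E). y \<notin> K \<longrightarrow> \<theta> m y = 0) \<and>
      continuous_map (subtopology (base_space E) V) (total_space E) (s m) \<and>
      (\<forall>y\<in>V. s m y \<in> carrier (fibre E y))) \<and>
    (\<forall>y\<in>topspace (base_space E). \<forall>f. fibre_functional E y f \<longrightarrow>
      (\<forall>e\<in>carrier (fibre E y). f e = (\<Sum>m<N. \<xi> m e * \<theta> m y * f (s m y)))) \<and>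
    (\<forall>y\<in>topspace (base_space E). \<exists>V n h k j u. local_chart E V n h k \<and> y \<in> V \<and>
      continuous_map (subtopology (base_space E) V) euclidean u \<and> (\<forall>x\<in>V. u x \<noteq> 0) \<and>
      (\<forall>l<n. j l < N \<and>
        (\<forall>e\<in>topspace (total_space E). proj E e \<in> V \<longrightarrow> \<xi> (j l) e = u (proj E e) * h e l)))"

text \<open>Finitely many charts with tent functions as weights. Each weight \<psi> is used twice,
  in \<xi> to extend the chart coordinates by zero and in \<theta> to extend the coordinate
  sections; this is why \<sigma> normalises the sum of squares.\<close>

lemma frame_exists:
  fixes E :: "('x::metric_space, 'e) vbundle"
  assumes vb: "complex_vector_bundle E" and base: "base_space E = top_of_set S" and S: "compact S"
  obtains N \<xi> \<theta> s where "frame E N \<xi> \<theta> s"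
proof -
  let ?B = "base_space E" and ?T = "total_space E"
  have topB: "topspace ?B = S"
    by (simp add: base)
  have "\<exists>U n h k d. local_chart E U n h k \<and> 0 < d \<and> ball x (2 * d) \<inter> S \<subseteq> U" if "x \<in> S" for x
  proof -
    have "x \<in> topspace (base_space E)"
      using that topB by simp
    from local_chart_exists[OF vb this] obtain U n h k where ch: "local_chart E U n h k" "x \<in> U"
      by metis
    obtain O' where O': "open O'" "U = S \<inter> O'"
      using local_chartD(1)[OF ch(1)] unfolding base openin_open by blast
    obtain d where d: "0 < d" "ball x d \<subseteq> O'"
      using O' ch(2) open_contains_ball by blast
    \<comment> \<open>The doubled ball fits into the chart, so the closed ball of the single radius,
      outside which the weight vanishes, does so too.\<close>
    then have "ball x (2 * (d / 2)) \<inter> S \<subseteq> U"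
      using O'(2) by auto
    then show ?thesis
      using ch(1) d(1) by (metis half_gt_zero)
  qed
  then obtain U n h k d where ch: "\<And>x. x \<in> S \<Longrightarrow> local_chart E (U x) (n x) (h x) (k x)"
    and d: "\<And>x. x \<in> S \<Longrightarrow> 0 < d x" "\<And>x. x \<in> S \<Longrightarrow> ball x (2 * d x) \<inter> S \<subseteq> U x"
    by metis
  have "S \<subseteq> (\<Union>x\<in>S. ball x (d x))"
    using d(1) by auto
  then obtain F where F: "F \<subseteq> S" "finite F" "S \<subseteq> (\<Union>x\<in>F. ball x (d x))"
    using compactE_image[OF S, of S "\<lambda>x. ball x (d x)"] by (metis open_ball)
  define \<psi> where "\<psi> = (\<lambda>x y. complex_of_real (max 0 (d x - dist x y)))"
  define \<sigma> where "\<sigma> = (\<lambda>y. \<Sum>x\<in>F. \<psi> x y * \<psi> x y)"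
  have \<psi>_0: "\<psi> x y = 0" if "d x \<le> dist x y" for x y
    using that by (simp add: \<psi>_def)
  have \<psi>_cont: "continuous_map ?B euclidean (\<psi> x)" for x
    unfolding base \<psi>_def by (auto intro!: continuous_intros)
  have \<sigma>_nz: "\<sigma> y \<noteq> 0" if y: "y \<in> S" for y
  proof -
    obtain x where x: "x \<in> F" "dist x y < d x"
      using F(3) y by auto
    have "0 < (\<Sum>x\<in>F. max 0 (d x - dist x y) * max 0 (d x - dist x y))"
      using x by (intro sum_pos2[OF F(2) x(1)]) auto
    moreover have "\<sigma> y = complex_of_real (\<Sum>x\<in>F. max 0 (d x - dist x y) * max 0 (d x - dist x y))"
      by (simp add: \<sigma>_def \<psi>_def)
    ultimately show ?thesis
      by (metis less_irrefl of_real_eq_0_iff)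
  qed
  have \<sigma>_cont: "continuous_map ?B euclidean \<sigma>"
    unfolding \<sigma>_def by (intro continuous_map_sum F(2) continuous_map_mult \<psi>_cont)
  define I where "I = Sigma F (\<lambda>x. {..<n x})"
  have fin_I: "finite I"
    using F(2) by (simp add: I_def)
  define N where "N = card I"
  obtain ix where ix: "bij_betw ix {..<N} I"
    using ex_bij_betw_nat_finite[OF fin_I] by (auto simp: N_def atLeast0LessThan)
  have ix_in: "fst (ix m) \<in> F" "snd (ix m) < n (fst (ix m))" "fst (ix m) \<in> S" if "m < N" for m
  proof -
    have "ix m \<in> Sigma F (\<lambda>x. {..<n x})"
      using bij_betwE[OF ix] that by (simp add: I_def)
    then show "fst (ix m) \<in> F" "snd (ix m) < n (fst (ix m))" "fst (ix m) \<in> S"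
      using F(1) by auto
  qed
  define \<xi> where "\<xi> = (\<lambda>m e. \<psi> (fst (ix m)) (proj E e) * h (fst (ix m)) e (snd (ix m)))"
  define \<theta> where "\<theta> = (\<lambda>m y. \<psi> (fst (ix m)) y / \<sigma> y)"
  define s where "s = (\<lambda>m y. k (fst (ix m)) y (\<lambda>i. if i = snd (ix m) then 1 else 0))"
  let ?K = "\<lambda>x. {y \<in> S. dist x y \<le> d x}"
  have K: "closedin ?B (?K x)" "?K x \<subseteq> U x" if "x \<in> S" for x
  proof -
    have "?K x = S \<inter> cball x (d x)"
      by auto
    then show "closedin ?B (?K x)"
      unfolding base closedin_closed by blast
    show "?K x \<subseteq> U x"
      using d[OF that] by (force simp: subset_iff)
  qed
  have proj_cont: "continuous_map ?T ?B (proj E)"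
    using vb by (simp add: complex_vector_bundle_def)
  have U_sub: "U x \<subseteq> S" if "x \<in> S" for x
    using openin_subset[OF local_chartD(1)[OF ch[OF that]]] topB by simp
  have "frame E N \<xi> \<theta> s"
    unfolding frame_def
  proof (intro conjI allI impI ballI)
    fix m assume m: "m < N"
    let ?x = "fst (ix m)" and ?l = "snd (ix m)"
    note x = ix_in[OF m] and D = local_chartD[OF ch[OF ix_in(3)[OF m]]]
    show "continuous_map ?T euclidean (\<xi> m)"
      unfolding \<xi>_def
    proof (rule continuous_map_cutoff)
      show "openin ?T {e \<in> topspace ?T. proj E e \<in> U ?x}"
        using proj_cont D(1) by (rule openin_continuous_map_preimage)
      show "closedin ?T {e \<in> topspace ?T. proj E e \<in> ?K ?x}"
        using proj_cont K(1)[OF x(3)] by (rule closedin_continuous_map_preimage)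
      show "{e \<in> topspace ?T. proj E e \<in> ?K ?x} \<subseteq> {e \<in> topspace ?T. proj E e \<in> U ?x}"
        using K(2)[OF x(3)] by blast
      show "continuous_map ?T euclidean (\<lambda>e. \<psi> ?x (proj E e))"
        using continuous_map_compose[OF proj_cont \<psi>_cont] by (simp add: o_def)
      show "continuous_map (subtopology ?T {e \<in> topspace ?T. proj E e \<in> U ?x}) euclidean (\<lambda>e. h ?x e ?l)"
        using D(9) by (simp add: continuous_map_Complex_space)
      show "\<psi> ?x (proj E e) = 0" if "e \<in> topspace ?T" "e \<notin> {e \<in> topspace ?T. proj E e \<in> ?K ?x}" for e
        using that continuous_map_image_subset_topspace[OF proj_cont] topB by (intro \<psi>_0) auto
    qed
    show "continuous_map ?B euclidean (\<theta> m)"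
    proof -
      have "continuous_map ?B euclidean (\<lambda>y. inverse (\<sigma> y))"
      proof (rule continuous_map_compose_on[OF _ \<sigma>_cont])
        show "continuous_on (- {0 :: complex}) inverse"
          by (intro continuous_on_inverse continuous_on_id) simp
      qed (use \<sigma>_nz topB in simp)
      then show ?thesis
        unfolding \<theta>_def divide_inverse by (intro continuous_map_mult \<psi>_cont)
    qed
    show "fibre_functional E y (\<xi> m)" if y: "y \<in> topspace ?B" for y
    proof (cases "y \<in> U ?x")
      case True
      show ?thesis
        unfolding fibre_functional_def \<xi>_def
        using D(7,8)[OF True] fibre_closed[OF vb y] fibre_carrier[OF vb y] by (simp add: distrib_left)
    next
      case False
      then have "\<psi> ?x y = 0"
        using K(2)[OF x(3)] y topB by (intro \<psi>_0) auto
      then show ?thesis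
        unfolding fibre_functional_def \<xi>_def
        using fibre_closed[OF vb y] fibre_carrier[OF vb y] by simp
    qed
    show "\<exists>V K. openin ?B V \<and> closedin ?B K \<and> K \<subseteq> V \<and>
        (\<forall>y\<in>topspace ?B. y \<notin> K \<longrightarrow> \<theta> m y = 0) \<and>
        continuous_map (subtopology ?B V) ?T (s m) \<and> (\<forall>y\<in>V. s m y \<in> carrier (fibre E y))"
    proof (intro exI conjI ballI impI)
      show "openin ?B (U ?x)" "closedin ?B (?K ?x)" "?K ?x \<subseteq> U ?x"
        using D(1) K[OF x(3)] by auto
      show "\<theta> m y = 0" if "y \<in> topspace ?B" "y \<notin> ?K ?x" for y
        using that \<psi>_0[of ?x y] topB by (auto simp: \<theta>_def)
      have \<delta>: "(\<lambda>i. if i = ?l then 1 else 0) \<in> topspace (Complex_space (n ?x))"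
        using x(2) by (auto simp: topspace_Complex_space)
      have "continuous_map (subtopology ?B (U ?x)) (prod_topology (subtopology ?B (U ?x)) (Complex_space (n ?x)))
          (\<lambda>y. (y, \<lambda>i. if i = ?l then 1 else 0))"
        using \<delta> by (intro continuous_map_pairedI) auto
      from continuous_map_compose[OF this D(10)]
      show "continuous_map (subtopology ?B (U ?x)) ?T (s m)"
        by (simp add: o_def s_def)
      show "s m y \<in> carrier (fibre E y)" if "y \<in> U ?x" for y
        using D(4,5)[OF that \<delta>] fibre_carrier[OF vb, of y] that U_sub[OF x(3)] topB by (auto simp: s_def)
    qed
  next
    fix y f e assume y: "y \<in> topspace ?B" and f: "fibre_functional E y f" and e: "e \<in> carrier (fibre E y)"
    have pe: "proj E e = y"
      using e fibre_carrier[OF vb y] by simp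
    have "(\<Sum>m<N. \<xi> m e * \<theta> m y * f (s m y)) =
        (\<Sum>m<N. (\<lambda>(x, l). \<psi> x y * h x e l * (\<psi> x y / \<sigma> y) * f (k x y (\<lambda>i. if i = l then 1 else 0))) (ix m))"
      by (simp add: \<xi>_def \<theta>_def s_def pe case_prod_unfold)
    also have "\<dots> = (\<Sum>(x, l)\<in>I. \<psi> x y * h x e l * (\<psi> x y / \<sigma> y) * f (k x y (\<lambda>i. if i = l then 1 else 0)))"
      by (rule sum.reindex_bij_betw[OF ix])
    also have "\<dots> = (\<Sum>x\<in>F. \<Sum>l<n x. \<psi> x y * h x e l * (\<psi> x y / \<sigma> y) * f (k x y (\<lambda>i. if i = l then 1 else 0)))"
      unfolding I_def using F(2) by (subst sum.Sigma) auto
    also have "\<dots> = (\<Sum>x\<in>F. \<psi> x y * \<psi> x y / \<sigma> y * f e)"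
    proof (intro sum.cong refl)
      fix x assume x: "x \<in> F"
      then have xS: "x \<in> S"
        using F(1) by blast
      show "(\<Sum>l<n x. \<psi> x y * h x e l * (\<psi> x y / \<sigma> y) * f (k x y (\<lambda>i. if i = l then 1 else 0))) =
          \<psi> x y * \<psi> x y / \<sigma> y * f e"
      proof (cases "y \<in> U x")
        case True
        show ?thesis
          unfolding chart_functional_expand[OF vb ch[OF xS] True f e] sum_distrib_left
          by (intro sum.cong) (auto simp: mult_ac)
      next
        case False
        then have "\<psi> x y = 0"
          using K(2)[OF xS] y topB by (intro \<psi>_0) auto
        then show ?thesis
          by simp
      qed
    qed
    also have "\<dots> = \<sigma> y / \<sigma> y * f e"
      unfolding sum_distrib_right[symmetric] sum_divide_distrib[symmetric] by (simp only: \<sigma>_def)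
    also have "\<dots> = f e"
      using \<sigma>_nz y topB by simp
    finally show "f e = (\<Sum>m<N. \<xi> m e * \<theta> m y * f (s m y))"
      by simp
  next
    \<comment> \<open>Near \<open>y\<close> the chart coordinates can be recovered from the frame
      coordinates by dividing by a nonvanishing weight. Continuity of the inverse trivialisation
      will rest on this.\<close>
    fix y assume y: "y \<in> topspace ?B"
    then obtain x where x: "x \<in> F" "dist x y < d x"
      using F(3) topB by auto
    then have xS: "x \<in> S"
      using F(1) by blast
    let ?V = "S \<inter> ball x (d x)"
    have V: "openin ?B ?V"
      unfolding base by (simp add: openin_open_Int)
    have VU: "?V \<subseteq> U x"
      using K(2)[OF xS] by auto
    define j where "j = (\<lambda>l. SOME m. m < N \<and> ix m = (x, l))"
    have j: "j l < N \<and> ix (j l) = (x, l)" if "l < n x" for l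
    proof -
      have "(x, l) \<in> ix ` {..<N}"
        using ix that x(1) by (auto simp: bij_betw_def I_def)
      then have "\<exists>m. m < N \<and> ix m = (x, l)"
        by (metis imageE lessThan_iff)
      then show ?thesis
        unfolding j_def by (rule someI_ex)
    qed
    show "\<exists>V n h k j u. local_chart E V n h k \<and> y \<in> V \<and>
        continuous_map (subtopology ?B V) euclidean u \<and> (\<forall>x\<in>V. u x \<noteq> 0) \<and>
        (\<forall>l<n. j l < N \<and>
          (\<forall>e\<in>topspace ?T. proj E e \<in> V \<longrightarrow> \<xi> (j l) e = u (proj E e) * h e l))"
    proof (intro exI conjI)
      show "local_chart E ?V (n x) (h x) (k x)"
        by (rule local_chart_subset[OF ch[OF xS] V VU])
      show "y \<in> ?V"
        using x(2) y topB by auto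
      show "continuous_map (subtopology ?B ?V) euclidean (\<psi> x)"
        using \<psi>_cont by (rule continuous_map_from_subtopology)
      show "\<forall>y\<in>?V. \<psi> x y \<noteq> 0"
        by (auto simp: \<psi>_def max_def)
      show "\<forall>l<n x. j l < N \<and>
          (\<forall>e\<in>topspace ?T. proj E e \<in> ?V \<longrightarrow> \<xi> (j l) e = \<psi> x (proj E e) * h x e l)"
        using j by (simp add: \<xi>_def)
    qed
  qed
  then show ?thesis
    using that by blast
qed

no_notation fps_nth (infixl \<open>$\<close> 75)

section \<open>Trivialising the bundle\<close>

definition of_vec2 :: "real^2 \<Rightarrow> complex"
  where "of_vec2 x = Complex (x $ 1) (x $ 2)"

definition to_vec2 :: "complex \<Rightarrow> real^2"
  where "to_vec2 z = vector [Re z, Im z]"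

lemma of_vec2_to_vec2 [simp]: "of_vec2 (to_vec2 z) = z"
  by (simp add: of_vec2_def to_vec2_def complex_eq_iff)

lemma to_vec2_of_vec2 [simp]: "to_vec2 (of_vec2 x) = x"
  by (simp add: of_vec2_def to_vec2_def vec_eq_iff forall_2)

lemma norm_of_vec2 [simp]: "cmod (of_vec2 x) = norm x"
  by (simp add: of_vec2_def norm_vec_def L2_set_def sum_2 cmod_def)

lemma norm_to_vec2 [simp]: "norm (to_vec2 z) = cmod z"
  using norm_of_vec2[of "to_vec2 z"] by simp

lemma continuous_of_vec2: "continuous_on A of_vec2"
proof -
  have eq: "of_vec2 = (\<lambda>x. complex_of_real (x $ 1) + \<i> * complex_of_real (x $ 2))"
    by (auto simp: of_vec2_def complex_eq_iff)
  show ?thesis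
    unfolding eq by (intro continuous_intros)
qed

lemma continuous_to_vec2: "continuous_on A to_vec2"
proof -
  have eq: "to_vec2 = (\<lambda>z. \<chi> i. if i = 1 then Re z else Im z)"
    by (auto simp: to_vec2_def vec_eq_iff forall_2)
  have "continuous_on A (\<lambda>z. if i = 1 then Re z else Im z)" for i :: 2
    by (cases "i = 1") (auto intro!: continuous_intros)
  then show ?thesis
    unfolding eq by (rule continuous_on_vec_lambda)
qed

text \<open>The squares of \<open>Q11 - Q22\<close> and \<open>Q12 + Q21\<close> add up to the sum
  of the squares of all entries minus twice the determinant, which is 2 - 2.\<close>

lemma rotation_matrix_2:
  fixes Q :: "real^2^2"
  assumes "rotation_matrix Q"
  shows "Q $ 2 $ 2 = Q $ 1 $ 1" "Q $ 1 $ 2 = - Q $ 2 $ 1" "(Q $ 1 $ 1)\<^sup>2 + (Q $ 2 $ 1)\<^sup>2 = 1"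
proof -
  have o: "transpose Q ** Q = mat 1" and d: "Q $ 1 $ 1 * Q $ 2 $ 2 - Q $ 1 $ 2 * Q $ 2 $ 1 = 1"
    using assms by (simp_all add: rotation_matrix_def orthogonal_matrix det_2)
  have "(transpose Q ** Q) $ 1 $ 1 = 1" "(transpose Q ** Q) $ 2 $ 2 = 1"
    unfolding o by (simp_all add: mat_def)
  then have e: "Q $ 1 $ 1 * Q $ 1 $ 1 + Q $ 2 $ 1 * Q $ 2 $ 1 = 1" "Q $ 1 $ 2 * Q $ 1 $ 2 + Q $ 2 $ 2 * Q $ 2 $ 2 = 1"
    by (simp_all add: matrix_matrix_mult_def transpose_def sum_2)
  have "(Q $ 1 $ 1 - Q $ 2 $ 2)\<^sup>2 + (Q $ 1 $ 2 + Q $ 2 $ 1)\<^sup>2 = 0"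
    using e d by (simp add: power2_eq_square algebra_simps)
  then have "Q $ 1 $ 1 - Q $ 2 $ 2 = 0" "Q $ 1 $ 2 + Q $ 2 $ 1 = 0"
    by (auto simp: sum_power2_eq_zero_iff)
  then show "Q $ 2 $ 2 = Q $ 1 $ 1" "Q $ 1 $ 2 = - Q $ 2 $ 1"
    by auto
  show "(Q $ 1 $ 1)\<^sup>2 + (Q $ 2 $ 1)\<^sup>2 = 1"
    using e(1) by (simp add: power2_eq_square)
qed

lemma G_spaceD:
  assumes "G_space G T Y a" "y \<in> topspace Y"
  shows "g \<in> carrier G \<Longrightarrow> a g y \<in> topspace Y"
    and "g \<in> carrier G \<Longrightarrow> h \<in> carrier G \<Longrightarrow> a (g \<otimes>\<^bsub>G\<^esub> h) y = a g (a h y)"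
    and "a \<one>\<^bsub>G\<^esub> y = y"
proof -
  interpret group_action G "topspace Y" "\<lambda>g. restrict (a g) (topspace Y)"
    using assms(1) by (simp add: G_space_def)
  show 1: "a g y \<in> topspace Y" if "g \<in> carrier G" for g
    using element_image[OF that assms(2) refl] assms(2) by simp
  show "a (g \<otimes>\<^bsub>G\<^esub> h) y = a g (a h y)" if "g \<in> carrier G" "h \<in> carrier G"
    using composition_rule[OF assms(2) that] assms(2) 1[OF that(2)] by simp
  show "a \<one>\<^bsub>G\<^esub> y = y"
    using id_eq_one assms(2) by (metis restrict_apply')
qed

lemma group_action_restrictI:
  assumes G: "group G"
    and "\<And>g y. g \<in> carrier G \<Longrightarrow> y \<in> Y \<Longrightarrow> a g y \<in> Y"
    and "\<And>g h y. g \<in> carrier G \<Longrightarrow> h \<in> carrier G \<Longrightarrow> y \<in> Y \<Longrightarrow> a (g \<otimes>\<^bsub>G\<^esub> h) y = a g (a h y)"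
    and "\<And>y. y \<in> Y \<Longrightarrow> a \<one>\<^bsub>G\<^esub> y = y"
  shows "group_action G Y (\<lambda>g. restrict (a g) Y)"
proof -
  interpret group G by (rule G)
  have bij: "restrict (a g) Y \<in> Bij Y" if g: "g \<in> carrier G" for g
    unfolding Bij_def
  proof
    show "restrict (a g) Y \<in> {f. bij_betw f Y Y}"
    proof
      show "bij_betw (restrict (a g) Y) Y Y"
      proof (rule bij_betw_byWitness[where f' = "a (inv\<^bsub>G\<^esub> g)"])
        show "\<forall>y\<in>Y. a (inv\<^bsub>G\<^esub> g) (restrict (a g) Y y) = y"
          using assms(3)[of "inv\<^bsub>G\<^esub> g" g] assms(4) g by simp
        show "\<forall>y\<in>Y. restrict (a g) Y (a (inv\<^bsub>G\<^esub> g) y) = y"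
          using assms(3)[of g "inv\<^bsub>G\<^esub> g"] assms(2,4) g by simp
      qed (use assms(2) g in auto)
    qed
  qed (auto simp: extensional_def)
  show ?thesis
    unfolding group_action_def group_hom_def group_hom_axioms_def
  proof (intro conjI G group_BijGroup)
    show "(\<lambda>g. restrict (a g) Y) \<in> hom G (BijGroup Y)"
      unfolding hom_def
    proof (intro CollectI conjI ballI)
      show "(\<lambda>g. restrict (a g) Y) \<in> carrier G \<rightarrow> carrier (BijGroup Y)"
        using bij by (simp add: BijGroup_def)
      fix g h assume gh: "g \<in> carrier G" "h \<in> carrier G"
      then show "restrict (a (g \<otimes>\<^bsub>G\<^esub> h)) Y = restrict (a g) Y \<otimes>\<^bsub>BijGroup Y\<^esub> restrict (a h) Y"
        using bij assms(2,3) by (auto simp: BijGroup_def compose_def fun_eq_iff)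
    qed
  qed
qed

definition act :: "nat \<Rightarrow> fmat \<Rightarrow> (nat \<Rightarrow> complex) \<Rightarrow> nat \<Rightarrow> complex"
  where "act N a u l = (\<Sum>m<N. entry a l m * u m)"

lemma act_mult: "a \<in> fmats N \<Longrightarrow> act N (a * b) u = act N a (act N b u)"
  unfolding act_def by (rule ext) (simp add: entry_times[of a N] sum_distrib_left sum_distrib_right mult.assoc, rule sum.swap)

lemma act_add: "act N a (\<lambda>m. u m + v m) = (\<lambda>l. act N a u l + act N a v l)"
  by (rule ext) (simp add: act_def distrib_left sum.distrib)

lemma act_scale: "act N a (\<lambda>m. c * u m) = (\<lambda>l. c * act N a u l)"
  by (rule ext) (simp add: act_def sum_distrib_left mult_ac)

lemma continuous_map_entry:
  assumes "continuous_map Z euclidean a"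
  shows "continuous_map Z euclidean (\<lambda>x. entry (a x) l m)"
  using continuous_map_compose_on[OF continuous_on_entry[OF continuous_on_id] assms, of UNIV] by simp

lemma continuous_map_act:
  assumes "continuous_map Z euclidean a" "\<And>m. m < N \<Longrightarrow> continuous_map Z euclidean (\<lambda>x. u x m)"
  shows "continuous_map Z euclidean (\<lambda>x. act N (a x) (u x) l)"
  unfolding act_def using assms by (intro continuous_map_sum continuous_map_mult continuous_map_entry) auto

lemma continuous_map_fmat_of:
  assumes "\<And>l m. l < N \<Longrightarrow> m < N \<Longrightarrow> continuous_map Z euclidean (\<lambda>x. f x l m)"
  shows "continuous_map Z euclidean (\<lambda>x. fmat_of N (f x))"
proof -
  have "fmat_of N (f x) = (\<Sum>l<N. \<Sum>m<N. f x l m *\<^sub>c elem_fmat l m)" for x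
    by (subst fmat_expand[OF fmat_of_in]) (simp add: entry_fmat_of)
  moreover have "continuous_map Z euclidean (\<lambda>x. f x l m *\<^sub>c elem_fmat l m)" if "l < N" "m < N" for l m
    using continuous_map_compose_on[OF continuous_on_cscale[OF continuous_on_id continuous_on_const] assms[OF that], of UNIV]
    by simp
  then have "continuous_map Z euclidean (\<lambda>x. \<Sum>l<N. \<Sum>m<N. f x l m *\<^sub>c elem_fmat l m)"
    by (intro continuous_map_sum) auto
  ultimately show ?thesis
    by simp
qed

lemma cis_eq_iff: "cis u = cis v \<longleftrightarrow> (\<exists>n::int. u = v + 2 * pi * n)"
  using sin_cos_eq_iff[of u v] by (auto simp: complex_eq_iff)

text \<open>Makes transport along the flow depend on its endpoints alone, which is what trivialises
  the bundle.\<close>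

lemma periodic_flow_cis:
  assumes h: "periodic_flow G N r c h" and "0 \<le> u" "0 \<le> v" "cis u = cis v" "z \<in> circle"
  shows "h u z = h v z"
proof -
  have per: "h (u + 2 * pi * real k) z = h u z" if "0 \<le> u" for u k
  proof (induction k)
    case (Suc k)
    have u': "0 \<le> u + 2 * pi * real k"
      using that by simp
    have "h (u + 2 * pi * real (Suc k)) z = h ((u + 2 * pi * real k) + 2 * pi) z"
      by (simp add: algebra_simps)
    also have "\<dots> = h (u + 2 * pi * real k) z * h 0 z"
      using periodic_flowD(4)[OF h assms(5) u', of "2 * pi"] periodic_flowD(2,3)[OF h assms(5)] by simp
    also have "\<dots> = h (u + 2 * pi * real k) z"
      using periodic_flowD(4)[OF h assms(5) u', of 0] by simp
    finally show ?case
      using Suc by simp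
  qed simp
  obtain n :: int where n: "u = v + 2 * pi * n"
    using assms(4) cis_eq_iff by blast
  show ?thesis
  proof (cases "0 \<le> n")
    case True
    then show ?thesis
      using per[OF assms(3), of "nat n"] n by simp
  next
    case False
    then have "v = u + 2 * pi * real (nat (- n))"
      using n by (simp add: algebra_simps)
    then show ?thesis
      using per[OF assms(2), of "nat (- n)"] by simp
  qed
qed

locale circle_bundle = compact_group G T for G (structure) and T :: "'a topology" +
  fixes \<rho> :: "'a \<Rightarrow> real^2^2" and E :: "(real^2, 'e) vbundle" and b :: "'a \<Rightarrow> 'e \<Rightarrow> 'e"
  assumes rho_mult: "\<And>g h. g \<in> carrier G \<Longrightarrow> h \<in> carrier G \<Longrightarrow> \<rho> (g \<otimes> h) = \<rho> g ** \<rho> h"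
    and rho_rotation: "\<And>g. g \<in> carrier G \<Longrightarrow> rotation_matrix (\<rho> g)"
    and rho_cont: "continuous_map T euclidean \<rho>"
    and base: "base_space E = top_of_set (sphere 0 1)"
    and G_bundle: "complex_G_vector_bundle G T E (\<lambda>g x. \<rho> g *v x) b"
begin

definition rot :: "'a \<Rightarrow> complex"
  where "rot g = Complex (\<rho> g $ 1 $ 1) (\<rho> g $ 2 $ 1)"

lemma of_vec2_rho: "g \<in> carrier G \<Longrightarrow> of_vec2 (\<rho> g *v x) = rot g * of_vec2 x"
  using rotation_matrix_2[OF rho_rotation[of g]]
  by (simp add: of_vec2_def rot_def complex_eq_iff matrix_vector_mult_def sum_2)

lemma rot_mult: "g \<in> carrier G \<Longrightarrow> h \<in> carrier G \<Longrightarrow> rot (g \<otimes> h) = rot g * rot h"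
  using rotation_matrix_2[OF rho_rotation[of g]]
  by (simp add: rot_def rho_mult complex_eq_iff matrix_matrix_mult_def sum_2)

lemma rot_norm: "g \<in> carrier G \<Longrightarrow> cmod (rot g) = 1"
  using rotation_matrix_2(3)[OF rho_rotation[of g]] by (simp add: rot_def cmod_def)

lemma rot_cont: "continuous_map T euclidean rot"
proof -
  have "continuous_on UNIV (\<lambda>M :: real^2^2. complex_of_real (M $ 1 $ 1) + \<i> * complex_of_real (M $ 2 $ 1))"
    by (intro continuous_intros)
  from continuous_map_compose_on[OF this rho_cont] show ?thesis
    by (simp add: rot_def[abs_def] complex_eq_iff Complex_eq)
qed

abbreviation "tot \<equiv> topspace (total_space E)"

lemma top_base: "topspace (base_space E) = sphere 0 1"
  by (simp add: base)

lemma vb: "complex_vector_bundle E"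
  and total_G_space: "G_space G T (total_space E) b"
  and base_G_space: "G_space G T (base_space E) (\<lambda>g x. \<rho> g *v x)"
  and proj_b: "\<And>g e. g \<in> carrier G \<Longrightarrow> e \<in> tot \<Longrightarrow> proj E (b g e) = \<rho> g *v proj E e"
  and linear_b: "\<And>g x. g \<in> carrier G \<Longrightarrow> x \<in> sphere 0 1 \<Longrightarrow> linear_on (fibre E x) (fibre E (\<rho> g *v x)) (b g)"
  using G_bundle unfolding complex_G_vector_bundle_def top_base by blast+

lemma proj_cont: "continuous_map (total_space E) (base_space E) (proj E)"
  using vb by (simp add: complex_vector_bundle_def)

lemma proj_in: "e \<in> tot \<Longrightarrow> proj E e \<in> sphere 0 1"
  using continuous_map_image_subset_topspace[OF proj_cont] top_base by blast

lemma fibreI: "e \<in> tot \<Longrightarrow> e \<in> carrier (fibre E (proj E e))"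
  using fibre_carrier[OF vb] proj_in top_base by simp

lemma fibreD: "y \<in> sphere 0 1 \<Longrightarrow> e \<in> carrier (fibre E y) \<Longrightarrow> e \<in> tot \<and> proj E e = y"
  using fibre_carrier[OF vb] top_base by simp

lemma rho_in: "g \<in> carrier G \<Longrightarrow> y \<in> sphere 0 1 \<Longrightarrow> \<rho> g *v y \<in> sphere 0 1"
  using G_spaceD(1)[OF base_G_space] top_base by simp

lemma b_cont: "continuous_map (prod_topology T (total_space E)) (total_space E) (\<lambda>(g, e). b g e)"
  using total_G_space by (simp add: G_space_def)

lemma functional_b:
  assumes "g \<in> carrier G" "y \<in> sphere 0 1" "fibre_functional E (\<rho> g *v y) f"
  shows "fibre_functional E y (\<lambda>e. f (b g e))"
  using linear_b[OF assms(1,2)] assms(3) by (auto simp: fibre_functional_def linear_on_def Pi_iff)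

lemma of_vec2_circle: "y \<in> sphere 0 1 \<Longrightarrow> of_vec2 y \<in> circle"
  by (simp add: mem_sphere_0)

lemma to_vec2_sphere: "z \<in> circle \<Longrightarrow> to_vec2 z \<in> sphere 0 1"
  by (simp add: mem_sphere_0)

end

section \<open>The matrix cocycle of a framed bundle\<close>

locale framed_circle_bundle = circle_bundle G T \<rho> E b
  for G (structure) and T :: "'a topology" and \<rho> and E :: "(real^2, 'e) vbundle" and b +
  fixes N :: nat and \<xi> :: "nat \<Rightarrow> 'e \<Rightarrow> complex" and \<theta> :: "nat \<Rightarrow> real^2 \<Rightarrow> complex"
    and s :: "nat \<Rightarrow> real^2 \<Rightarrow> 'e"
  assumes frame: "frame E N \<xi> \<theta> s"
begin

lemmas frame_props = frame[unfolded frame_def top_base]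

lemmas xi_cont = frame_props[THEN conjunct1, rule_format]
  and xi_functional = frame_props[THEN conjunct2, THEN conjunct1, rule_format]
  and theta_cont = frame_props[THEN conjunct2, THEN conjunct2, THEN conjunct1, rule_format]
  and frame_support = frame_props[THEN conjunct2, THEN conjunct2, THEN conjunct2, THEN conjunct1, rule_format]
  and frame_expand = frame_props[THEN conjunct2, THEN conjunct2, THEN conjunct2, THEN conjunct2, THEN conjunct1, rule_format]
  and frame_chart = frame_props[THEN conjunct2, THEN conjunct2, THEN conjunct2, THEN conjunct2, THEN conjunct2, rule_format]

lemma section_in: "m < N \<Longrightarrow> y \<in> sphere 0 1 \<Longrightarrow> \<theta> m y \<noteq> 0 \<Longrightarrow> s m y \<in> carrier (fibre E y)"
  using frame_support[of m] by blast

text \<open>The matrix of \<open>b g\<close> in the frame: column \<open>m\<close> holds the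
  coordinates of the translate of the weighted section \<open>s m\<close>. The weight removes the
  section where it is arbitrary.\<close>

definition c :: "'a \<Rightarrow> complex \<Rightarrow> fmat"
  where "c g z = fmat_of N (\<lambda>l m. \<theta> m (to_vec2 z) * \<xi> l (b g (s m (to_vec2 z))))"

definition coords :: "'e \<Rightarrow> nat \<Rightarrow> complex"
  where "coords e m = (if m < N then \<xi> m e else 0)"

lemma act_c:
  assumes "g \<in> carrier G" "e \<in> tot"
  shows "act N (c g (of_vec2 (proj E e))) (coords e) = coords (b g e)"
proof
  fix l
  let ?y = "proj E e"
  show "act N (c g (of_vec2 ?y)) (coords e) l = coords (b g e) l"
  proof (cases "l < N")
    case True
    have "\<xi> l (b g e) = (\<Sum>m<N. \<xi> m e * \<theta> m ?y * \<xi> l (b g (s m ?y)))"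
      using frame_expand[OF proj_in[OF assms(2)] functional_b[OF assms(1) proj_in[OF assms(2)]
          xi_functional[OF True rho_in[OF assms(1) proj_in[OF assms(2)]]]] fibreI[OF assms(2)]] .
    then show ?thesis
      using True by (simp add: act_def c_def entry_fmat_of coords_def mult_ac)
  qed (simp add: act_def c_def entry_fmat_of coords_def)
qed

lemma continuous_to_vec2_snd:
  "continuous_map (prod_topology T (top_of_set circle)) (base_space E) (\<lambda>x. to_vec2 (snd x))"
proof -
  have "continuous_map (prod_topology T (top_of_set circle)) euclidean (\<lambda>x. to_vec2 (snd x))"
    by (intro continuous_map_compose_on[OF continuous_to_vec2]
        continuous_map_into_fulltopology[OF continuous_map_snd]) auto
  then show ?thesis
    unfolding base continuous_map_in_subtopology using to_vec2_sphere by auto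
qed

sublocale circle_cocycle G T N rot c
proof unfold_locales
  show "rot (g \<otimes> h) = rot g * rot h" if "g \<in> carrier G" "h \<in> carrier G" for g h
    using that by (rule rot_mult)
  show "cmod (rot g) = 1" if "g \<in> carrier G" for g
    using that by (rule rot_norm)
  show "continuous_map T euclidean rot"
    by (rule rot_cont)
  show "c g z \<in> fmats N" for g z
    by (simp add: c_def)
  fix g h z assume g: "g \<in> carrier G" and h: "h \<in> carrier G" and z: "z \<in> circle"
  let ?y = "to_vec2 z"
  have y: "?y \<in> sphere 0 1"
    using z by (rule to_vec2_sphere)
  show "c (g \<otimes> h) z = c g (rot h * z) * c h z"
  proof (rule fmat_eqI)
    fix l m
    show "entry (c (g \<otimes> h) z) l m = entry (c g (rot h * z) * c h z) l m"
    proof (cases "l < N \<and> m < N")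
      case True
      \<comment> \<open>Column \<open>m\<close> of \<open>c h z\<close> is a weighted coordinate
        vector of \<open>b h (s m ?y)\<close>, so \<open>act_c\<close> evaluates the product and the
        action law of \<open>b\<close> finishes.\<close>
      have "entry (c g (rot h * z) * c h z) l m =
          (\<Sum>q<N. entry (c g (rot h * z)) l q * (\<theta> m ?y * \<xi> q (b h (s m ?y))))"
        using True by (simp add: entry_times[of _ N] c_def entry_fmat_of)
      also have "\<dots> = \<theta> m ?y * act N (c g (rot h * z)) (coords (b h (s m ?y))) l"
        by (simp add: act_def coords_def sum_distrib_left mult_ac)
      also have "\<dots> = \<theta> m ?y * \<xi> l (b (g \<otimes> h) (s m ?y))"
      proof (cases "\<theta> m ?y = 0")
        case False
        then have e: "s m ?y \<in> tot" "proj E (s m ?y) = ?y"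
          using section_in[of m ?y] fibreD[OF y] True y by auto
        have "of_vec2 (proj E (b h (s m ?y))) = rot h * z"
          using proj_b[OF h e(1)] e(2) of_vec2_rho[OF h, of ?y] by simp
        then have "act N (c g (rot h * z)) (coords (b h (s m ?y))) = coords (b g (b h (s m ?y)))"
          using act_c[OF g G_spaceD(1)[OF total_G_space e(1) h]] by simp
        then show ?thesis
          using True G_spaceD(2)[OF total_G_space e(1) g h] by (simp add: coords_def)
      qed simp
      also have "\<dots> = entry (c (g \<otimes> h) z) l m"
        using True by (simp add: c_def entry_fmat_of)
      finally show ?thesis
        by simp
    next
      case False
      have "c (g \<otimes> h) z \<in> fmats N" "c g (rot h * z) * c h z \<in> fmats N"
        by (simp_all add: c_def)
      then show ?thesis
        using False fmats_entry_0 by metis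
    qed
  qed
next
  let ?Z = "prod_topology T (top_of_set circle)"
  note tv = continuous_to_vec2_snd
  have "continuous_map ?Z euclidean (\<lambda>x. c (fst x) (snd x))"
    unfolding c_def
  proof (rule continuous_map_fmat_of)
    fix l m assume lm: "l < N" "m < N"
    obtain V K where V: "openin (base_space E) V" and K: "closedin (base_space E) K" "K \<subseteq> V"
      and th0: "\<And>y. y \<in> sphere 0 1 \<Longrightarrow> y \<notin> K \<Longrightarrow> \<theta> m y = 0"
      and s_cont: "continuous_map (subtopology (base_space E) V) (total_space E) (s m)"
      using frame_support[OF lm(2)] by metis
    let ?V = "{x \<in> topspace ?Z. to_vec2 (snd x) \<in> V}"
    show "continuous_map ?Z euclidean (\<lambda>x. \<theta> m (to_vec2 (snd x)) * \<xi> l (b (fst x) (s m (to_vec2 (snd x)))))"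
    proof (rule continuous_map_cutoff)
      show "openin ?Z ?V"
        using tv V by (rule openin_continuous_map_preimage)
      show "closedin ?Z {x \<in> topspace ?Z. to_vec2 (snd x) \<in> K}"
        using tv K(1) by (rule closedin_continuous_map_preimage)
      show "{x \<in> topspace ?Z. to_vec2 (snd x) \<in> K} \<subseteq> ?V"
        using K(2) by blast
      show "continuous_map ?Z euclidean (\<lambda>x. \<theta> m (to_vec2 (snd x)))"
        using continuous_map_compose[OF tv theta_cont[OF lm(2)]] by (simp add: o_def)
      have "continuous_map (subtopology ?Z ?V) (subtopology (base_space E) V) (\<lambda>x. to_vec2 (snd x))"
        using continuous_map_from_subtopology[OF tv] by (auto simp: continuous_map_in_subtopology)
      from continuous_map_compose[OF this s_cont]
      have "continuous_map (subtopology ?Z ?V) (total_space E) (\<lambda>x. s m (to_vec2 (snd x)))"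
        by (simp add: o_def)
      from continuous_map_pairedI[OF continuous_map_from_subtopology[OF continuous_map_fst] this]
      have "continuous_map (subtopology ?Z ?V) (prod_topology T (total_space E)) (\<lambda>x. (fst x, s m (to_vec2 (snd x))))" .
      from continuous_map_compose[OF continuous_map_compose[OF this b_cont] xi_cont[OF lm(1)]]
      show "continuous_map (subtopology ?Z ?V) euclidean (\<lambda>x. \<xi> l (b (fst x) (s m (to_vec2 (snd x)))))"
        by (simp add: o_def)
      show "\<theta> m (to_vec2 (snd x)) = 0" if "x \<in> topspace ?Z" "x \<notin> {x \<in> topspace ?Z. to_vec2 (snd x) \<in> K}" for x
        using that by (intro th0 to_vec2_sphere) auto
    qed
  qed
  then show "continuous_map ?Z euclidean (\<lambda>(g, z). c g z)"
    by (simp add: case_prod_unfold)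
qed

text \<open>Chart coordinates of the combination of the sections \<open>s m\<close> with
  coefficients \<open>\<theta> m y * u m\<close>. Applying the chart before summing avoids sums in
  the fibre.\<close>

definition section_coords :: "('e \<Rightarrow> nat \<Rightarrow> complex) \<Rightarrow> real^2 \<Rightarrow> (nat \<Rightarrow> complex) \<Rightarrow> nat \<Rightarrow> complex"
  where "section_coords h y u i = (\<Sum>m<N. \<theta> m y * h (s m y) i * u m)"

text \<open>\<open>section_coords\<close> is a left inverse of taking frame coordinates; in the
  other order the composition is the idempotent \<open>c \<one>\<close>, so it is the identity on
  the vectors fixed by it.\<close>

lemma
  assumes ch: "local_chart E V n h k" and y: "y \<in> V"
  shows section_coords_in: "section_coords h y u \<in> topspace (Complex_space n)"
    and section_coords_coords: "e \<in> tot \<Longrightarrow> proj E e = y \<Longrightarrow> section_coords h y (coords e) = h e"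
    and coords_section_coords: "act N (c \<one> (of_vec2 y)) u = u \<Longrightarrow> coords (k y (section_coords h y u)) = u"
proof -
  note D = local_chartD[OF ch]
  have yS: "y \<in> sphere 0 1"
    using openin_subset[OF D(1)] y top_base by blast
  have s_in: "s m y \<in> tot \<and> proj E (s m y) = y" if "m < N" "\<theta> m y \<noteq> 0" for m
    using section_in[OF that(1) yS that(2)] fibreD[OF yS] by blast
  show 1: "section_coords h y u \<in> topspace (Complex_space n)" for u
    unfolding topspace_Complex_space
  proof (intro CollectI allI impI)
    fix i assume i: "n \<le> i"
    have z: "\<theta> m y * h (s m y) i * u m = 0" if "m < N" for m
    proof (cases "\<theta> m y = 0")
      case False
      then have "h (s m y) \<in> topspace (Complex_space n)"
        using D(2)[of "s m y"] s_in[OF that] y by simp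
      then show ?thesis
        using i by (simp add: topspace_Complex_space)
    qed simp
    show "section_coords h y u i = 0"
      unfolding section_coords_def by (intro sum.neutral ballI z) simp
  qed
  show "section_coords h y (coords e) = h e" if e: "e \<in> tot" "proj E e = y"
  proof
    fix i
    have "fibre_functional E y (\<lambda>e. h e i)"
      unfolding fibre_functional_def using D(7,8)[OF y] by simp
    then have "h e i = (\<Sum>m<N. \<xi> m e * \<theta> m y * h (s m y) i)"
      using frame_expand[OF yS] fibreI[OF e(1)] e(2) by simp
    then show "section_coords h y (coords e) i = h e i"
      by (simp add: section_coords_def coords_def mult_ac)
  qed
  assume u: "act N (c \<one> (of_vec2 y)) u = u"
  let ?w = "section_coords h y u"
  have kw: "k y ?w \<in> tot" "proj E (k y ?w) = y" "h (k y ?w) = ?w"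
    using D(4-6)[OF y 1] by auto
  show "coords (k y ?w) = u"
  proof
    fix l
    show "coords (k y ?w) l = u l"
    proof (cases "l < N")
      case True
      let ?d = "\<lambda>i. \<xi> l (k y (\<lambda>j. if j = i then 1 else 0))"
      note ex = chart_functional_expand[OF vb ch y xi_functional[OF True yS]]
      have "\<xi> l (k y ?w) = (\<Sum>i<n. ?w i * ?d i)"
        using ex[of "k y ?w"] fibreI[OF kw(1)] kw by simp
      also have "\<dots> = (\<Sum>m<N. \<Sum>i<n. \<theta> m y * h (s m y) i * u m * ?d i)"
        unfolding section_coords_def sum_distrib_right by (rule sum.swap)
      also have "\<dots> = (\<Sum>m<N. entry (c \<one> (of_vec2 y)) l m * u m)"
      proof (intro sum.cong refl)
        fix m assume "m \<in> {..<N}"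
        then have m: "m < N"
          by simp
        show "(\<Sum>i<n. \<theta> m y * h (s m y) i * u m * ?d i) = entry (c \<one> (of_vec2 y)) l m * u m"
        proof (cases "\<theta> m y = 0")
          case False
          have "\<xi> l (s m y) = (\<Sum>i<n. h (s m y) i * ?d i)"
            using ex[of "s m y"] section_in[OF m yS False] by simp
          moreover have "b \<one> (s m y) = s m y"
            using G_spaceD(3)[OF total_G_space] s_in[OF m False] by simp
          ultimately show ?thesis
            using True m by (simp add: c_def entry_fmat_of sum_distrib_left sum_distrib_right mult_ac)
        qed (use True m in \<open>simp add: c_def entry_fmat_of\<close>)
      qed
      also have "\<dots> = u l"
        using u unfolding act_def by metis
      finally show ?thesis
        using True by (simp add: coords_def)
    next
      case False
      have "u l = act N (c \<one> (of_vec2 y)) u l"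
        using u by simp
      also have "\<dots> = 0"
        using False by (simp add: act_def c_def entry_fmat_of)
      finally show ?thesis
        using False by (simp add: coords_def)
    qed
  qed
qed

end

text \<open>Transport along the flow from \<open>z\<close> to 1. Since flows run over nonnegative
  times, it completes the turn instead of going back.\<close>

definition to_base :: "(real \<Rightarrow> complex \<Rightarrow> fmat) \<Rightarrow> complex \<Rightarrow> fmat"
  where "to_base h z = h (2 * pi - Arg2pi z) z"

definition from_base :: "(real \<Rightarrow> complex \<Rightarrow> fmat) \<Rightarrow> complex \<Rightarrow> fmat"
  where "from_base h z = h (Arg2pi z) 1"

lemma cis_to_base: "z \<in> circle \<Longrightarrow> cis (2 * pi - Arg2pi z) * z = 1"
proof -
  assume z: "z \<in> circle"
  have "cis (2 * pi - Arg2pi z) * z = cis (2 * pi - Arg2pi z) * cis (Arg2pi z)"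
    using cis_Arg2pi_circle[OF z] by simp
  also have "\<dots> = 1"
    by (simp add: cis_mult)
  finally show ?thesis .
qed

lemma to_base_nonneg: "0 \<le> 2 * pi - Arg2pi z"
  using Arg2pi_lt_2pi[of z] by linarith

section \<open>Transport to the fibre over 1\<close>

context circle_cocycle
begin

context
  fixes h assumes h: "periodic_flow G N r c h"
begin

lemma to_base_eq:
  assumes "0 \<le> u" "z \<in> circle" "cis u * z = 1"
  shows "to_base h z = h u z"
proof -
  have "z \<noteq> 0"
    using assms(3) by auto
  moreover have "cis u * z = cis (2 * pi - Arg2pi z) * z"
    using cis_to_base[OF assms(2)] assms(3) by simp
  ultimately have "cis (2 * pi - Arg2pi z) = cis u"
    by simp
  from periodic_flow_cis[OF h to_base_nonneg assms(1) this assms(2)] show ?thesis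
    by (simp add: to_base_def)
qed

lemma from_base_cis: "0 \<le> t \<Longrightarrow> from_base h (cis t) = h t 1"
  unfolding from_base_def
  by (rule periodic_flow_cis[OF h Arg2pi_ge_0 _ cis_Arg2pi_circle[OF circle_cis] one_circle])

lemma to_base_in: "z \<in> circle \<Longrightarrow> to_base h z \<in> fmats N"
  and from_base_in: "from_base h z \<in> fmats N"
  unfolding to_base_def from_base_def
  using periodic_flowD(1)[OF h _ to_base_nonneg] periodic_flowD(1)[OF h one_circle Arg2pi_ge_0] by auto

lemma to_from_base: "z \<in> circle \<Longrightarrow> to_base h z * from_base h z = c \<one> 1"
  using periodic_flowD(4)[OF h one_circle to_base_nonneg Arg2pi_ge_0, of z z] periodic_flowD(3)[OF h one_circle]
  by (simp add: to_base_def from_base_def cis_Arg2pi_circle)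

lemma from_to_base: "z \<in> circle \<Longrightarrow> from_base h z * to_base h z = c \<one> z"
  using periodic_flowD(4)[OF h _ Arg2pi_ge_0 to_base_nonneg, of z z z] periodic_flowD(3)[OF h, of z]
  by (simp add: to_base_def from_base_def cis_to_base)

lemma one_to_base: "z \<in> circle \<Longrightarrow> c \<one> 1 * to_base h z = to_base h z"
  using periodic_flowD(4)[OF h _ order_refl to_base_nonneg, of z z] periodic_flowD(2)[OF h one_circle]
  by (simp add: to_base_def cis_to_base)

lemma one_from_base: "z \<in> circle \<Longrightarrow> c \<one> z * from_base h z = from_base h z"
  using periodic_flowD(4)[OF h one_circle order_refl Arg2pi_ge_0, of z] periodic_flowD(2)[OF h, of z]
  by (simp add: from_base_def cis_Arg2pi_circle)

text \<open>The factor in front of \<open>to_base h z\<close> is the action of \<open>g\<close> on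
  the transported fibre, and it does not involve \<open>z\<close>. The combined time
  \<open>v + u\<close> carries \<open>r g * z\<close> to 1; equivariance moves \<open>g\<close> past
  the flow, and the flow law cuts off the stretch from \<open>z\<close> to 1.\<close>

lemma to_base_equivariant:
  assumes g: "g \<in> carrier G" and z: "z \<in> circle"
  shows "to_base h (r g * z) * c g z = to_base h (r g) * c g 1 * to_base h z"
proof -
  define u v where "u = 2 * pi - Arg2pi z" and "v = 2 * pi - Arg2pi (r g)"
  have rg: "r g \<in> circle" "r g * z \<in> circle"
    using r_norm[OF g] z by (simp_all add: mem_sphere_0 norm_mult)
  have u: "0 \<le> u" "cis u * z = 1" and v: "0 \<le> v" "cis v * r g = 1"
    using to_base_nonneg cis_to_base z rg(1) by (simp_all add: u_def v_def)
  have vu: "cis (v + u) * (r g * z) = (cis v * r g) * (cis u * z)"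
    by (simp only: cis_mult[symmetric] mult_ac)
  have "to_base h (r g * z) * c g z = h (v + u) (r g * z) * c g z"
    using to_base_eq[of "v + u" "r g * z"] u v vu rg(2) by simp
  also have "\<dots> = c g (cis (v + u) * z) * h (v + u) z"
    using u(1) v(1) by (intro periodic_flowD(5)[OF h z g]) simp
  also have "cis (v + u) * z = cis v"
    using u(2) by (simp add: cis_mult[symmetric])
  also have "h (v + u) z = h v 1 * to_base h z"
    using periodic_flowD(4)[OF h z v(1) u(1)] u(2) to_base_eq[OF u(1) z u(2)] by simp
  also have "c g (cis v) * (h v 1 * to_base h z) = h v (r g) * c g 1 * to_base h z"
    using periodic_flowD(5)[OF h one_circle g v(1)] by (simp add: mult.assoc)
  also have "h v (r g) = to_base h (r g)"
    using to_base_eq[OF v(1) rg(1) v(2)] by simp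
  finally show ?thesis .
qed

lemma continuous_from_base: "continuous_on circle (from_base h)"
proof -
  have "continuous_on (UNIV \<times> {0..}) (\<lambda>(x :: real, t). h t 1)"
  proof -
    have "continuous_on (UNIV \<times> {0..}) (\<lambda>x :: real \<times> real. (\<lambda>(t, z). h t z) (snd x, 1))"
      by (rule continuous_on_compose2[of "{0..} \<times> circle"])
        (use h one_circle in \<open>auto simp: periodic_flow_def intro!: continuous_intros\<close>)
    then show ?thesis
      by (simp add: case_prod_unfold)
  qed
  then have "continuous_on (UNIV \<times> circle) (\<lambda>(x :: real, z). from_base h z)"
    by (rule continuous_on_circle_param) (simp add: from_base_cis)
  then have "continuous_on circle (\<lambda>z. (\<lambda>(x :: real, z). from_base h z) (0, z))"
    by (rule continuous_on_compose2) (auto intro!: continuous_intros)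
  then show ?thesis
    by simp
qed

lemma continuous_to_base: "continuous_on circle (to_base h)"
proof -
  have "continuous_on (UNIV \<times> {0..}) (\<lambda>(x :: real, t). h t (cis (- t)))"
  proof -
    have "continuous_on (UNIV \<times> {0..}) (\<lambda>x :: real \<times> real. (\<lambda>(t, z). h t z) (snd x, cis (- snd x)))"
      by (rule continuous_on_compose2[of "{0..} \<times> circle"])
        (use h circle_cis in \<open>auto simp: periodic_flow_def intro!: continuous_intros\<close>)
    then show ?thesis
      by (simp add: case_prod_unfold)
  qed
  \<comment> \<open>From \<open>cis (- t)\<close> the time \<open>t\<close> leads to 1, so the
    conjugate variable is the one parametrised by nonnegative times. The real variable
    \<open>x\<close> is a dummy parameter.\<close>
  then have "continuous_on (UNIV \<times> circle) (\<lambda>(x :: real, z). to_base h (cnj z))"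
  proof (rule continuous_on_circle_param)
    fix x t :: real assume "0 \<le> t"
    then show "to_base h (cnj (cis t)) = h t (cis (- t))"
      using to_base_eq[of t "cis (- t)", OF _ circle_cis] by (simp add: cis_cnj cis_mult)
  qed
  then have "continuous_on circle (\<lambda>z. (\<lambda>(x :: real, z). to_base h (cnj z)) (0, cnj z))"
    by (rule continuous_on_compose2) (auto intro!: continuous_intros simp: mem_sphere_0)
  then show ?thesis
    by simp
qed

end

end

lemma act_fixed: "p \<in> fmats N \<Longrightarrow> p * a = a \<Longrightarrow> act N p (act N a u) = act N a u"
  by (metis act_mult)

lemma carrier_complex_vectors [simp]: "carrier (complex_vectors n) = topspace (Complex_space n)"
  by (simp add: complex_vectors_def)

section \<open>The equivariant trivialisation\<close>

locale trivialised_circle_bundle = framed_circle_bundle G T \<rho> E b N \<xi> \<theta> s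
  for G (structure) and T :: "'a topology" and \<rho> and E :: "(real^2, 'e) vbundle" and b and N \<xi> \<theta> s +
  fixes h :: "real \<Rightarrow> complex \<Rightarrow> fmat" and V0 n h0 k0
  assumes flow: "periodic_flow G N rot c h"
    and chart0: "local_chart E V0 n h0 k0" and base0: "to_vec2 1 \<in> V0"
begin

abbreviation "Cn \<equiv> Complex_space n"

definition coords0 :: "(nat \<Rightarrow> complex) \<Rightarrow> nat \<Rightarrow> complex"
  where "coords0 w = coords (k0 (to_vec2 1) w)"

text \<open>Transport the frame coordinates to the fibre over 1 and read the result in one fixed
  chart there, so that the model fibre has the true dimension \<open>n\<close> instead of
  \<open>N\<close>.\<close>

definition triv :: "'e \<Rightarrow> nat \<Rightarrow> complex"
  where "triv e = section_coords h0 (to_vec2 1) (act N (to_base h (of_vec2 (proj E e))) (coords e))"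

text \<open>The action of \<open>g\<close> on the fibre over 1 followed by transport back from
  \<open>rot g\<close>, as in \<open>to_base_equivariant\<close>.\<close>

definition sigma :: "'a \<Rightarrow> (nat \<Rightarrow> complex) \<Rightarrow> nat \<Rightarrow> complex"
  where "sigma g w = section_coords h0 (to_vec2 1) (act N (to_base h (rot g) * c g 1) (coords0 w))"

definition triv_inv ::
  "('e \<Rightarrow> nat \<Rightarrow> complex) \<Rightarrow> (real^2 \<Rightarrow> (nat \<Rightarrow> complex) \<Rightarrow> 'e) \<Rightarrow> real^2 \<Rightarrow> (nat \<Rightarrow> complex) \<Rightarrow> 'e"
  where "triv_inv hc k y w = k y (section_coords hc y (act N (from_base h (of_vec2 y)) (coords0 w)))"

lemma proj_circle: "e \<in> tot \<Longrightarrow> of_vec2 (proj E e) \<in> circle"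
  by (rule of_vec2_circle[OF proj_in])

lemma c_one_in: "z \<in> circle \<Longrightarrow> c \<one> z \<in> fmats N"
  by (rule c_in[OF one_closed])

lemma coords_fixed: "e \<in> tot \<Longrightarrow> act N (c \<one> (of_vec2 (proj E e))) (coords e) = coords e"
  using act_c[OF one_closed] G_spaceD(3)[OF total_G_space] by simp

lemma coords0_fixed: "w \<in> topspace Cn \<Longrightarrow> act N (c \<one> 1) (coords0 w) = coords0 w"
  using coords_fixed[of "k0 (to_vec2 1) w"] local_chartD(4,5)[OF chart0 base0] by (simp add: coords0_def)

lemma triv_in: "triv e \<in> topspace Cn"
  unfolding triv_def by (rule section_coords_in[OF chart0 base0])

lemma coords0_triv:
  assumes "e \<in> tot"
  shows "coords0 (triv e) = act N (to_base h (of_vec2 (proj E e))) (coords e)"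
  unfolding coords0_def triv_def
  using act_fixed[OF c_one_in[OF one_circle] one_to_base[OF flow proj_circle[OF assms]]]
  by (intro coords_section_coords[OF chart0 base0]) simp

lemma triv_inv_triv:
  assumes ch: "local_chart E V n' hc k" and e: "e \<in> tot" "proj E e \<in> V"
  shows "triv_inv hc k (proj E e) (triv e) = e"
proof -
  have "act N (from_base h (of_vec2 (proj E e))) (coords0 (triv e)) = coords e"
    unfolding coords0_triv[OF e(1)] act_mult[OF from_base_in[OF flow], symmetric]
      from_to_base[OF flow proj_circle[OF e(1)]] by (rule coords_fixed[OF e(1)])
  then show ?thesis
    using section_coords_coords[OF ch e(2) e(1)] local_chartD(3)[OF ch e] by (simp add: triv_inv_def)
qed

lemma
  assumes ch: "local_chart E V n' hc k" and y: "y \<in> V" and w: "w \<in> topspace Cn"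
  shows triv_inv_in: "triv_inv hc k y w \<in> tot" and proj_triv_inv: "proj E (triv_inv hc k y w) = y"
    and triv_triv_inv: "triv (triv_inv hc k y w) = w"
    and coords_triv_inv: "coords (triv_inv hc k y w) = act N (from_base h (of_vec2 y)) (coords0 w)"
proof -
  let ?z = "of_vec2 y" and ?u = "act N (from_base h (of_vec2 y)) (coords0 w)"
  have z: "?z \<in> circle"
    using openin_subset[OF local_chartD(1)[OF ch]] y top_base by (intro of_vec2_circle) blast
  have S: "section_coords hc y ?u \<in> topspace (Complex_space n')"
    by (rule section_coords_in[OF ch y])
  show "triv_inv hc k y w \<in> tot" and pr: "proj E (triv_inv hc k y w) = y"
    using local_chartD(4,5)[OF ch y S] by (simp_all add: triv_inv_def)
  show co: "coords (triv_inv hc k y w) = ?u"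
    unfolding triv_inv_def
    by (rule coords_section_coords[OF ch y act_fixed[OF c_one_in[OF z] one_from_base[OF flow z]]])
  have "triv (triv_inv hc k y w) = section_coords h0 (to_vec2 1) (coords0 w)"
    unfolding triv_def pr co act_mult[OF to_base_in[OF flow z], symmetric] to_from_base[OF flow z]
      coords0_fixed[OF w] ..
  also have "\<dots> = w"
    unfolding coords0_def
    using section_coords_coords[OF chart0 base0] local_chartD(4-6)[OF chart0 base0 w] by simp
  finally show "triv (triv_inv hc k y w) = w" .
qed

lemma triv_equivariant:
  assumes g: "g \<in> carrier G" and e: "e \<in> tot"
  shows "triv (b g e) = sigma g (triv e)"
proof -
  let ?z = "of_vec2 (proj E e)"
  have z: "?z \<in> circle" "rot g * ?z \<in> circle" "rot g \<in> circle"
    using proj_circle[OF e] r_norm[OF g] by (simp_all add: mem_sphere_0 norm_mult)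
  have in1: "to_base h (rot g) * c g 1 \<in> fmats N"
    using to_base_in[OF flow z(3)] c_in[OF g one_circle] by (rule fmats_mult)
  have "act N (to_base h (rot g * ?z)) (coords (b g e)) = act N (to_base h (rot g * ?z) * c g ?z) (coords e)"
    unfolding act_mult[OF to_base_in[OF flow z(2)]] act_c[OF g e] ..
  also have "\<dots> = act N (to_base h (rot g) * c g 1) (coords0 (triv e))"
    unfolding to_base_equivariant[OF flow g z(1)] act_mult[OF in1] coords0_triv[OF e] ..
  finally show ?thesis
    using proj_b[OF g e] of_vec2_rho[OF g] by (simp add: triv_def sigma_def)
qed

lemma triv_surj:
  assumes "w \<in> topspace Cn"
  obtains e where "e \<in> tot" "triv e = w"
  using triv_inv_in[OF chart0 base0 assms] triv_triv_inv[OF chart0 base0 assms] by (rule that)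

lemma section_coords_add:
  "section_coords hc y (\<lambda>m. u m + v m) = (\<lambda>i. section_coords hc y u i + section_coords hc y v i)"
  by (rule ext) (simp add: section_coords_def distrib_left sum.distrib)

lemma section_coords_scale:
  "section_coords hc y (\<lambda>m. a * u m) = (\<lambda>i. a * section_coords hc y u i)"
  by (rule ext) (simp add: section_coords_def sum_distrib_left mult_ac)

lemma base_sphere: "to_vec2 1 \<in> sphere 0 1"
  by (simp add: mem_sphere_0)

lemma coords0_add:
  "u \<in> topspace Cn \<Longrightarrow> v \<in> topspace Cn \<Longrightarrow> coords0 (\<lambda>i. u i + v i) = (\<lambda>m. coords0 u m + coords0 v m)"
  using chart_inverse_linear(1)[OF vb chart0 base0 xi_functional[OF _ base_sphere]]
  by (auto simp: coords0_def coords_def)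

lemma coords0_scale:
  "u \<in> topspace Cn \<Longrightarrow> coords0 (\<lambda>i. a * u i) = (\<lambda>m. a * coords0 u m)"
  using chart_inverse_linear(2)[OF vb chart0 base0 xi_functional[OF _ base_sphere]]
  by (auto simp: coords0_def coords_def)

lemma sigma_in: "sigma g w \<in> topspace Cn"
  unfolding sigma_def by (rule section_coords_in[OF chart0 base0])

lemma continuous_map_circle_fmat:
  assumes "continuous_on circle a" "continuous_map Z euclidean f" "\<And>x. x \<in> topspace Z \<Longrightarrow> f x \<in> circle"
  shows "continuous_map Z euclidean (\<lambda>x. a (f x) :: fmat)"
  by (rule continuous_map_compose_on[OF assms(1,2)]) (use assms(3) in auto)

lemma continuous_map_section_coords:
  assumes "\<And>m. m < N \<Longrightarrow> continuous_map Z euclidean (\<lambda>x. u x m)"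
  shows "continuous_map Z Cn (\<lambda>x. section_coords h0 (to_vec2 1) (u x))"
  unfolding continuous_map_Complex_space
proof (intro conjI allI ballI impI)
  show "continuous_map Z euclidean (\<lambda>x. section_coords h0 (to_vec2 1) (u x) i)" for i
    unfolding section_coords_def using assms
    by (intro continuous_map_sum continuous_map_mult) auto
  show "section_coords h0 (to_vec2 1) (u x) i = 0" if "n \<le> i" for x i
    using section_coords_in[OF chart0 base0] that by (simp add: topspace_Complex_space)
qed

lemma continuous_map_coords0:
  assumes "continuous_map Z Cn f" "m < N"
  shows "continuous_map Z euclidean (\<lambda>x. coords0 (f x) m)"
proof -
  have "continuous_map Z (prod_topology (subtopology (base_space E) V0) Cn) (\<lambda>x. (to_vec2 1, f x))"
    using base0 base_sphere top_base assms(1) by (intro continuous_map_pairedI) auto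
  from continuous_map_compose[OF continuous_map_compose[OF this local_chartD(10)[OF chart0]] xi_cont[OF assms(2)]]
  show ?thesis
    using assms(2) by (simp add: o_def coords0_def coords_def)
qed

lemma continuous_triv: "continuous_map (total_space E) Cn triv"
  unfolding triv_def[abs_def]
proof (intro continuous_map_section_coords continuous_map_act)
  have "continuous_map (total_space E) euclidean (proj E)"
    using proj_cont unfolding base by (rule continuous_map_into_fulltopology)
  then have "continuous_map (total_space E) euclidean (\<lambda>e. of_vec2 (proj E e))"
    using continuous_map_compose_on[OF continuous_of_vec2[of UNIV]] by simp
  then show "continuous_map (total_space E) euclidean (\<lambda>e. to_base h (of_vec2 (proj E e)))"
    by (rule continuous_map_circle_fmat[OF continuous_to_base[OF flow] _ proj_circle])
  show "continuous_map (total_space E) euclidean (\<lambda>e. coords e m)" if "m < N" for m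
    using xi_cont[OF that] that by (simp add: coords_def)
qed

text \<open>The action laws are inherited from \<open>b\<close>: \<open>triv\<close> is onto and
  carries \<open>b g\<close> to \<open>sigma g\<close>. Continuity and linearity are read off from
  the formula.\<close>

lemma module_sigma: "complex_G_module G T n sigma"
proof -
  have group_action: "group_action G (topspace Cn) (\<lambda>g. restrict (sigma g) (topspace Cn))"
  proof (rule group_action_restrictI[OF is_group sigma_in])
    fix g g' w assume g: "g \<in> carrier G" "g' \<in> carrier G" and w: "w \<in> topspace Cn"
    obtain e where e: "e \<in> tot" "triv e = w"
      by (rule triv_surj[OF w])
    have "sigma (g \<otimes> g') w = triv (b (g \<otimes> g') e)"
      using triv_equivariant[of "g \<otimes> g'" e] g e by simp
    also have "\<dots> = triv (b g (b g' e))"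
      using G_spaceD(2)[OF total_G_space e(1) g] by simp
    also have "\<dots> = sigma g (sigma g' w)"
      using triv_equivariant[OF g(1) G_spaceD(1)[OF total_G_space e(1) g(2)]] triv_equivariant[OF g(2) e(1)] e(2)
      by simp
    finally show "sigma (g \<otimes> g') w = sigma g (sigma g' w)" .
  next
    fix w assume w: "w \<in> topspace Cn"
    obtain e where e: "e \<in> tot" "triv e = w"
      by (rule triv_surj[OF w])
    show "sigma \<one> w = w"
      using triv_equivariant[OF one_closed e(1)] e G_spaceD(3)[OF total_G_space e(1)] by simp
  qed
  let ?Z = "prod_topology T Cn"
  have "continuous_map ?Z Cn (\<lambda>x. sigma (fst x) (snd x))"
    unfolding sigma_def
  proof (intro continuous_map_section_coords continuous_map_act continuous_map_mult continuous_map_coords0)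
    have rot: "continuous_map ?Z euclidean (\<lambda>x. rot (fst x))"
      using continuous_map_compose[OF continuous_map_fst r_cont] by (simp add: o_def)
    show "continuous_map ?Z euclidean (\<lambda>x. to_base h (rot (fst x)))"
      by (rule continuous_map_circle_fmat[OF continuous_to_base[OF flow] rot])
        (auto simp: topspace_T mem_sphere_0 r_norm)
    show "continuous_map ?Z euclidean (\<lambda>x. c (fst x) 1)"
      by (rule continuous_map_c[OF continuous_map_fst]) auto
    show "continuous_map ?Z Cn snd"
      by (rule continuous_map_snd)
  qed
  then have "G_space G T Cn sigma"
    using group_action by (simp add: G_space_def case_prod_unfold)
  moreover have "linear_on (complex_vectors n) (complex_vectors n) (sigma g)" for g
    unfolding linear_on_def carrier_complex_vectors
  proof (intro conjI ballI allI)
    show "sigma g \<in> topspace Cn \<rightarrow> topspace Cn"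
      using sigma_in by blast
    show "sigma g (u \<oplus>\<^bsub>complex_vectors n\<^esub> v) = sigma g u \<oplus>\<^bsub>complex_vectors n\<^esub> sigma g v"
      if "u \<in> topspace Cn" "v \<in> topspace Cn" for u v
      using that by (simp add: complex_vectors_def sigma_def coords0_add act_add section_coords_add)
    show "sigma g (a \<odot>\<^bsub>complex_vectors n\<^esub> v) = a \<odot>\<^bsub>complex_vectors n\<^esub> sigma g v"
      if "v \<in> topspace Cn" for a v
      using that by (simp add: complex_vectors_def sigma_def coords0_scale act_scale section_coords_scale)
  qed
  ultimately show ?thesis
    by (simp add: complex_G_module_def)
qed

lemma triv_linear:
  assumes y: "y \<in> sphere 0 1" and u: "u \<in> carrier (fibre E y)"
  shows "v \<in> carrier (fibre E y) \<Longrightarrow> triv (u \<oplus>\<^bsub>fibre E y\<^esub> v) = (\<lambda>i. triv u i + triv v i)"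
    and "triv (a \<odot>\<^bsub>fibre E y\<^esub> u) = (\<lambda>i. a * triv u i)"
proof -
  have yB: "y \<in> topspace (base_space E)"
    using y top_base by simp
  note closed = fibre_closed[OF vb yB u]
  have pr: "proj E e = y" if "e \<in> carrier (fibre E y)" for e
    using fibreD[OF y that] by simp
  note lin = xi_functional[OF _ y, unfolded fibre_functional_def]
  show "triv (u \<oplus>\<^bsub>fibre E y\<^esub> v) = (\<lambda>i. triv u i + triv v i)" if v: "v \<in> carrier (fibre E y)"
  proof -
    have "coords (u \<oplus>\<^bsub>fibre E y\<^esub> v) = (\<lambda>m. coords u m + coords v m)"
      using lin u v by (auto simp: coords_def)
    then show ?thesis
      using pr u v closed(1)[OF v] by (simp add: triv_def act_add section_coords_add)
  qed
  have "coords (a \<odot>\<^bsub>fibre E y\<^esub> u) = (\<lambda>m. a * coords u m)"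
    using lin u by (auto simp: coords_def)
  then show "triv (a \<odot>\<^bsub>fibre E y\<^esub> u) = (\<lambda>i. a * triv u i)"
    using pr u closed(2) by (simp add: triv_def act_scale section_coords_scale)
qed

text \<open>The inverse is described without a chart, so that the formulas \<open>triv_inv\<close>
  from different charts are values of one function.\<close>

definition total_inv :: "(real^2) \<times> (nat \<Rightarrow> complex) \<Rightarrow> 'e"
  where "total_inv x = (THE e. e \<in> tot \<and> proj E e = fst x \<and> triv e = snd x)"

lemma total_inv_eq:
  assumes ch: "local_chart E V n' hc k" and "fst x \<in> V" "snd x \<in> topspace Cn"
  shows "total_inv x = triv_inv hc k (fst x) (snd x)"
  unfolding total_inv_def
proof (rule the_equality)
  show "triv_inv hc k (fst x) (snd x) \<in> tot \<and> proj E (triv_inv hc k (fst x) (snd x)) = fst x \<and>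
      triv (triv_inv hc k (fst x) (snd x)) = snd x"
    using triv_inv_in[OF assms] proj_triv_inv[OF assms] triv_triv_inv[OF assms] by simp
  show "e = triv_inv hc k (fst x) (snd x)" if "e \<in> tot \<and> proj E e = fst x \<and> triv e = snd x" for e
    using triv_inv_triv[OF ch, of e] that assms(2) by simp
qed

lemma total_inv:
  assumes "x \<in> topspace (prod_topology (base_space E) Cn)"
  shows "total_inv x \<in> tot" "proj E (total_inv x) = fst x" "triv (total_inv x) = snd x"
proof -
  have x: "fst x \<in> topspace (base_space E)" "snd x \<in> topspace Cn"
    using assms by auto
  obtain V n' hc k where ch: "local_chart E V n' hc k" "fst x \<in> V"
    by (rule local_chart_exists[OF vb x(1)])
  show "total_inv x \<in> tot" "proj E (total_inv x) = fst x" "triv (total_inv x) = snd x"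
    unfolding total_inv_eq[OF ch x(2)]
    using triv_inv_in[OF ch x(2)] proj_triv_inv[OF ch x(2)] triv_triv_inv[OF ch x(2)] by simp_all
qed

lemma total_inv_triv:
  assumes "e \<in> tot"
  shows "total_inv (proj E e, triv e) = e"
proof -
  have "proj E e \<in> topspace (base_space E)"
    using proj_in[OF assms] top_base by simp
  then obtain V n' hc k where ch: "local_chart E V n' hc k" "proj E e \<in> V"
    by (rule local_chart_exists[OF vb])
  show ?thesis
    using total_inv_eq[OF ch(1), of "(proj E e, triv e)"] ch triv_in triv_inv_triv[OF ch(1) assms ch(2)] by simp
qed

text \<open>In a chart of arbitrary origin, \<open>section_coords\<close> involves sections that
  need not be continuous there. The charts supplied by the frame express chart coordinates through
  frame coordinates, which transport continuously.\<close>

lemma continuous_total_inv: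
  "continuous_map (prod_topology (base_space E) Cn) (total_space E) total_inv"
proof (rule continuous_map_locally)
  let ?P = "prod_topology (base_space E) Cn"
  fix x0 assume x0: "x0 \<in> topspace ?P"
  then have "fst x0 \<in> sphere 0 1"
    using x0 by (simp add: mem_Times_iff top_base)
  from frame_chart[OF this] obtain V n' hc k j u where ch: "local_chart E V n' hc k" "fst x0 \<in> V"
    and u: "continuous_map (subtopology (base_space E) V) euclidean u" "\<forall>x\<in>V. u x \<noteq> 0"
    and j: "\<forall>l<n'. j l < N \<and> (\<forall>e\<in>tot. proj E e \<in> V \<longrightarrow> \<xi> (j l) e = u (proj E e) * hc e l)"
    by (elim exE conjE) (rule that)
  let ?W = "{x \<in> topspace ?P. fst x \<in> V}"
  let ?PW = "subtopology ?P ?W"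
  let ?U = "\<lambda>x. act N (from_base h (of_vec2 (fst x))) (coords0 (snd x))"
  have fstB: "continuous_map ?PW (base_space E) fst" and sndC: "continuous_map ?PW Cn snd"
    by (simp_all add: continuous_map_from_subtopology continuous_map_fst continuous_map_snd)
  have fstV: "continuous_map ?PW (subtopology (base_space E) V) fst"
    using fstB by (auto simp: continuous_map_in_subtopology)
  have "continuous_map ?PW euclidean fst"
    using fstB unfolding base by (rule continuous_map_into_fulltopology)
  then have "continuous_map ?PW euclidean (\<lambda>x. of_vec2 (fst x))"
    using continuous_map_compose_on[OF continuous_of_vec2[of UNIV]] by simp
  then have "continuous_map ?PW euclidean (\<lambda>x. from_base h (of_vec2 (fst x)))"
    by (rule continuous_map_circle_fmat[OF continuous_from_base[OF flow]]) (use top_base of_vec2_circle in auto)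
  then have U: "continuous_map ?PW euclidean (\<lambda>x. ?U x l)" for l
    by (rule continuous_map_act) (rule continuous_map_coords0[OF sndC])
  have "continuous_map ?PW (Complex_space n') (\<lambda>x. section_coords hc (fst x) (?U x))"
    unfolding continuous_map_Complex_space
  proof (intro conjI allI ballI impI)
    show zero: "section_coords hc (fst x) (?U x) i = 0" if "x \<in> topspace ?PW" "n' \<le> i" for x i
      using section_coords_in[OF ch(1), of "fst x"] that by (simp add: topspace_Complex_space)
    fix i
    show "continuous_map ?PW euclidean (\<lambda>x. section_coords hc (fst x) (?U x) i)"
    proof (cases "i < n'")
      case True
      \<comment> \<open>The frame coordinate \<open>j i\<close> is the weight \<open>u\<close> times
        the chart coordinate \<open>i\<close>; dividing by \<open>u\<close> gives a visibly
        continuous formula for the latter.\<close>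
      have "continuous_map ?PW euclidean (\<lambda>x. inverse (u (fst x)) * ?U x (j i))"
      proof (intro continuous_map_mult U)
        have "continuous_map ?PW euclidean (\<lambda>x. u (fst x))"
          using continuous_map_compose[OF fstV u(1)] by (simp add: o_def)
        then show "continuous_map ?PW euclidean (\<lambda>x. inverse (u (fst x)))"
          by (intro continuous_map_compose_on[of "- {0}" inverse]) (use u(2) in \<open>auto intro!: continuous_intros\<close>)
      qed
      then show ?thesis
      proof (rule continuous_map_eq)
        fix x assume x: "x \<in> topspace ?PW"
        then have x': "fst x \<in> V" "snd x \<in> topspace Cn"
          by auto
        let ?e = "triv_inv hc k (fst x) (snd x)"
        have e: "?e \<in> tot" "proj E ?e = fst x" "coords ?e = ?U x"
          using triv_inv_in[OF ch(1) x'] proj_triv_inv[OF ch(1) x'] coords_triv_inv[OF ch(1) x'] by auto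
        have "?U x (j i) = u (fst x) * hc ?e i"
          using j True e x'(1) by (simp add: coords_def flip: e(3))
        also have "hc ?e = section_coords hc (fst x) (?U x)"
          unfolding triv_inv_def by (rule local_chartD(6)[OF ch(1) x'(1) section_coords_in[OF ch(1) x'(1)]])
        finally show "inverse (u (fst x)) * ?U x (j i) = section_coords hc (fst x) (?U x) i"
          using u(2) x'(1) by simp
      qed
    next
      case False
      show ?thesis
        by (rule continuous_map_eq[of _ _ "\<lambda>x. 0"]) (use zero False in auto)
    qed
  qed
  from continuous_map_compose[OF continuous_map_pairedI[OF fstV this] local_chartD(10)[OF ch(1)]]
  have "continuous_map ?PW (total_space E) (\<lambda>x. triv_inv hc k (fst x) (snd x))"
    by (simp add: o_def triv_inv_def)
  then have "continuous_map ?PW (total_space E) total_inv"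
    by (rule continuous_map_eq) (use total_inv_eq[OF ch(1)] in auto)
  moreover have "openin ?P ?W"
    by (rule openin_continuous_map_preimage[OF continuous_map_fst local_chartD(1)[OF ch(1)]])
  ultimately show "\<exists>V. openin ?P V \<and> x0 \<in> V \<and> continuous_map (subtopology ?P V) (total_space E) total_inv"
    using x0 ch(2) by (intro exI[of _ ?W]) auto
qed

lemma trivial: "trivial_G_vector_bundle G T E (\<lambda>g x. \<rho> g *v x) b"
proof -
  let ?f = "\<lambda>e. (proj E e, triv e)" and ?F = "product_bundle (base_space E) n"
  have "homeomorphic_maps (total_space E) (prod_topology (base_space E) Cn) ?f total_inv"
    unfolding homeomorphic_maps_def
  proof (intro conjI ballI continuous_map_pairedI proj_cont continuous_triv continuous_total_inv)
    show "total_inv (?f e) = e" if "e \<in> tot" for e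
      using that by (rule total_inv_triv)
    show "?f (total_inv x) = x" if "x \<in> topspace (prod_topology (base_space E) Cn)" for x
      using total_inv(2,3)[OF that] by simp
  qed
  then have hom: "homeomorphic_map (total_space E) (total_space ?F) ?f"
    using homeomorphic_maps_imp_map by (simp add: product_bundle_def) blast
  have lin: "linear_on (fibre E y) (fibre ?F y) ?f" if y: "y \<in> sphere 0 1" for y
  proof -
    have yB: "y \<in> topspace (base_space E)"
      using y top_base by simp
    have pr: "proj E e = y" if "e \<in> carrier (fibre E y)" for e
      using fibreD[OF y that] by simp
    show ?thesis
      unfolding linear_on_def
      using pr fibre_closed[OF vb yB] triv_in triv_linear[OF y]
      by (simp add: product_bundle_def complex_vectors_def)
  qed
  have "G_bundle_iso G E b ?F (\<lambda>g (x, w). (\<rho> g *v x, sigma g w)) ?f"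
    unfolding G_bundle_iso_def bundle_iso_def
  proof (intro conjI ballI hom)
    show "linear_on (fibre E y) (fibre ?F y) ?f" if "y \<in> topspace (base_space E)" for y
      using that top_base by (intro lin) simp
    show "?f (b g e) = (case ?f e of (x, w) \<Rightarrow> (\<rho> g *v x, sigma g w))" if "g \<in> carrier G" "e \<in> tot" for g e
      using proj_b[OF that] triv_equivariant[OF that] by simp
  qed (simp_all add: product_bundle_def)
  then show ?thesis
    unfolding trivial_G_vector_bundle_def using module_sigma by blast
qed

end

lemma (in framed_circle_bundle) trivial_framed: "trivial_G_vector_bundle G T E (\<lambda>g x. \<rho> g *v x) b"
proof -
  obtain h where h: "periodic_flow G N rot c h"
    using periodic_flow_exists[OF circle_cocycle_axioms] by (rule exE)
  have "to_vec2 1 \<in> topspace (base_space E)"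
    by (simp add: top_base mem_sphere_0)
  then obtain V n hc k where "local_chart E V n hc k" "to_vec2 1 \<in> V"
    by (rule local_chart_exists[OF vb])
  then interpret trivialised_circle_bundle G T \<rho> E b N \<xi> \<theta> s h V n hc k
    by unfold_locales (use h in auto)
  show ?thesis
    by (rule trivial)
qed

theorem corollary4:
  fixes G :: "('g, 'm) monoid_scheme"
    and T :: "'g topology" and d :: nat and A :: "'g chart set"
    and \<rho> :: "'g \<Rightarrow> real^2^2"
    and E :: "(real^2, 'e) vbundle"
    and b :: "'g \<Rightarrow> 'e \<Rightarrow> 'e"
  assumes "compact_lie_group G T d A"
    and "orthogonal_representation G T \<rho>"
    and "\<rho> ` carrier G \<subseteq> {M. rotation_matrix M}"
    and "base_space E = top_of_set (sphere 0 1)"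
    and "complex_G_vector_bundle G T E (\<lambda>g x. \<rho> g *v x) b"
  shows "trivial_G_vector_bundle G T E (\<lambda>g x. \<rho> g *v x) b"
proof -
  interpret compact_lie_group G T d A
    by (rule assms(1))
  interpret circle_bundle G T \<rho> E b
  proof unfold_locales
    show "topspace T = carrier G"
      by (rule topspace_eq)
    show "compact_space T"
      by (rule compact)
    show "continuous_map (prod_topology T T) T (\<lambda>(x, y). x \<otimes>\<^bsub>G\<^esub> y)" "continuous_map T T (\<lambda>x. inv\<^bsub>G\<^esub> x)"
      using smooth_mult smooth_inv by (auto simp: smooth_map_def)
    show "\<rho> (g \<otimes>\<^bsub>G\<^esub> h) = \<rho> g ** \<rho> h" if "g \<in> carrier G" "h \<in> carrier G" for g h
      using assms(2) that by (simp add: orthogonal_representation_def orthogonal_group_def hom_def)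
    show "rotation_matrix (\<rho> g)" if "g \<in> carrier G" for g
      using assms(3) that by blast
    show "continuous_map T euclidean \<rho>"
      using assms(2) by (simp add: orthogonal_representation_def)
  qed (fact assms)+
  obtain N \<xi> \<theta> s where "frame E N \<xi> \<theta> s"
    by (rule frame_exists[OF vb base compact_sphere])
  then interpret framed_circle_bundle G T \<rho> E b N \<xi> \<theta> s
    by unfold_locales
  show ?thesis
    by (rule trivial_framed)
qed

end
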